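(* For any constants $c_0,c_1\in(0,1)$ there exist constants $C_I,C_e,C_e'>0$ (which, for the Censored Block Model, may depend on its constant $\epsilon$) such that the following holds for each of: the $\mathbb{Z}_2$ Synchronization model; the Censored Block Model; and the binary symmetric Stochastic Block Model with $0<c_0p\le q<p\le 1-c_1$. If $nI^*\ge C_I$, then with probability at least $1-10\exp(-\sqrt{\log n})$, every $\widehat Y\in\mathcal{Y}(A)$ satisfies $$\frac1n\|\widehat Y-Y^*\|_1\le\left\lfloor n\exp\left[-\Big(1-C_e\sqrt{\tfrac{1}{nI^*}}\Big)\bar nI^*\right]\right\rfloor$$ and $$\mathrm{err}(\widehat\sigma^{\mathrm{sdp}},\sigma^* )\le\exp\left[-\Big(1-C_e'\sqrt{\tfrac{1}{nI^*}}\Big)\bar nI^*\right],$$ where $\widehat\sigma^{\mathrm{sdp}}\in\{\pm1\}^n$ is the vector of entrywise signs of a top eigenvector of $\widehat Y$.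
   Context: Models. $\sigma^*\in\{\pm1\}^n$ is the (deterministic) ground-truth label vector, $Y^*=\sigma^*(\sigma^* )^\top$. The observed matrix $A\in\mathbb{R}^{n\times n}$ is symmetric with independent entries $\{A_{ij}:i\le j\}$: - $\mathbb{Z}_2$ Synchronization: $A_{ij}\sim N(\sigma_i^*\sigma_j^*,\tau^2)$, $\tau>0$ (may depend on $n$). - Censored Block Model: $A_{ij}=\sigma_i^*\sigma_j^*$ w.p. $\alpha(1-\epsilon)$, $-\sigma_i^*\sigma_j^*$ w.p. $\alpha\epsilon$, $0$ w.p. $1-\alpha$; $\alpha\in(0,1]$ may depend on $n$, $\epsilon\in(0,\frac12)$ is a constant. - Binary symmetric Stochastic Block Model: $\sum_i\sigma_i^*=0$, and $A_{ij}\sim\mathrm{Ber}(p)$ if $\sigma_i^*\sigma_j^*=1$, $A_{ij}\sim\mathrm{Ber}(q)$ if $\sigma_i^*\sigma_j^*=-1$; $0<q<p<1$ may depend on $n$. $I^*=(2\tau^2)^{-1}$, resp. $I^*=(\sqrt{\alpha(1-\epsilon)}-\sqrt{\alpha\epsilon})^2$, resp. $I^*=-2\log[\sqrt{pq}+\sqrt{(1-p)(1-q)}]$ for the three models. $\bar n=n$ for the first two models and $\bar n=n/2$ for the Stochastic Block Model. SDP: maximize $\langle A,Y\rangle=\sum_{i,j}A_{ij}Y_{ij}$ over $Y\in\mathbb{R}^{n\times n}$ with $Y\succeq0$ (symmetric positive semidefinite), $Y_{ii}=1$ for all $i$, and, for the Stochastic Block Model only, additionally $\sum_{i,j}Y_{ij}=0$.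 The sublevel set is $\mathcal{Y}(A)=\{Y: Y\text{ is feasible for the SDP},\ \langle A,Y\rangle\ge\langle A,Y^*\rangle\}$. $\|M\|_1=\sum_{i,j}|M_{ij}|$. $\mathrm{err}(\sigma,\sigma')=\min_{g\in\{\pm1\}}\frac1n\sum_{i=1}^n\mathbf{1}\{g\sigma_i\ne\sigma'_i\}$. The sign of $0$ is taken to be $1$; a top eigenvector is an eigenvector for the largest eigenvalue. *)

theory Defs
  imports "HOL-Probability.Probability" "Jordan_Normal_Form.Char_Poly"
begin

unbundle no vec_syntax and no inner_syntax

text \<open>
  The dimension \<open>n\<close> is quantified inside the theorem, after the constants, so matrices and vectors
  are the dimension-carrying ones of \<^theory>\<open>Jordan_Normal_Form.Matrix\<close>, with indices
  \<open>0, \<dots>, n - 1\<close>.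
\<close>

definition label_vec :: "nat \<Rightarrow> real Matrix.vec \<Rightarrow> bool" where
  "label_vec n \<sigma> \<longleftrightarrow> \<sigma> \<in> carrier_vec n \<and> (\<forall>i<n. \<sigma> $ i \<in> {1, -1})"

definition balanced :: "nat \<Rightarrow> real Matrix.vec \<Rightarrow> bool" where
  "balanced n \<sigma> \<longleftrightarrow> (\<Sum>i<n. \<sigma> $ i) = 0"

definition truth_mat :: "nat \<Rightarrow> real Matrix.vec \<Rightarrow> real mat" where
  "truth_mat n \<sigma> = mat n n (\<lambda>(i, j). \<sigma> $ i * \<sigma> $ j)"

definition mat_inner :: "nat \<Rightarrow> real mat \<Rightarrow> real mat \<Rightarrow> real" where
  "mat_inner n A B = (\<Sum>i<n. \<Sum>j<n. A $$ (i, j) * B $$ (i, j))"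

definition entry_l1_norm :: "nat \<Rightarrow> real mat \<Rightarrow> real" where
  "entry_l1_norm n A = (\<Sum>i<n. \<Sum>j<n. \<bar>A $$ (i, j)\<bar>)"

definition psd :: "nat \<Rightarrow> real mat \<Rightarrow> bool" where
  "psd n Y \<longleftrightarrow> Y \<in> carrier_mat n n \<and> transpose_mat Y = Y
     \<and> (\<forall>v \<in> carrier_vec n. 0 \<le> v \<bullet> (Y *\<^sub>v v))"

definition sdp_feasible :: "nat \<Rightarrow> real mat set" where
  "sdp_feasible n = {Y. psd n Y \<and> (\<forall>i<n. Y $$ (i, i) = 1)}"

definition sdp_feasible_balanced :: "nat \<Rightarrow> real mat set" where
  "sdp_feasible_balanced n = {Y \<in> sdp_feasible n. (\<Sum>i<n. \<Sum>j<n. Y $$ (i, j)) = 0}"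

definition sublevel_set :: "nat \<Rightarrow> real mat set \<Rightarrow> real Matrix.vec \<Rightarrow> real mat \<Rightarrow> real mat set" where
  "sublevel_set n F \<sigma> A = {Y \<in> F. mat_inner n A (truth_mat n \<sigma>) \<le> mat_inner n A Y}"

definition err :: "nat \<Rightarrow> real Matrix.vec \<Rightarrow> real Matrix.vec \<Rightarrow> real" where
  "err n \<sigma> \<sigma>' = Min ((\<lambda>g. real (card {i. i < n \<and> g * \<sigma> $ i \<noteq> \<sigma>' $ i}) / real n) ` {1, -1})"

definition top_eigenvector :: "real mat \<Rightarrow> real Matrix.vec \<Rightarrow> bool" where
  "top_eigenvector Y v \<longleftrightarrow> (\<exists>k. eigenvector Y v k \<and> (\<forall>k'. eigenvalue Y k' \<longrightarrow> k' \<le> k))"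

text \<open>The library's \<^const>\<open>sgn\<close> is not used here, because the sign of \<open>0\<close> has to be \<open>1\<close>.\<close>

definition sign_vec :: "real Matrix.vec \<Rightarrow> real Matrix.vec" where
  "sign_vec v = map_vec (\<lambda>x. if 0 \<le> x then 1 else -1) v"

text \<open>
  In all three models the law of \<open>A\<^sub>i\<^sub>j\<close> is a function \<open>D\<close> of \<open>\<sigma>\<^sub>i \<sigma>\<^sub>j\<close>.  The joint law of the
  independent entries with \<open>i \<le> j\<close> is their product measure; a sample \<open>\<omega>\<close> determines the
  symmetric matrix \<open>observed_mat n \<omega>\<close>.
\<close>

definition entries_law ::
  "nat \<Rightarrow> (real \<Rightarrow> real measure) \<Rightarrow> real Matrix.vec \<Rightarrow> (nat \<times> nat \<Rightarrow> real) measure" where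
  "entries_law n D \<sigma> = PiM {(i, j). i \<le> j \<and> j < n} (\<lambda>(i, j). D (\<sigma> $ i * \<sigma> $ j))"

definition observed_mat :: "nat \<Rightarrow> (nat \<times> nat \<Rightarrow> real) \<Rightarrow> real mat" where
  "observed_mat n \<omega> = mat n n (\<lambda>(i, j). \<omega> (min i j, max i j))"

definition borel_of_pmf :: "real pmf \<Rightarrow> real measure" where
  "borel_of_pmf P = distr (measure_pmf P) borel (\<lambda>x. x)"

definition sync_entry :: "real \<Rightarrow> real \<Rightarrow> real measure" where
  "sync_entry \<tau> s = density lborel (normal_density s \<tau>)"

definition censored_entry :: "real \<Rightarrow> real \<Rightarrow> real \<Rightarrow> real measure" where
  "censored_entry \<alpha> \<epsilon> s =
     borel_of_pmf (pmf_of_list [(s, \<alpha> * (1 - \<epsilon>)), (- s, \<alpha> * \<epsilon>), (0, 1 - \<alpha>)])"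

lemma censored_entry_wf:
  fixes \<alpha> \<epsilon> s :: real
  assumes "0 < \<alpha>" "\<alpha> \<le> 1" "0 < \<epsilon>" "\<epsilon> < 1/2"
  shows "pmf_of_list_wf [(s, \<alpha> * (1 - \<epsilon>)), (- s, \<alpha> * \<epsilon>), (0, 1 - \<alpha>)]"
  using assms by (auto simp: pmf_of_list_wf_def right_diff_distrib intro: mult_nonneg_nonneg)

definition sbm_entry :: "real \<Rightarrow> real \<Rightarrow> real \<Rightarrow> real measure" where
  "sbm_entry p q s = borel_of_pmf (map_pmf of_bool (bernoulli_pmf (if s = 1 then p else q)))"

definition sync_info :: "real \<Rightarrow> real" where
  "sync_info \<tau> = 1 / (2 * \<tau>\<^sup>2)"

definition censored_info :: "real \<Rightarrow> real \<Rightarrow> real" where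
  "censored_info \<alpha> \<epsilon> = (sqrt (\<alpha> * (1 - \<epsilon>)) - sqrt (\<alpha> * \<epsilon>))\<^sup>2"

definition sbm_info :: "real \<Rightarrow> real \<Rightarrow> real" where
  "sbm_info p q = - 2 * ln (sqrt (p * q) + sqrt ((1 - p) * (1 - q)))"

text \<open>
  Stated through a measurable event contained in \<open>{\<omega>. Q \<omega>}\<close>, since the library's \<^const>\<open>measure\<close>
  is \<open>0\<close> on non-measurable sets and \<open>Q\<close> will quantify over uncountably many matrices.
\<close>

definition with_prob_at_least :: "'a measure \<Rightarrow> real \<Rightarrow> ('a \<Rightarrow> bool) \<Rightarrow> bool" where
  "with_prob_at_least M r Q \<longleftrightarrow> (\<exists>E \<in> sets M. r \<le> measure M E \<and> (\<forall>\<omega>\<in>E. Q \<omega>))"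

text \<open>
  Here \<open>F\<close> is the feasible set of the SDP, \<open>I\<close> the information quantity of the model and
  \<open>m\<close> the effective size: \<open>n\<close>, or \<open>n / 2\<close> for the stochastic block model.
\<close>

definition sdp_error_bounds ::
  "nat \<Rightarrow> (real \<Rightarrow> real measure) \<Rightarrow> real mat set \<Rightarrow> real Matrix.vec \<Rightarrow> real \<Rightarrow> real
     \<Rightarrow> real \<Rightarrow> real \<Rightarrow> bool" where
  "sdp_error_bounds n D F \<sigma> I m C\<^sub>e C\<^sub>e' \<longleftrightarrow>
     with_prob_at_least (entries_law n D \<sigma>) (1 - 10 * exp (- sqrt (ln (real n)))) (\<lambda>\<omega>.
       \<forall>Y \<in> sublevel_set n F \<sigma> (observed_mat n \<omega>).
         entry_l1_norm n (Y - truth_mat n \<sigma>) / real n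
           \<le> of_int \<lfloor>real n * exp (- ((1 - C\<^sub>e * sqrt (1 / (real n * I))) * m * I))\<rfloor> \<and>
         (\<forall>v. top_eigenvector Y v \<longrightarrow>
            err n (sign_vec v) \<sigma> \<le> exp (- ((1 - C\<^sub>e' * sqrt (1 / (real n * I))) * m * I))))"

end

theory Submission
  imports Defs
begin

text \<open>
  Let \<open>Y\<close> lie in the sublevel set, let \<open>X\<close> be the compression of \<open>Y\<close> to the orthogonal complement of
  \<open>\<sigma>\<close>, and let \<open>D i = (\<Sum>j. A i j * \<sigma> i * \<sigma> j)\<close>.  Then \<open>X\<close> is a Gram matrix with diagonal entries at most
  \<open>4\<close> and trace \<open>\<gamma> = \<parallel>Y - Y*\<parallel> / n\<close>, it annihilates the mean of \<open>A\<close>, and \<open>\<langle>A, Y\<rangle> \<ge> \<langle>A, Y*\<rangle>\<close> becomes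
  \<open>(\<Sum>i. D i * X i i) \<le> \<langle>W, X\<rangle>\<close> with \<open>W = A - E A\<close>.  If \<open>\<langle>W, X\<rangle> \<le> \<theta> * \<gamma>\<close>, averaging produces a set \<open>S\<close>
  of about \<open>\<gamma> / 4\<close> indices with \<open>(\<Sum>i\<in>S. D i) \<le> \<theta> * card S\<close>; the Chernoff bound at the optimal
  exponent together with a union bound over \<open>S\<close> excludes this unless \<open>\<gamma>\<close> is below the claimed rate.
  Integrality of \<open>card S\<close> yields the floor: below one index, \<open>\<gamma>\<close> has to vanish.

  The bound \<open>\<langle>W, X\<rangle> \<le> \<theta> * \<gamma>\<close> with \<open>\<theta>\<close> of order \<open>sqrt (n * v)\<close>, where \<open>v\<close> is the entry variance, needs no
  spectral theory: quadratic forms are reduced to integer vectors, pairs with a small product are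
  handled by a union bound, and in the sparse models the remaining pairs by the discrepancy argument of
  Feige and Ofek after removing the rows of very large degree, whose contribution is bounded separately.
\<close>

section \<open>Positive semidefinite matrices\<close>

text \<open>The compression loses nothing because \<open>diag D - A\<close> annihilates \<sigma>:
  \<open>D i * \<sigma> i\<close> is the \<open>i\<close>-th entry of \<open>A\<close> applied to
  \<sigma>. Hence \<open>A - diag D\<close> has the same form on \<open>Y\<close> and on
  \<open>X\<close>, and on \<open>Y\<close> it is the nonnegative gap of the objective. Per index of
  \<open>S\<close>, choosing the set costs \<open>1 + ln (n / card S)\<close>, the slack \<theta>
  costs \<open>t * \<theta>\<close> at tilt \<open>t\<close>, of order \<open>sqrt (n * I)\<close>,
  and the Chernoff gain is \<open>(n - card S + 1) * J\<close>, where \<open>n * J\<close> is the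
  exponent of the rate. The balance lies at \<open>card S\<close> about
  \<open>n * exp (- n * J)\<close>, up to a factor exponential in \<open>sqrt (n * I)\<close>. The
  missing \<open>card S * J\<close> is tolerable only for sets of size of order
  \<open>n / sqrt (n * I)\<close>, so a crude bound on \<gamma> has to come first; it compares the
  noise on \<open>Y\<close> and on the truth with the signal in the mean. The obstacle is that the
  expected degree may stay bounded. Then \<theta> must be free of logarithms, which a net with
  Bernstein's inequality alone cannot give, since large entries of net vectors leave the range of
  the Gaussian moment bound.\<close>

lemma gram_decomposition:
  fixes y :: "nat \<Rightarrow> nat \<Rightarrow> real"
  assumes "\<And>i j. i < n \<Longrightarrow> j < n \<Longrightarrow> y i j = y j i"
    and "\<And>v. 0 \<le> (\<Sum>i<n. \<Sum>j<n. v i * y i j * v j)"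
  shows "\<exists>b. \<forall>i<n. \<forall>j<n. y i j = (\<Sum>k<n. b k i * b k j)"
  using assms
proof (induction n arbitrary: y)
  case 0
  then show ?case by simp
next
  case (Suc n)
  note sym = Suc.prems(1) and psd = Suc.prems(2)
  have expand: "(\<Sum>i<Suc n. \<Sum>j<Suc n. v i * y i j * v j) =
      (\<Sum>i<n. \<Sum>j<n. v i * y i j * v j) + 2 * v n * (\<Sum>i<n. v i * y i n) + y n n * (v n)\<^sup>2" for v
  proof -
    have "(\<Sum>j<n. v n * y n j * v j) = v n * (\<Sum>j<n. v j * y j n)"
      unfolding sum_distrib_left by (intro sum.cong) (auto simp: sym)
    moreover have "(\<Sum>i<n. v i * y i n * v n) = v n * (\<Sum>j<n. v j * y j n)"
      unfolding sum_distrib_left by (intro sum.cong) auto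
    ultimately show ?thesis by (simp add: sum.distrib power2_eq_square algebra_simps)
  qed
  show ?case
  proof (cases "y n n = 0")
    case True
    have z: "y i n = 0" if "i < n" for i
    proof (rule ccontr)
      assume nz: "y i n \<noteq> 0"
      \<comment> \<open>A zero diagonal entry forces its column to vanish: with this
        \<open>c\<close> the form at \<open>e_i + c * e_n\<close> equals
        \<open>y i i + 2 * c * y i n = -1\<close>.\<close>
      define c where "c = - (y i i + 1) / (2 * y i n)"
      define v where "v = (\<lambda>l. if l = i then 1 else if l = n then c else (0::real))"
      have s1: "(\<Sum>l<n. v l * f l) = f i" for f :: "nat \<Rightarrow> real"
      proof -
        have "(\<Sum>l<n. v l * f l) = (\<Sum>l<n. if l = i then f l else 0)"
          by (intro sum.cong) (auto simp: v_def)
        then show ?thesis using that by (simp add: sum.delta)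
      qed
      have "(\<Sum>a<n. \<Sum>b<n. v a * y a b * v b) = (\<Sum>a<n. v a * (\<Sum>b<n. v b * y a b))"
        by (simp add: sum_distrib_left mult_ac)
      also have "\<dots> = y i i" by (simp only: s1)
      finally have "0 \<le> y i i + 2 * c * y i n"
        using psd[of v] expand[of v] s1[of "\<lambda>l. y l n"] that True by (simp add: v_def)
      then show False using nz by (simp add: c_def field_simps)
    qed
    have "\<exists>b. \<forall>i<n. \<forall>j<n. y i j = (\<Sum>k<n. b k i * b k j)"
    proof (rule Suc.IH)
      show "y i j = y j i" if "i < n" "j < n" for i j using sym that by simp
      show "0 \<le> (\<Sum>i<n. \<Sum>j<n. v i * y i j * v j)" for v
        using psd[of "v(n := 0)"] expand[of "v(n := 0)"] by simp
    qed
    then obtain b where b: "\<And>i j. i < n \<Longrightarrow> j < n \<Longrightarrow> y i j = (\<Sum>k<n. b k i * b k j)" by blast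
    define b' where "b' = (\<lambda>k i. if k < n \<and> i < n then b k i else 0)"
    have "y i j = (\<Sum>k<Suc n. b' k i * b' k j)" if "i < Suc n" "j < Suc n" for i j
      using that b[of i j] z sym[of n j] True by (auto simp: b'_def less_Suc_eq)
    then show ?thesis by blast
  next
    case False
    define e where "e = (\<lambda>i. if i = n then 1 else (0::real))"
    have pos: "y n n > 0" using psd[of e] expand[of e] False by (simp add: e_def)
    \<comment> \<open>The Schur complement of the last diagonal entry. Its form is that of
      \<open>y\<close> minimised over the last coordinate, attained at \<open>- s / y n n\<close>,
      so it is again semidefinite; the normalised last column is the additional Gram row.\<close>
    define z where "z = (\<lambda>i j. y i j - y i n * y j n / y n n)"
    have "\<exists>b. \<forall>i<n. \<forall>j<n. z i j = (\<Sum>k<n. b k i * b k j)"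
    proof (rule Suc.IH)
      show "z i j = z j i" if "i < n" "j < n" for i j using sym[of i j] that by (simp add: z_def)
      fix v :: "nat \<Rightarrow> real"
      define s where "s = (\<Sum>i<n. v i * y i n)"
      have "(\<Sum>i<n. \<Sum>j<n. v i * z i j * v j) =
        (\<Sum>i<n. \<Sum>j<n. v i * y i j * v j) - (\<Sum>i<n. \<Sum>j<n. (v i * y i n) * (v j * y j n)) / y n n"
        by (simp add: z_def sum_subtractf[symmetric] sum_divide_distrib algebra_simps)
      also have "(\<Sum>i<n. \<Sum>j<n. (v i * y i n) * (v j * y j n)) = s\<^sup>2"
        by (simp add: s_def power2_eq_square sum_product)
      finally have eq: "(\<Sum>i<n. \<Sum>j<n. v i * z i j * v j) = (\<Sum>i<n. \<Sum>j<n. v i * y i j * v j) - s\<^sup>2 / y n n" .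
      define w where "w = v(n := - s / y n n)"
      have "0 \<le> (\<Sum>i<n. \<Sum>j<n. v i * y i j * v j) + 2 * w n * s + y n n * (w n)\<^sup>2"
        using psd[of w] expand[of w] by (simp add: w_def s_def)
      moreover have "2 * w n * s + y n n * (w n)\<^sup>2 = - s\<^sup>2 / y n n"
        using pos by (simp add: w_def field_simps power2_eq_square)
      ultimately have "0 \<le> (\<Sum>i<n. \<Sum>j<n. v i * y i j * v j) + - s\<^sup>2 / y n n" by linarith
      then show "0 \<le> (\<Sum>i<n. \<Sum>j<n. v i * z i j * v j)" unfolding eq by simp
    qed
    then obtain b where b: "\<And>i j. i < n \<Longrightarrow> j < n \<Longrightarrow> z i j = (\<Sum>k<n. b k i * b k j)" by blast
    define b' where "b' = (\<lambda>k i. if k = n then y i n / sqrt (y n n) else if i < n then b k i else 0)"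
    have "y i j = (\<Sum>k<Suc n. b' k i * b' k j)" if "i < Suc n" "j < Suc n" for i j
    proof -
      have l: "b' n i * b' n j = y i n * y j n / y n n"
        using pos by (simp add: b'_def)
      have "(\<Sum>k<n. b' k i * b' k j) = z i j"
      proof (cases "i < n \<and> j < n")
        case True
        then show ?thesis using b[of i j] by (auto simp: b'_def intro!: sum.cong)
      next
        case False
        then have "z i j = 0" using that pos sym[of n j] by (auto simp: z_def less_Suc_eq)
        moreover have "(\<Sum>k<n. b' k i * b' k j) = 0" using False that
          by (intro sum.neutral) (auto simp: b'_def)
        ultimately show ?thesis by simp
      qed
      then show ?thesis using l by (simp add: z_def)
    qed
    then show ?thesis by blast
  qed
qed

text \<open>The weights are a fractional choice of \<kappa> indices, and an integral choice does at
  least as well: \<open>S\<close> collects the \<open>k\<close> largest values, whose average only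
  grows when \<kappa> is rounded down. The \<open>max 1\<close> covers \<kappa> below one, where a
  single index of largest value beats every weighted average.\<close>

lemma card_subset_sum_ge_weighted_sum:
  fixes w y :: "nat \<Rightarrow> real"
  assumes w: "\<And>i. i < n \<Longrightarrow> 0 \<le> w i" "\<And>i. i < n \<Longrightarrow> w i \<le> 1"
    and \<kappa>: "\<kappa> = (\<Sum>i<n. w i)" "\<kappa> > 0"
    and k: "k = max 1 (nat \<lfloor>\<kappa>\<rfloor>)"
  shows "\<exists>S. S \<subseteq> {..<n} \<and> card S = k \<and> k * (\<Sum>i<n. w i * y i) \<le> \<kappa> * (\<Sum>i\<in>S. y i)"
proof -
  have "\<kappa> \<le> n" using sum_mono[of "{..<n}" w "\<lambda>_. 1"] w \<kappa> by simp
  have "n \<noteq> 0" using \<kappa> by (intro notI) auto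
  then have kn: "k \<le> n" using \<open>\<kappa> \<le> n\<close> k by linarith
  define F where "F = {S. S \<subseteq> {..<n} \<and> card S = k}"
  have finF: "finite F" unfolding F_def by (rule finite_subset[of _ "Pow {..<n}"]) auto
  have "{..<k} \<in> F" using kn by (auto simp: F_def)
  then have "F \<noteq> {}" by blast
  then obtain S where S: "S \<in> F" and mx: "\<And>T. T \<in> F \<Longrightarrow> sum y T \<le> sum y S"
    using obtains_MAX[OF finF, of "sum y"] Max_ge[OF finite_imageI[OF finF], of _ "sum y"] by (metis image_eqI)
  have finS: "finite S" and SF: "S \<subseteq> {..<n}" "card S = k"
    using S finite_subset by (auto simp: F_def)
  have "S \<noteq> {}" using SF k by auto
  define c where "c = Min (y ` S)"
  have cS: "c \<le> y i" if "i \<in> S" for i using that finS by (simp add: c_def)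
  obtain m where m: "m \<in> S" "y m = c"
    using Min_in[of "y ` S"] finS \<open>S \<noteq> {}\<close> unfolding c_def by fastforce
  \<comment> \<open>Exchange argument: replacing a minimal element of \<open>S\<close> by an outside
    index cannot increase the sum, so \<open>c\<close> separates the values in \<open>S\<close> from
    the others.\<close>
  have out: "y j \<le> c" if "j < n" "j \<notin> S" for j
  proof -
    have "insert j (S - {m}) \<in> F" using that m SF finS card_Suc_Diff1[of S m] by (auto simp: F_def)
    from mx[OF this] have "y j + (sum y S - y m) \<le> sum y S"
      using that m finS by (simp add: sum_diff1)
    then show ?thesis using m by simp
  qed
  have "(\<Sum>i<n. w i * y i) = \<kappa> * c + (\<Sum>i<n. w i * (y i - c))"
    by (simp add: \<kappa> sum_distrib_right right_diff_distrib sum_subtractf)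
  also have "(\<Sum>i<n. w i * (y i - c)) = (\<Sum>i\<in>S. w i * (y i - c)) + (\<Sum>i\<in>{..<n} - S. w i * (y i - c))"
    using SF by (simp add: sum.subset_diff)
  also have "(\<Sum>i\<in>{..<n} - S. w i * (y i - c)) \<le> 0"
    using out w by (intro sum_nonpos) (auto intro: mult_nonneg_nonpos)
  finally have 1: "(\<Sum>i<n. w i * y i) \<le> \<kappa> * c + (\<Sum>i\<in>S. w i * (y i - c))" by simp
  have 2: "k * (\<Sum>i\<in>S. w i * (y i - c)) \<le> \<kappa> * (\<Sum>i\<in>S. y i - c)"
  proof (cases "\<kappa> \<ge> 1")
    case True
    then have "real k \<le> \<kappa>" using k by linarith
    moreover have "(\<Sum>i\<in>S. w i * (y i - c)) \<le> (\<Sum>i\<in>S. y i - c)"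
      using w SF cS by (intro sum_mono) (auto intro!: mult_left_le_one_le)
    moreover have "0 \<le> (\<Sum>i\<in>S. w i * (y i - c))"
      using w SF cS by (intro sum_nonneg) auto
    ultimately show ?thesis using \<kappa> by (intro mult_mono) auto
  next
    case False
    then have "k = 1" using k \<kappa> by auto
    then obtain l where "S = {l}" using SF by (auto simp: card_1_singleton_iff)
    then show ?thesis using m by simp
  qed
  have 3: "(\<Sum>i\<in>S. y i - c) = (\<Sum>i\<in>S. y i) - k * c" using SF by (simp add: sum_subtractf)
  have "k * (\<Sum>i<n. w i * y i) \<le> k * (\<kappa> * c + (\<Sum>i\<in>S. w i * (y i - c)))"
    using 1 by (intro mult_left_mono) auto
  also have "\<dots> \<le> \<kappa> * (\<Sum>i\<in>S. y i)" using 2 unfolding 3 by (simp add: algebra_simps)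
  finally show ?thesis using SF by blast
qed

definition bilin :: "nat \<Rightarrow> (nat \<Rightarrow> nat \<Rightarrow> real) \<Rightarrow> (nat \<Rightarrow> real) \<Rightarrow> (nat \<Rightarrow> real) \<Rightarrow> real" where
  "bilin n a u v = (\<Sum>i<n. \<Sum>j<n. u i * a i j * v j)"

lemma bilin_gram:
  "(\<Sum>k<n. bilin n a (x k) (x k)) = (\<Sum>i<n. \<Sum>j<n. a i j * (\<Sum>k<n. x k i * x k j))"
proof -
  have "(\<Sum>k<n. bilin n a (x k) (x k)) = (\<Sum>i<n. \<Sum>k<n. \<Sum>j<n. x k i * a i j * x k j)"
    unfolding bilin_def by (rule sum.swap)
  also have "\<dots> = (\<Sum>i<n. \<Sum>j<n. \<Sum>k<n. x k i * a i j * x k j)"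
    by (intro sum.cong refl sum.swap)
  finally show ?thesis by (simp add: sum_distrib_left mult_ac)
qed

lemma gram_entry_le_one:
  fixes b :: "nat \<Rightarrow> nat \<Rightarrow> real"
  assumes "(\<Sum>k<n. (b k i)\<^sup>2) = 1" "(\<Sum>k<n. (b k j)\<^sup>2) = 1"
  shows "\<bar>\<Sum>k<n. b k i * b k j\<bar> \<le> 1"
proof -
  have "0 \<le> (\<Sum>k<n. (b k i + b k j)\<^sup>2)" "0 \<le> (\<Sum>k<n. (b k i - b k j)\<^sup>2)"
    by (auto intro: sum_nonneg)
  moreover have "(\<Sum>k<n. (b k i + b k j)\<^sup>2) = 2 + 2 * (\<Sum>k<n. b k i * b k j)"
    "(\<Sum>k<n. (b k i - b k j)\<^sup>2) = 2 - 2 * (\<Sum>k<n. b k i * b k j)"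
    using assms by (simp_all add: power2_sum power2_diff sum.distrib sum_subtractf sum_distrib_left mult_ac)
  ultimately show ?thesis by linarith
qed

text \<open>Every Gram row loses its component along \<sigma>. The removed trace is the form of
  \<open>y\<close> at \<sigma> divided by \<open>n\<close>, which is why the remaining trace is an
  average of \<open>1 - \<sigma> i * \<sigma> j * y i j\<close>. The bound 4 comes from
  \<open>(p - q)^2 \<le> 2 * p^2 + 2 * q^2\<close>, as both parts have squared length at most
  one.\<close>

lemma projected_gram:
  fixes a y :: "nat \<Rightarrow> nat \<Rightarrow> real" and \<sigma> :: "nat \<Rightarrow> real"
  assumes n: "n > 0" and \<sigma>: "\<And>i. i < n \<Longrightarrow> (\<sigma> i)\<^sup>2 = 1"
    and b: "\<And>i j. i < n \<Longrightarrow> j < n \<Longrightarrow> y i j = (\<Sum>k<n. b k i * b k j)"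
    and diag: "\<And>i. i < n \<Longrightarrow> y i i = 1"
    and sym: "\<And>i j. i < n \<Longrightarrow> j < n \<Longrightarrow> a i j = a j i"
    and ge: "(\<Sum>i<n. \<Sum>j<n. a i j * (\<sigma> i * \<sigma> j)) \<le> (\<Sum>i<n. \<Sum>j<n. a i j * y i j)"
  defines "x \<equiv> \<lambda>k i. b k i - (\<Sum>l<n. \<sigma> l * b k l) / n * \<sigma> i"
  shows "\<And>i. i < n \<Longrightarrow> (\<Sum>k<n. (x k i)\<^sup>2) \<le> 4"
    and "(\<Sum>i<n. \<Sum>k<n. (x k i)\<^sup>2) = (\<Sum>i<n. \<Sum>j<n. 1 - \<sigma> i * \<sigma> j * y i j) / n"
    and "(\<Sum>i<n. (\<Sum>j<n. a i j * (\<sigma> i * \<sigma> j)) * (\<Sum>k<n. (x k i)\<^sup>2)) \<le> (\<Sum>k<n. bilin n a (x k) (x k))"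
    and "\<And>k. (\<Sum>i<n. \<sigma> i * x k i) = 0"
proof -
  define s where "s = (\<lambda>k. (\<Sum>l<n. \<sigma> l * b k l) / n)"
  have x: "x k i = b k i - s k * \<sigma> i" for k i by (simp add: x_def s_def)
  have s': "(\<Sum>l<n. \<sigma> l * b k l) = n * s k" for k using n by (simp add: s_def)
  have b1: "(\<Sum>k<n. (b k i)\<^sup>2) = 1" if "i < n" for i
    using b[OF that that] diag[OF that] by (simp add: power2_eq_square)
  have ss: "(\<Sum>i<n. (\<sigma> i)\<^sup>2) = n" using \<sigma> by simp
  have x2: "(\<Sum>i<n. (x k i)\<^sup>2) = (\<Sum>i<n. (b k i)\<^sup>2) - n * (s k)\<^sup>2" for k
  proof -
    have "(\<Sum>i<n. (x k i)\<^sup>2) = (\<Sum>i<n. (b k i)\<^sup>2) + (s k)\<^sup>2 * (\<Sum>i<n. (\<sigma> i)\<^sup>2) - 2 * s k * (\<Sum>l<n. \<sigma> l * b k l)"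
      by (simp add: x power2_diff power_mult_distrib sum.distrib sum_subtractf sum_distrib_left mult_ac)
    then show ?thesis unfolding ss s' by (simp add: power2_eq_square)
  qed
  have bsum: "(\<Sum>k<n. \<Sum>i<n. (b k i)\<^sup>2) = n"
    by (subst sum.swap) (simp add: b1)
  have "0 \<le> (\<Sum>k<n. \<Sum>i<n. (x k i)\<^sup>2)" by (intro sum_nonneg) auto
  then have "n * (\<Sum>k<n. (s k)\<^sup>2) \<le> n"
    by (simp add: x2 sum_subtractf bsum sum_distrib_left)
  then have s1: "(\<Sum>k<n. (s k)\<^sup>2) \<le> 1" using n by simp
  show "(\<Sum>k<n. (x k i)\<^sup>2) \<le> 4" if "i < n" for i
  proof -
    have "(x k i)\<^sup>2 \<le> 2 * (b k i)\<^sup>2 + 2 * (s k)\<^sup>2" for k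
    proof -
      have "0 \<le> (b k i + s k * \<sigma> i)\<^sup>2" by simp
      then show ?thesis using \<sigma>[OF that] by (simp add: x power2_diff power2_sum power_mult_distrib)
    qed
    then have "(\<Sum>k<n. (x k i)\<^sup>2) \<le> (\<Sum>k<n. 2 * (b k i)\<^sup>2 + 2 * (s k)\<^sup>2)" by (intro sum_mono)
    also have "\<dots> = 2 + 2 * (\<Sum>k<n. (s k)\<^sup>2)"
      using b1[OF that] by (simp add: sum.distrib sum_distrib_left[symmetric])
    finally show ?thesis using s1 by simp
  qed
  have "(\<Sum>k<n. (n * s k)\<^sup>2) = (\<Sum>i<n. \<Sum>j<n. \<sigma> i * \<sigma> j * y i j)"
  proof -
    have "(\<Sum>k<n. (n * s k)\<^sup>2) = (\<Sum>k<n. bilin n (\<lambda>i j. \<sigma> i * \<sigma> j) (b k) (b k))"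
      unfolding s'[symmetric] bilin_def by (simp add: power2_eq_square sum_product mult_ac)
    also have "\<dots> = (\<Sum>i<n. \<Sum>j<n. \<sigma> i * \<sigma> j * y i j)"
      unfolding bilin_gram by (intro sum.cong refl) (simp add: b)
    finally show ?thesis .
  qed
  then have sq: "n * (\<Sum>k<n. (s k)\<^sup>2) = (\<Sum>i<n. \<Sum>j<n. \<sigma> i * \<sigma> j * y i j) / n"
    using n by (simp add: power_mult_distrib sum_distrib_left[symmetric] power2_eq_square field_simps)
  have "(\<Sum>i<n. \<Sum>k<n. (x k i)\<^sup>2) = n - n * (\<Sum>k<n. (s k)\<^sup>2)"
    by (subst sum.swap) (simp add: x2 sum_subtractf bsum sum_distrib_left)
  then show "(\<Sum>i<n. \<Sum>k<n. (x k i)\<^sup>2) = (\<Sum>i<n. \<Sum>j<n. 1 - \<sigma> i * \<sigma> j * y i j) / n"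
    unfolding sq using n by (simp add: sum_subtractf diff_divide_distrib)
  show "(\<Sum>i<n. \<sigma> i * x k i) = 0" for k
  proof -
    have "(\<Sum>i<n. \<sigma> i * x k i) = (\<Sum>l<n. \<sigma> l * b k l) - s k * (\<Sum>i<n. (\<sigma> i)\<^sup>2)"
      by (simp add: x right_diff_distrib sum_subtractf sum_distrib_left power2_eq_square mult_ac)
    then show ?thesis by (simp add: ss s')
  qed
  define D where "D = (\<lambda>i. \<Sum>j<n. a i j * (\<sigma> i * \<sigma> j))"
  have D\<sigma>: "(\<Sum>i<n. \<sigma> i * a i j) = \<sigma> j * D j" if "j < n" for j
  proof -
    have "\<sigma> j * D j = (\<Sum>i<n. (\<sigma> j)\<^sup>2 * (a j i * \<sigma> i))"
      unfolding D_def sum_distrib_left by (intro sum.cong) (auto simp: power2_eq_square)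
    also have "\<dots> = (\<Sum>i<n. \<sigma> i * a i j)" using \<sigma>[OF that] sym that by (intro sum.cong) auto
    finally show ?thesis by simp
  qed
  \<comment> \<open>Since \<open>a\<close> maps \<sigma> to the vector
    \<open>\<sigma> j * D j\<close>, the cross terms and the \<sigma> terms of the two forms agree
    and cancel in the difference.\<close>
  have key: "bilin n a (x k) (x k) - (\<Sum>i<n. D i * (x k i)\<^sup>2)
      = bilin n a (b k) (b k) - (\<Sum>i<n. D i * (b k i)\<^sup>2)" for k
  proof -
    have 1: "bilin n a \<sigma> v = (\<Sum>j<n. \<sigma> j * D j * v j)" for v
    proof -
      have "bilin n a \<sigma> v = (\<Sum>j<n. (\<Sum>i<n. \<sigma> i * a i j) * v j)"
        unfolding bilin_def by (subst sum.swap) (simp add: sum_distrib_right)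
      then show ?thesis by (simp add: D\<sigma>)
    qed
    have 2: "bilin n a v \<sigma> = bilin n a \<sigma> v" for v
      unfolding bilin_def by (subst sum.swap) (auto intro!: sum.cong simp: sym)
    have "bilin n a (x k) (x k) = bilin n a (b k) (b k) - s k * bilin n a (b k) \<sigma>
        - s k * bilin n a \<sigma> (b k) + (s k)\<^sup>2 * bilin n a \<sigma> \<sigma>"
    proof -
      have "bilin n a (x k) (x k) = (\<Sum>i<n. \<Sum>j<n. b k i * a i j * b k j - s k * (b k i * a i j * \<sigma> j)
          - s k * (\<sigma> i * a i j * b k j) + (s k)\<^sup>2 * (\<sigma> i * a i j * \<sigma> j))"
        unfolding bilin_def by (intro sum.cong refl) (simp add: x algebra_simps power2_eq_square)
      then show ?thesis
        by (simp only: bilin_def sum.distrib sum_subtractf sum_distrib_left)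
    qed
    also have "\<dots> = bilin n a (b k) (b k) - 2 * s k * (\<Sum>j<n. \<sigma> j * D j * b k j) + (s k)\<^sup>2 * (\<Sum>j<n. D j * (\<sigma> j)\<^sup>2)"
      by (simp add: 1 2[of "b k"] power2_eq_square mult_ac)
    finally have 3: "bilin n a (x k) (x k) = \<dots>" .
    have "(\<Sum>i<n. D i * (x k i)\<^sup>2) = (\<Sum>i<n. D i * (b k i)\<^sup>2) - 2 * s k * (\<Sum>j<n. \<sigma> j * D j * b k j) + (s k)\<^sup>2 * (\<Sum>j<n. D j * (\<sigma> j)\<^sup>2)"
    proof -
      have "(\<Sum>i<n. D i * (x k i)\<^sup>2) = (\<Sum>i<n. D i * (b k i)\<^sup>2 - 2 * s k * (\<sigma> i * D i * b k i) + (s k)\<^sup>2 * (D i * (\<sigma> i)\<^sup>2))"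
        by (intro sum.cong refl) (simp add: x algebra_simps power2_eq_square)
      then show ?thesis by (simp only: sum.distrib sum_subtractf sum_distrib_left)
    qed
    with 3 show ?thesis by simp
  qed
  have "(\<Sum>k<n. \<Sum>i<n. D i * (b k i)\<^sup>2) = (\<Sum>i<n. D i)"
    by (subst sum.swap) (simp add: sum_distrib_left[symmetric] b1)
  moreover have "(\<Sum>k<n. bilin n a (b k) (b k)) = (\<Sum>i<n. \<Sum>j<n. a i j * y i j)"
    unfolding bilin_gram by (intro sum.cong refl) (simp add: b)
  ultimately have "0 \<le> (\<Sum>k<n. bilin n a (b k) (b k) - (\<Sum>i<n. D i * (b k i)\<^sup>2))"
    using ge by (simp add: sum_subtractf D_def)
  also have "\<dots> = (\<Sum>k<n. bilin n a (x k) (x k)) - (\<Sum>k<n. \<Sum>i<n. D i * (x k i)\<^sup>2)"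
    by (simp add: key[symmetric] sum_subtractf)
  also have "(\<Sum>k<n. \<Sum>i<n. D i * (x k i)\<^sup>2) = (\<Sum>i<n. D i * (\<Sum>k<n. (x k i)\<^sup>2))"
    by (subst sum.swap) (simp add: sum_distrib_left)
  finally show "(\<Sum>i<n. (\<Sum>j<n. a i j * (\<sigma> i * \<sigma> j)) * (\<Sum>k<n. (x k i)\<^sup>2)) \<le> (\<Sum>k<n. bilin n a (x k) (x k))"
    by (simp add: D_def)
qed

text \<open>The dimension is a variable, so vectors are functions vanishing from \<open>n\<close>
  on. The sphere is closed in a product of intervals, which is compact by Tychonoff.\<close>

lemma compact_coordinate_sphere: "compact {f :: nat \<Rightarrow> real. (\<forall>i\<ge>n. f i = 0) \<and> (\<Sum>i<n. (f i)\<^sup>2) = 1}"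
proof -
  define B where "B = PiE UNIV (\<lambda>i. if i < n then {-1..1} else {0 :: real})"
  have "compactin (product_topology (\<lambda>_. euclidean) UNIV) B"
    unfolding B_def compactin_PiE by auto
  then have cB: "compact B" by (simp add: euclidean_product_topology)
  have "closed {f :: nat \<Rightarrow> real. (\<Sum>i<n. (f i)\<^sup>2) = 1}"
    by (intro closed_Collect_eq continuous_intros) auto
  moreover have "{f :: nat \<Rightarrow> real. (\<forall>i\<ge>n. f i = 0) \<and> (\<Sum>i<n. (f i)\<^sup>2) = 1} = B \<inter> {f. (\<Sum>i<n. (f i)\<^sup>2) = 1}"
  proof -
    have "f i \<in> {-1..1}" if "(\<Sum>i<n. (f i)\<^sup>2) = 1" "i < n" for f :: "nat \<Rightarrow> real" and i
    proof -
      have "(f i)\<^sup>2 \<le> (\<Sum>i<n. (f i)\<^sup>2)" using that(2) by (intro member_le_sum) auto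
      then show ?thesis using that abs_square_le_1[of "f i"] by auto
    qed
    moreover have "f \<in> B \<longleftrightarrow> (\<forall>i. if i < n then f i \<in> {-1..1} else f i = 0)" for f
      by (auto simp: B_def PiE_iff split: if_splits)
    ultimately show ?thesis by (auto simp: not_less[symmetric])
  qed
  ultimately show ?thesis using compact_Int_closed[OF cB] by simp
qed

text \<open>Take a maximiser of the form on the unit sphere. Homogeneity extends its maximality to
  all vectors, and the first-order condition along each coordinate direction is the eigenvector
  equation.\<close>

lemma symmetric_rayleigh_eigenvector:
  fixes y :: "nat \<Rightarrow> nat \<Rightarrow> real"
  assumes n: "n > 0" and sym: "\<And>i j. i < n \<Longrightarrow> j < n \<Longrightarrow> y i j = y j i"
  shows "\<exists>l f. (\<Sum>i<n. (f i)\<^sup>2) = 1 \<and> (\<forall>i<n. (\<Sum>j<n. y i j * f j) = l * f i)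
    \<and> (\<forall>x. bilin n y x x \<le> l * (\<Sum>i<n. (x i)\<^sup>2))"
proof -
  define K where "K = {f :: nat \<Rightarrow> real. (\<forall>i\<ge>n. f i = 0) \<and> (\<Sum>i<n. (f i)\<^sup>2) = 1}"
  have "(\<lambda>i. if i = 0 then 1 else 0) \<in> K"
    using n by (auto simp: K_def if_distrib[of "\<lambda>x. x\<^sup>2"] sum.delta cong: if_cong)
  then have ne: "K \<noteq> {}" by blast
  have "compact K" unfolding K_def by (rule compact_coordinate_sphere)
  moreover have "continuous_on K (\<lambda>f. bilin n y f f)"
    unfolding bilin_def by (intro continuous_intros continuous_on_subset[OF continuous_on_product_coordinates]) auto
  ultimately obtain f where f: "f \<in> K" and mx: "\<And>g. g \<in> K \<Longrightarrow> bilin n y g g \<le> bilin n y f f"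
    using continuous_attains_sup[of K "\<lambda>f. bilin n y f f"] ne by blast
  define l where "l = bilin n y f f"
  have f1: "(\<Sum>i<n. (f i)\<^sup>2) = 1" using f by (simp add: K_def)
  have ray: "bilin n y x x \<le> l * (\<Sum>i<n. (x i)\<^sup>2)" for x
  proof (cases "(\<Sum>i<n. (x i)\<^sup>2) = 0")
    case True
    then have "x i = 0" if "i < n" for i using that by (simp add: sum_nonneg_eq_0_iff)
    then show ?thesis using True by (simp add: bilin_def)
  next
    case False
    define r where "r = sqrt (\<Sum>i<n. (x i)\<^sup>2)"
    have r2: "r\<^sup>2 = (\<Sum>i<n. (x i)\<^sup>2)" by (simp add: r_def sum_nonneg)
    have r0: "r \<noteq> 0" using False r2 by auto
    define g where "g = (\<lambda>i. if i < n then x i / r else 0)"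
    have "(\<Sum>i<n. (g i)\<^sup>2) = (\<Sum>i<n. (x i)\<^sup>2) / r\<^sup>2"
      unfolding sum_divide_distrib by (intro sum.cong) (auto simp: g_def power_divide)
    then have "g \<in> K" using r2 r0 False by (simp add: K_def g_def)
    from mx[OF this] have "bilin n y g g \<le> l" by (simp add: l_def)
    moreover have "bilin n y g g = bilin n y x x / r\<^sup>2"
      unfolding bilin_def sum_divide_distrib by (intro sum.cong refl) (auto simp: g_def power2_eq_square)
    ultimately show ?thesis using r0 by (simp add: r2[symmetric] field_simps)
  qed
  have "(\<Sum>j<n. y i j * f j) = l * f i" if i: "i < n" for i
  proof -
    define e where "e = (\<lambda>j. if j = i then 1 else (0 :: real))"
    define P where "P = l - y i i"
    define B where "B = l * f i - (\<Sum>j<n. y i j * f j)"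
    have e1: "(\<Sum>j<n. g j * e j) = g i" for g :: "nat \<Rightarrow> real"
      using i by (simp add: e_def if_distrib sum.delta cong: if_cong)
    have yee: "bilin n y e e = y i i"
    proof -
      have "bilin n y e e = (\<Sum>a<n. (\<Sum>b<n. y a b * e b) * e a)"
        unfolding bilin_def sum_distrib_right by (simp add: mult_ac)
      then show ?thesis by (simp add: e1)
    qed
    have yfe: "bilin n y f e = (\<Sum>j<n. y i j * f j)"
    proof -
      have "bilin n y f e = (\<Sum>a<n. f a * (\<Sum>b<n. y a b * e b))"
        unfolding bilin_def sum_distrib_left by (simp add: mult_ac)
      then show ?thesis unfolding e1 using sym i by (auto intro!: sum.cong)
    qed
    have yef: "bilin n y e f = (\<Sum>j<n. y i j * f j)"
    proof -
      have "bilin n y e f = (\<Sum>a<n. (\<Sum>b<n. y a b * f b) * e a)"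
        unfolding bilin_def sum_distrib_right by (simp add: mult_ac)
      then show ?thesis by (simp add: e1)
    qed
    have nn: "0 \<le> 2 * c * B + c\<^sup>2 * P" for c
    proof -
      have 1: "bilin n y (\<lambda>j. f j + c * e j) (\<lambda>j. f j + c * e j)
        = bilin n y f f + c * bilin n y f e + c * bilin n y e f + c\<^sup>2 * bilin n y e e"
      proof -
        have "bilin n y (\<lambda>j. f j + c * e j) (\<lambda>j. f j + c * e j) = (\<Sum>a<n. \<Sum>b<n. f a * y a b * f b
          + c * (f a * y a b * e b) + c * (e a * y a b * f b) + c\<^sup>2 * (e a * y a b * e b))"
          unfolding bilin_def by (intro sum.cong refl) (simp add: algebra_simps power2_eq_square)
        then show ?thesis by (simp only: bilin_def sum.distrib sum_distrib_left)
      qed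
      have "(\<Sum>j<n. (f j + c * e j)\<^sup>2) = (\<Sum>j<n. (f j)\<^sup>2 + 2 * c * (f j * e j) + c\<^sup>2 * (e j * e j))"
        by (intro sum.cong refl) (simp add: algebra_simps power2_eq_square)
      also have "\<dots> = 1 + 2 * c * f i + c\<^sup>2"
        unfolding sum.distrib sum_distrib_left[symmetric] e1 f1 by (simp add: e_def)
      finally have 2: "(\<Sum>j<n. (f j + c * e j)\<^sup>2) = 1 + 2 * c * f i + c\<^sup>2" .
      from ray[of "\<lambda>j. f j + c * e j"] show ?thesis
        unfolding 1 2 yee yfe yef by (simp add: B_def P_def l_def[symmetric] algebra_simps)
    qed
    have "P \<ge> 0" using nn[of 1] nn[of "-1"] by simp
    \<comment> \<open>A nonzero linear term \<open>B\<close> would make the quadratic in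
      \<open>c\<close> negative for small \<open>c\<close> of the opposite sign; dividing by
      \<open>P + 1\<close> instead of \<open>P\<close> also covers \<open>P = 0\<close>.\<close>
    define c where "c = - B / (P + 1)"
    have "2 * c * B + c\<^sup>2 * P = - B\<^sup>2 * (P + 2) / (P + 1)\<^sup>2"
      using \<open>P \<ge> 0\<close> by (simp add: c_def divide_simps power2_eq_square) (simp add: algebra_simps)
    with nn[of c] have "0 \<le> - B\<^sup>2 * (P + 2) / (P + 1)\<^sup>2" by simp
    moreover have "B\<^sup>2 * (P + 2) / (P + 1)\<^sup>2 > 0" if "B \<noteq> 0"
      using that \<open>P \<ge> 0\<close> by (intro divide_pos_pos mult_pos_pos) auto
    ultimately have "B = 0" by fastforce
    then show ?thesis by (simp add: B_def)
  qed
  then show ?thesis using f1 ray by blast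
qed

text \<open>The trace dominates the largest eigenvalue: Cauchy-Schwarz in each Gram row.\<close>

lemma psd_form_le_trace:
  fixes y :: "nat \<Rightarrow> nat \<Rightarrow> real"
  assumes "\<And>i j. i < n \<Longrightarrow> j < n \<Longrightarrow> y i j = y j i" "\<And>v. 0 \<le> bilin n y v v"
  shows "bilin n y x x \<le> (\<Sum>i<n. y i i) * (\<Sum>i<n. (x i)\<^sup>2)"
proof -
  obtain b where b: "\<And>i j. i < n \<Longrightarrow> j < n \<Longrightarrow> y i j = (\<Sum>k<n. b k i * b k j)"
    using gram_decomposition[of n y] assms unfolding bilin_def by metis
  have "bilin n y x x = (\<Sum>i<n. \<Sum>j<n. x i * x j * (\<Sum>k<n. b k i * b k j))"
    unfolding bilin_def by (intro sum.cong refl) (simp add: b)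
  also have "\<dots> = (\<Sum>k<n. (\<Sum>i<n. b k i * x i)\<^sup>2)"
    unfolding bilin_gram[symmetric] bilin_def
    by (simp add: power2_eq_square sum_product mult_ac)
  also have "\<dots> \<le> (\<Sum>k<n. (\<Sum>i<n. (b k i)\<^sup>2) * (\<Sum>i<n. (x i)\<^sup>2))"
    by (intro sum_mono Cauchy_Schwarz_ineq_sum)
  also have "\<dots> = (\<Sum>i<n. y i i) * (\<Sum>i<n. (x i)\<^sup>2)"
  proof -
    have "(\<Sum>k<n. \<Sum>i<n. (b k i)\<^sup>2) = (\<Sum>i<n. y i i)"
      by (subst sum.swap) (simp add: b power2_eq_square)
    then show ?thesis by (simp add: sum_distrib_right[symmetric])
  qed
  finally show ?thesis .
qed

section \<open>Feasible matrices, their distance from the truth and their top eigenvectors\<close>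

lemma form_eq_bilin:
  assumes "Y \<in> carrier_mat n n" "v \<in> carrier_vec n"
  shows "v \<bullet> (Y *\<^sub>v v) = bilin n (\<lambda>i j. Y $$ (i, j)) (\<lambda>i. v $ i) (\<lambda>i. v $ i)"
  using assms
  by (auto simp: bilin_def scalar_prod_def sum_distrib_left mult_ac atLeast0LessThan intro!: sum.cong)

lemma sdp_feasibleD:
  assumes "Y \<in> sdp_feasible n"
  shows "Y \<in> carrier_mat n n" "\<And>i j. i < n \<Longrightarrow> j < n \<Longrightarrow> Y $$ (i, j) = Y $$ (j, i)"
    "\<And>v. 0 \<le> bilin n (\<lambda>i j. Y $$ (i, j)) v v" "\<And>i. i < n \<Longrightarrow> Y $$ (i, i) = 1"
proof -
  show Y: "Y \<in> carrier_mat n n" using assms by (simp add: sdp_feasible_def psd_def)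
  show "Y $$ (i, j) = Y $$ (j, i)" if "i < n" "j < n" for i j
  proof -
    have "Y $$ (i, j) = transpose_mat Y $$ (i, j)" using assms by (simp add: sdp_feasible_def psd_def)
    then show ?thesis using that Y by simp
  qed
  show "0 \<le> bilin n (\<lambda>i j. Y $$ (i, j)) v v" for v
  proof -
    have "0 \<le> Matrix.vec n v \<bullet> (Y *\<^sub>v Matrix.vec n v)"
      using assms unfolding sdp_feasible_def psd_def by auto
    also have "\<dots> = bilin n (\<lambda>i j. Y $$ (i, j)) v v"
      unfolding form_eq_bilin[OF Y vec_carrier] bilin_def by (intro sum.cong) auto
    finally show ?thesis .
  qed
  show "Y $$ (i, i) = 1" if "i < n" for i using assms that by (simp add: sdp_feasible_def)
qed

lemma sdp_feasible_gram:
  assumes "Y \<in> sdp_feasible n"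
  obtains b where "\<And>i j. i < n \<Longrightarrow> j < n \<Longrightarrow> Y $$ (i, j) = (\<Sum>k<n. b k i * b k j)"
  using gram_decomposition[of n "\<lambda>i j. Y $$ (i, j)"] sdp_feasibleD[OF assms] unfolding bilin_def by metis

text \<open>Feasible entries lie in \<open>[-1, 1]\<close>, so no entry overshoots the true sign and
  every absolute value opens with a known sign. The distance is therefore linear in \<open>Y\<close>
  on the feasible set, which is what allows it to be read as a trace.\<close>

lemma entry_l1_dist_truth:
  assumes Y: "Y \<in> sdp_feasible n" and \<sigma>: "label_vec n \<sigma>"
  shows "entry_l1_norm n (Y - truth_mat n \<sigma>) = (\<Sum>i<n. \<Sum>j<n. 1 - \<sigma> $ i * \<sigma> $ j * Y $$ (i, j))"
proof -
  obtain b where b: "\<And>i j. i < n \<Longrightarrow> j < n \<Longrightarrow> Y $$ (i, j) = (\<Sum>k<n. b k i * b k j)"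
    using sdp_feasible_gram[OF Y] by blast
  have "\<bar>Y $$ (i, j)\<bar> \<le> 1" if "i < n" "j < n" for i j
    unfolding b[OF that] using that b[of i i] b[of j j] sdp_feasibleD(4)[OF Y]
    by (intro gram_entry_le_one) (auto simp: power2_eq_square)
  have "\<sigma> $ i = 1 \<or> \<sigma> $ i = -1" if "i < n" for i using \<sigma> that by (auto simp: label_vec_def)
  have "\<bar>Y $$ (i, j) - \<sigma> $ i * \<sigma> $ j\<bar> = 1 - \<sigma> $ i * \<sigma> $ j * Y $$ (i, j)" if "i < n" "j < n" for i j
  proof -
    have "\<bar>Y $$ (i, j)\<bar> \<le> 1" "\<sigma> $ i * \<sigma> $ j = 1 \<or> \<sigma> $ i * \<sigma> $ j = -1"
      using \<open>\<And>i j. i < n \<Longrightarrow> j < n \<Longrightarrow> \<bar>Y $$ (i, j)\<bar> \<le> 1\<close>[OF that]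
        \<open>\<And>i. i < n \<Longrightarrow> \<sigma> $ i = 1 \<or> \<sigma> $ i = -1\<close>[OF that(1)]
        \<open>\<And>i. i < n \<Longrightarrow> \<sigma> $ i = 1 \<or> \<sigma> $ i = -1\<close>[OF that(2)] by auto
    then show ?thesis by (auto simp: abs_if)
  qed
  then show ?thesis using sdp_feasibleD(1)[OF Y]
    by (auto simp: entry_l1_norm_def truth_mat_def intro!: sum.cong)
qed

text \<open>\<open>top_eigenvector\<close> compares eigenvalues only; its eigenvalue bounds the
  whole form because the maximum of the Rayleigh quotient is itself an eigenvalue. The normalising
  factor is positive, so the signs of the entries survive.\<close>

lemma top_eigenvector_rayleigh:
  assumes Y: "Y \<in> sdp_feasible n" and n: "n > 0" and v: "top_eigenvector Y v"
  shows "v \<in> carrier_vec n \<and> (\<exists>k u. (\<Sum>i<n. (u i)\<^sup>2) = 1 \<and> (\<forall>i<n. (\<Sum>j<n. Y $$ (i, j) * u j) = k * u i)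
    \<and> (\<forall>x. bilin n (\<lambda>i j. Y $$ (i, j)) x x \<le> k * (\<Sum>i<n. (x i)\<^sup>2)) \<and> (\<exists>r>0. \<forall>i<n. u i = v $ i / r))"
proof -
  note Yc = sdp_feasibleD(1)[OF Y]
  obtain k where ev: "eigenvector Y v k" and top: "\<And>k'. eigenvalue Y k' \<Longrightarrow> k' \<le> k"
    using v unfolding top_eigenvector_def by blast
  have vc: "v \<in> carrier_vec n" and v0: "v \<noteq> 0\<^sub>v n" and Yv: "Y *\<^sub>v v = k \<cdot>\<^sub>v v"
    using ev Yc unfolding eigenvector_def by auto
  have "\<exists>i<n. v $ i \<noteq> 0"
  proof (rule ccontr)
    assume "\<not> ?thesis"
    then have "v = 0\<^sub>v n" using vc by (intro eq_vecI) auto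
    then show False using v0 by simp
  qed
  then obtain i where i: "i < n" "v $ i \<noteq> 0" by blast
  define r where "r = sqrt (\<Sum>i<n. (v $ i)\<^sup>2)"
  have pos: "0 < (\<Sum>i<n. (v $ i)\<^sup>2)" using i by (intro sum_pos2[of _ i]) auto
  then have r: "r > 0" "r\<^sup>2 = (\<Sum>i<n. (v $ i)\<^sup>2)" by (auto simp: r_def)
  obtain l f where f: "(\<Sum>i<n. (f i)\<^sup>2) = 1" "\<And>i. i < n \<Longrightarrow> (\<Sum>j<n. Y $$ (i, j) * f j) = l * f i"
    and ray: "\<And>x. bilin n (\<lambda>i j. Y $$ (i, j)) x x \<le> l * (\<Sum>i<n. (x i)\<^sup>2)"
    using symmetric_rayleigh_eigenvector[of n "\<lambda>i j. Y $$ (i, j)", OF n sdp_feasibleD(2)[OF Y]] by blast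
  have "eigenvector Y (Matrix.vec n f) l"
  proof -
    have "Matrix.vec n f \<noteq> 0\<^sub>v n"
    proof
      assume eq: "Matrix.vec n f = 0\<^sub>v n"
      have "f i = 0" if "i < n" for i
        using arg_cong[OF eq, of "\<lambda>w. w $ i"] that by simp
      then show False using f(1) by simp
    qed
    moreover have "Y *\<^sub>v Matrix.vec n f = l \<cdot>\<^sub>v Matrix.vec n f"
      using Yc f(2) by (intro eq_vecI) (auto simp: scalar_prod_def atLeast0LessThan)
    ultimately show ?thesis using Yc by (simp add: eigenvector_def)
  qed
  then have "l \<le> k" using top unfolding eigenvalue_def by blast
  then have rayk: "bilin n (\<lambda>i j. Y $$ (i, j)) x x \<le> k * (\<Sum>i<n. (x i)\<^sup>2)" for x
    using ray[of x] mult_right_mono[of l k "\<Sum>i<n. (x i)\<^sup>2"] by (force intro: sum_nonneg)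
  have "(\<Sum>i<n. (v $ i / r)\<^sup>2) = 1"
    using r pos by (simp add: power_divide sum_divide_distrib[symmetric])
  moreover have "(\<Sum>j<n. Y $$ (i, j) * (v $ j / r)) = k * (v $ i / r)" if "i < n" for i
  proof -
    have "(Y *\<^sub>v v) $ i = (k \<cdot>\<^sub>v v) $ i" using Yv by simp
    then have "(\<Sum>j<n. Y $$ (i, j) * v $ j) = k * v $ i"
      using that Yc vc by (simp add: scalar_prod_def atLeast0LessThan)
    then show ?thesis by (simp add: sum_divide_distrib[symmetric])
  qed
  ultimately show ?thesis using rayk r vc
    by (intro conjI exI[of _ k] exI[of _ "\<lambda>i. v $ i / r"] exI[of _ r]) auto
qed

text \<open>The argument avoids eigenvalue gaps. Removing the top component leaves a semidefinite
  matrix of trace \<open>n - k\<close>, whose form at \<sigma> is at most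
  \<open>(n - k) * n\<close>. The form of \<open>Y\<close> at \<sigma> is
  \<open>n * (n - \<gamma>)\<close>, and \<open>n - \<gamma> \<le> k \<le> n\<close>, so the overlap
  \<open>c\<close> of the unit eigenvector with \<sigma> satisfies
  \<open>c^2 \<ge> n - 2 * \<gamma>\<close>.\<close>

lemma err_top_eigenvector_le:
  assumes Y: "Y \<in> sdp_feasible n" and n: "n > 0" and \<sigma>: "label_vec n \<sigma>" and v: "top_eigenvector Y v"
  shows "err n (sign_vec v) \<sigma> \<le> 4 * (entry_l1_norm n (Y - truth_mat n \<sigma>) / n) / n"
proof -
  define y where "y = (\<lambda>i j. Y $$ (i, j))"
  define \<gamma> where "\<gamma> = entry_l1_norm n (Y - truth_mat n \<sigma>) / n"
  obtain u k where u1: "(\<Sum>i<n. (u i)\<^sup>2) = 1"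
    and eig': "\<And>i. i < n \<Longrightarrow> (\<Sum>j<n. Y $$ (i, j) * u j) = k * u i"
    and ray': "\<And>x. bilin n (\<lambda>i j. Y $$ (i, j)) x x \<le> k * (\<Sum>i<n. (x i)\<^sup>2)"
    and uv: "\<exists>r>0. \<forall>i<n. u i = v $ i / r" and vc: "v \<in> carrier_vec n"
    using top_eigenvector_rayleigh[OF Y n v] by blast
  have eig: "\<And>i. i < n \<Longrightarrow> (\<Sum>j<n. y i j * u j) = k * u i"
    and ray: "\<And>x. bilin n y x x \<le> k * (\<Sum>i<n. (x i)\<^sup>2)"
    using eig' ray' by (auto simp: y_def)
  have ysym: "\<And>i j. i < n \<Longrightarrow> j < n \<Longrightarrow> y i j = y j i" and ypsd: "\<And>x. 0 \<le> bilin n y x x"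
    and ydiag: "\<And>i. i < n \<Longrightarrow> y i i = 1"
    using sdp_feasibleD[OF Y] by (auto simp: y_def)
  have \<sigma>1: "(\<sigma> $ i)\<^sup>2 = 1" if "i < n" for i using \<sigma> that by (auto simp: label_vec_def)
  define s where "s = (\<lambda>i. \<sigma> $ i)"
  have ss: "(\<Sum>i<n. (s i)\<^sup>2) = n" using \<sigma>1 by (simp add: s_def)
  define q where "q = bilin n y s s"
  have q: "q = n * (n - \<gamma>)"
    unfolding \<gamma>_def entry_l1_dist_truth[OF Y \<sigma>] using n
    by (simp add: q_def bilin_def s_def y_def sum_subtractf field_simps power2_eq_square)
  define c where "c = (\<Sum>i<n. u i * s i)"
  define m where "m = (\<lambda>i j. y i j - k * u i * u j)"
  have bm: "bilin n m x x = bilin n y x x - k * (\<Sum>i<n. u i * x i)\<^sup>2" for x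
  proof -
    have "bilin n m x x = bilin n y x x - (\<Sum>i<n. \<Sum>j<n. k * ((u i * x i) * (u j * x j)))"
      unfolding bilin_def m_def sum_subtractf[symmetric] by (intro sum.cong refl) (simp add: algebra_simps)
    also have "(\<Sum>i<n. \<Sum>j<n. k * ((u i * x i) * (u j * x j))) = k * (\<Sum>i<n. u i * x i)\<^sup>2"
      unfolding power2_eq_square sum_product by (simp add: sum_distrib_left)
    finally show ?thesis .
  qed
  have mpsd: "0 \<le> bilin n m x x" for x
  proof -
    define d where "d = (\<Sum>i<n. u i * x i)"
    \<comment> \<open>\<open>w\<close> is \<open>x\<close> without its component along the
      eigenvector; the form of \<open>m\<close> at \<open>x\<close> is the form of \<open>y\<close>
      at \<open>w\<close>.\<close>
    define w where "w = (\<lambda>i. x i - d * u i)"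
    have 1: "bilin n y x u = k * d"
    proof -
      have "bilin n y x u = (\<Sum>i<n. x i * (\<Sum>j<n. y i j * u j))"
        by (simp add: bilin_def sum_distrib_left mult_ac)
      also have "\<dots> = (\<Sum>i<n. k * (u i * x i))" by (intro sum.cong) (auto simp: eig)
      finally show ?thesis by (simp add: d_def sum_distrib_left)
    qed
    have 2: "bilin n y u x = bilin n y x u"
      unfolding bilin_def by (subst sum.swap) (auto intro!: sum.cong simp: ysym)
    have 3: "bilin n y u u = k"
    proof -
      have "bilin n y u u = (\<Sum>i<n. u i * (\<Sum>j<n. y i j * u j))"
        by (simp add: bilin_def sum_distrib_left mult_ac)
      also have "\<dots> = (\<Sum>i<n. k * (u i)\<^sup>2)" by (intro sum.cong) (auto simp: eig power2_eq_square)
      finally show ?thesis using u1 by (simp add: sum_distrib_left[symmetric])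
    qed
    have "bilin n y w w = (\<Sum>i<n. \<Sum>j<n. x i * y i j * x j - d * (x i * y i j * u j)
        - d * (u i * y i j * x j) + d\<^sup>2 * (u i * y i j * u j))"
      unfolding bilin_def by (intro sum.cong refl) (simp add: w_def algebra_simps power2_eq_square)
    also have "\<dots> = bilin n y x x - d * bilin n y x u - d * bilin n y u x + d\<^sup>2 * bilin n y u u"
      by (simp only: bilin_def sum.distrib sum_subtractf sum_distrib_left)
    also have "\<dots> = bilin n y x x - k * d\<^sup>2" unfolding 2 1 3 by (simp add: power2_eq_square)
    finally show ?thesis using ypsd[of w] by (simp add: bm d_def)
  qed
  have tr: "(\<Sum>i<n. m i i) = n - k"
  proof -
    have "(\<Sum>i<n. m i i) = (\<Sum>i<n. 1 - k * (u i)\<^sup>2)"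
      by (intro sum.cong) (auto simp: m_def ydiag power2_eq_square)
    then show ?thesis using u1 by (simp add: sum_subtractf sum_distrib_left[symmetric])
  qed
  have "bilin n m s s \<le> (n - k) * n"
    using psd_form_le_trace[of n m s] mpsd ysym unfolding tr ss by (simp add: m_def mult_ac)
  then have A: "q - k * c\<^sup>2 \<le> (n - k) * n" by (simp add: bm q_def c_def)
  have "q \<le> k * n" using ray[of s] ss by (simp add: q_def)
  then have k1: "n - \<gamma> \<le> k" using n unfolding q by (simp add: mult.commute)
  have k2: "k \<le> n"
  proof -
    have "0 \<le> m i i" if "i < n" for i
    proof -
      define e where "e = (\<lambda>j. if j = i then 1 else (0 :: real))"
      have "bilin n m e e = (\<Sum>a<n. \<Sum>b<n. if a = i then (if b = i then m a b else 0) else 0)"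
        unfolding bilin_def by (intro sum.cong refl) (simp add: e_def)
      also have "\<dots> = (\<Sum>a<n. if a = i then m a i else 0)"
        using that by (intro sum.cong refl) (simp add: sum.delta)
      also have "\<dots> = m i i" using that by (simp add: sum.delta)
      finally show ?thesis using mpsd[of e] by simp
    qed
    then have "0 \<le> (\<Sum>i<n. m i i)" by (intro sum_nonneg) auto
    then show ?thesis by (simp add: tr)
  qed
  have "k * c\<^sup>2 \<ge> n * (n - \<gamma>) - n * \<gamma>"
  proof -
    have "(n - k) * n \<le> \<gamma> * n" using k1 by (intro mult_right_mono) auto
    then show ?thesis using A q by (simp add: mult.commute)
  qed
  then have "n * (n - 2 * \<gamma>) \<le> k * c\<^sup>2" by (simp add: algebra_simps)
  also have "\<dots> \<le> n * c\<^sup>2" using k2 by (intro mult_right_mono) auto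
  finally have c2: "n - 2 * \<gamma> \<le> c\<^sup>2" using n by simp
  have "c\<^sup>2 \<le> (\<Sum>i<n. (u i)\<^sup>2) * (\<Sum>i<n. (s i)\<^sup>2)" unfolding c_def by (rule Cauchy_Schwarz_ineq_sum)
  then have c3: "\<bar>c\<bar> \<le> sqrt n" unfolding u1 ss by (simp add: real_le_rsqrt)
  \<comment> \<open>The global sign makes the overlap nonnegative. Every index with a wrong sign
    then costs at least one in the squared distance between \<open>sqrt n * g * u\<close> and
    \<sigma>.\<close>
  define g :: real where "g = (if c \<ge> 0 then 1 else -1)"
  define F where "F = {i. i < n \<and> g * sign_vec v $ i \<noteq> \<sigma> $ i}"
  have finF: "finite F" "F \<subseteq> {..<n}" by (auto simp: F_def)
  obtain r where r: "r > 0" "\<And>i. i < n \<Longrightarrow> u i = v $ i / r" using uv by blast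
  have bad: "1 \<le> (sqrt n * g * u i - s i)\<^sup>2" if "i \<in> F" for i
  proof -
    have i: "i < n" using that by (simp add: F_def)
    have sg: "sign_vec v $ i = (if 0 \<le> u i then 1 else -1)"
      using i vc r by (simp add: sign_vec_def zero_le_divide_iff)
    have s: "s i = 1 \<or> s i = -1" using \<sigma> i by (auto simp: label_vec_def s_def)
    have "g * u i * s i \<le> 0" using that sg s by (auto simp: F_def g_def s_def split: if_splits)
    then have "sqrt n * (g * u i * s i) \<le> 0" by (rule mult_nonneg_nonpos[rotated]) simp
    moreover have "(s i)\<^sup>2 = 1" using s by auto
    moreover have "0 \<le> (sqrt n * g * u i)\<^sup>2" by simp
    moreover have "(sqrt n * g * u i - s i)\<^sup>2 = (sqrt n * g * u i)\<^sup>2 - 2 * (sqrt n * (g * u i * s i)) + (s i)\<^sup>2"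
      by (simp add: power2_diff)
    ultimately show ?thesis by linarith
  qed
  have "card F \<le> (\<Sum>i\<in>F. (sqrt n * g * u i - s i)\<^sup>2)"
    using sum_mono[of F "\<lambda>_. 1" "\<lambda>i. (sqrt n * g * u i - s i)\<^sup>2"] bad by simp
  also have "\<dots> \<le> (\<Sum>i<n. (sqrt n * g * u i - s i)\<^sup>2)"
    using finF by (intro sum_mono2) auto
  also have "\<dots> = (\<Sum>i<n. n * (u i)\<^sup>2 + (s i)\<^sup>2 - 2 * sqrt n * g * (u i * s i))"
    by (intro sum.cong refl) (simp add: power2_diff power_mult_distrib g_def mult_ac)
  also have "\<dots> = 2 * n - 2 * (sqrt n * (g * c))"
    using u1 ss by (simp add: sum.distrib sum_subtractf sum_distrib_left[symmetric] c_def)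
  also have "g * c = \<bar>c\<bar>" by (simp add: g_def)
  \<comment> \<open>The overlap is at most \<open>sqrt n\<close> in absolute value, so the squared
    distance is at most \<open>2 * n - 2 * c^2\<close> and the lower bound on \<open>c^2\<close>
    applies directly.\<close>
  also have "sqrt n * \<bar>c\<bar> \<ge> c\<^sup>2" using mult_right_mono[OF c3, of "\<bar>c\<bar>"] by (simp add: power2_eq_square)
  then have "2 * n - 2 * (sqrt n * \<bar>c\<bar>) \<le> 4 * \<gamma>" using c2 by simp
  finally have cF: "card F \<le> 4 * \<gamma>" .
  have "err n (sign_vec v) \<sigma> \<le> card F / n"
    unfolding err_def F_def by (intro Min_le) (auto simp: g_def)
  also have "\<dots> \<le> 4 * \<gamma> / n" using cF by (intro divide_right_mono) auto
  finally show ?thesis by (simp add: \<gamma>_def)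
qed

section \<open>Tail bounds\<close>

text \<open>Regroups the square by independent entries: an off-diagonal sample is read at
  \<open>(i, j)\<close> and at \<open>(j, i)\<close>.\<close>

lemma sum_square_upper_triangle:
  fixes f :: "nat \<Rightarrow> nat \<Rightarrow> 'a :: comm_monoid_add"
  shows "(\<Sum>i<n. \<Sum>j<n. f i j) =
    (\<Sum>(i, j) \<in> {(i, j). i \<le> j \<and> j < n}. if i = j then f i i else f i j + f j i)"
proof -
  define L where "L = {(i, j). i < j \<and> j < n}"
  define G where "G = {(i, j). j < i \<and> i < n}"
  define E where "E = {(i, j). i = j \<and> j < n}"
  have fin: "finite L" "finite G" "finite E"
    by (rule finite_subset[of _ "{..<n} \<times> {..<n}"]; auto simp: L_def G_def E_def)+
  have U: "{..<n} \<times> {..<n} = (L \<union> E) \<union> G" "{(i, j). i \<le> j \<and> j < n} = L \<union> E"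
    by (auto simp: L_def G_def E_def)
  have dis: "L \<inter> E = {}" "(L \<union> E) \<inter> G = {}" by (auto simp: L_def G_def E_def)
  have GL: "(\<Sum>(i, j) \<in> G. f i j) = (\<Sum>(i, j) \<in> L. f j i)"
    by (rule sum.reindex_bij_witness[of _ prod.swap prod.swap]) (auto simp: L_def G_def)
  have "(\<Sum>i<n. \<Sum>j<n. f i j) = (\<Sum>(i, j) \<in> {..<n} \<times> {..<n}. f i j)"
    by (simp add: sum.cartesian_product)
  also have "\<dots> = (\<Sum>(i, j) \<in> L. f i j) + (\<Sum>(i, j) \<in> E. f i j) + (\<Sum>(i, j) \<in> L. f j i)"
    unfolding U using fin dis by (simp add: sum.union_disjoint GL)
  also have "\<dots> = (\<Sum>(i, j) \<in> L. f i j + f j i) + (\<Sum>(i, j) \<in> E. f i j)"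
    by (simp add: sum.distrib case_prod_unfold add_ac)
  also have "(\<Sum>(i, j) \<in> L. f i j + f j i) = (\<Sum>(i, j) \<in> L. if i = j then f i i else f i j + f j i)"
    by (intro sum.cong) (auto simp: L_def)
  also have "(\<Sum>(i, j) \<in> E. f i j) = (\<Sum>(i, j) \<in> E. if i = j then f i i else f i j + f j i)"
    by (intro sum.cong) (auto simp: E_def)
  finally show ?thesis unfolding U using fin dis by (simp add: sum.union_disjoint)
qed

text \<open>Exponential Markov inequality and independence. The tilt is part of \<open>f\<close>,
  and the hypothesis bounds nonnegative integrals, so no integrability has to be
  established.\<close>

lemma chernoff_PiM:
  fixes M :: "'i \<Rightarrow> real measure"
  assumes I: "finite I" and P: "\<And>i. prob_space (M i)" and S: "\<And>i. sets (M i) = sets borel"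
    and f: "\<And>i. i \<in> I \<Longrightarrow> f i \<in> borel_measurable borel"
    and b: "\<And>i. i \<in> I \<Longrightarrow> (\<integral>\<^sup>+x. ennreal (exp (f i x)) \<partial>M i) \<le> ennreal (exp (b i))"
  shows "{\<omega> \<in> space (PiM I M). a \<le> (\<Sum>i\<in>I. f i (\<omega> i))} \<in> sets (PiM I M)"
    and "measure (PiM I M) {\<omega> \<in> space (PiM I M). a \<le> (\<Sum>i\<in>I. f i (\<omega> i))} \<le> exp ((\<Sum>i\<in>I. b i) - a)"
proof -
  interpret product_prob_space M I by (intro product_prob_spaceI P)
  have fM: "f i \<in> borel_measurable (M i)" if "i \<in> I" for i
    using f[OF that] S by (simp cong: measurable_cong_sets)
  have [measurable]: "(\<lambda>\<omega>. f i (\<omega> i)) \<in> borel_measurable (PiM I M)" if "i \<in> I" for i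
    by (rule measurable_compose[OF measurable_component_singleton[OF that]]) (rule fM[OF that])
  show meas: "{\<omega> \<in> space (PiM I M). a \<le> (\<Sum>i\<in>I. f i (\<omega> i))} \<in> sets (PiM I M)" by measurable
  have "emeasure (PiM I M) {\<omega> \<in> space (PiM I M). a \<le> (\<Sum>i\<in>I. f i (\<omega> i))}
     \<le> ennreal (exp (- 1 * a)) * (\<integral>\<^sup>+\<omega>. ennreal (exp (1 * (\<Sum>i\<in>I. f i (\<omega> i)))) * indicator (space (PiM I M)) \<omega> \<partial>PiM I M)"
    by (intro Chernoff_ineq_nn_integral_ge) auto
  also have "(\<integral>\<^sup>+\<omega>. ennreal (exp (1 * (\<Sum>i\<in>I. f i (\<omega> i)))) * indicator (space (PiM I M)) \<omega> \<partial>PiM I M)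
     = (\<integral>\<^sup>+\<omega>. (\<Prod>i\<in>I. ennreal (exp (f i (\<omega> i)))) \<partial>PiM I M)"
    using I by (intro nn_integral_cong) (auto simp: exp_sum prod_ennreal)
  also have "\<dots> = (\<Prod>i\<in>I. \<integral>\<^sup>+x. ennreal (exp (f i x)) \<partial>M i)"
    using fM by (intro product_nn_integral_prod I) auto
  also have "\<dots> \<le> (\<Prod>i\<in>I. ennreal (exp (b i)))" using I b
    by (induction I) (auto intro!: mult_mono)
  also have "\<dots> = ennreal (exp (\<Sum>i\<in>I. b i))" using I by (simp add: prod_ennreal exp_sum)
  finally have "emeasure (PiM I M) {\<omega> \<in> space (PiM I M). a \<le> (\<Sum>i\<in>I. f i (\<omega> i))}
    \<le> ennreal (exp (- 1 * a)) * ennreal (exp (\<Sum>i\<in>I. b i))" by (simp add: mult_left_mono)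
  also have "\<dots> = ennreal (exp ((\<Sum>i\<in>I. b i) - a))"
    by (simp add: ennreal_mult[symmetric] exp_add[symmetric])
  finally show "measure (PiM I M) {\<omega> \<in> space (PiM I M). a \<le> (\<Sum>i\<in>I. f i (\<omega> i))} \<le> exp ((\<Sum>i\<in>I. b i) - a)"
    by (simp add: emeasure_eq_measure)
qed

section \<open>Independent symmetric entries\<close>

definition obs :: "(nat \<times> nat \<Rightarrow> real) \<Rightarrow> nat \<Rightarrow> nat \<Rightarrow> real" where
  "obs \<omega> i j = \<omega> (min i j, max i j)"

lemma obs_sym: "obs \<omega> i j = obs \<omega> j i"
  by (simp add: obs_def min.commute max.commute)

locale entry_model =
  fixes n :: nat and D :: "real \<Rightarrow> real measure" and \<sigma> :: "real Matrix.vec"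
  assumes prob_D: "\<And>s. prob_space (D s)" and sets_D: "\<And>s. sets (D s) = sets borel"
    and label: "label_vec n \<sigma>" and n_pos: "n > 0"
begin

abbreviation P where "P \<equiv> entries_law n D \<sigma>"

sublocale prob_space P
  unfolding entries_law_def by (intro prob_space_PiM) (auto simp: prob_D split: prod.splits)

text \<open>The weights at \<open>(i, j)\<close> and \<open>(j, i)\<close> may differ although both
  act on one sample; hence the moment bound is required for their sum, and \<open>b\<close> is split
  between the two places only for bookkeeping.\<close>

lemma tail:
  assumes g: "\<And>i j. g i j \<in> borel_measurable borel"
    and off: "\<And>i j. i < j \<Longrightarrow> j < n \<Longrightarrow>
      (\<integral>\<^sup>+x. ennreal (exp (g i j x + g j i x)) \<partial>D (\<sigma> $ i * \<sigma> $ j)) \<le> ennreal (exp (b i j + b j i))"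
    and diag: "\<And>i. i < n \<Longrightarrow> (\<integral>\<^sup>+x. ennreal (exp (g i i x)) \<partial>D (\<sigma> $ i * \<sigma> $ i)) \<le> ennreal (exp (b i i))"
  shows "{\<omega> \<in> space P. a \<le> (\<Sum>i<n. \<Sum>j<n. g i j (obs \<omega> i j))} \<in> events"
    and "prob {\<omega> \<in> space P. a \<le> (\<Sum>i<n. \<Sum>j<n. g i j (obs \<omega> i j))} \<le> exp ((\<Sum>i<n. \<Sum>j<n. b i j) - a)"
proof -
  define E where "E = {(i, j). i \<le> j \<and> j < n}"
  have fin: "finite E" unfolding E_def by (rule finite_subset[of _ "{..<n} \<times> {..<n}"]) auto
  define f where "f = (\<lambda>(i, j) x. if i = j then g i i x else g i j x + g j i x)"
  define b' where "b' = (\<lambda>(i, j). if i = j then b i i else b i j + b j i)"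
  define M where "M = (\<lambda>(i, j). D (\<sigma> $ i * \<sigma> $ j))"
  have PM: "P = PiM E M" by (simp add: entries_law_def E_def M_def)
  have eq: "(\<Sum>i<n. \<Sum>j<n. g i j (obs \<omega> i j)) = (\<Sum>e\<in>E. f e (\<omega> e))" for \<omega>
    unfolding sum_square_upper_triangle E_def[symmetric]
    by (intro sum.cong) (auto simp: f_def E_def obs_def min_def max_def)
  have beq: "(\<Sum>i<n. \<Sum>j<n. b i j) = (\<Sum>e\<in>E. b' e)"
    unfolding sum_square_upper_triangle E_def[symmetric] b'_def by simp
  have bd: "(\<integral>\<^sup>+x. ennreal (exp (f e x)) \<partial>M e) \<le> ennreal (exp (b' e))" if "e \<in> E" for e
    using that off diag by (cases e) (auto simp: E_def f_def b'_def M_def)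
  have fm: "f e \<in> borel_measurable borel" for e
    using g by (cases e) (auto simp: f_def)
  note ch = chernoff_PiM[of E M f b' a, OF fin _ _ fm bd]
  show "{\<omega> \<in> space P. a \<le> (\<Sum>i<n. \<Sum>j<n. g i j (obs \<omega> i j))} \<in> events"
    unfolding PM eq by (rule ch(1)) (auto simp: M_def prob_D sets_D split: prod.splits)
  show "prob {\<omega> \<in> space P. a \<le> (\<Sum>i<n. \<Sum>j<n. g i j (obs \<omega> i j))} \<le> exp ((\<Sum>i<n. \<Sum>j<n. b i j) - a)"
    unfolding PM eq beq by (rule ch(2)) (auto simp: M_def prob_D sets_D split: prod.splits)
qed

lemma prob_Union_le:
  assumes "finite K" "\<And>k. k \<in> K \<Longrightarrow> A k \<in> events" "\<And>k. k \<in> K \<Longrightarrow> prob (A k) \<le> c k"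
    "(\<Sum>k\<in>K. c k) \<le> p"
  shows "(\<Union>k\<in>K. A k) \<in> events" "prob (\<Union>k\<in>K. A k) \<le> p"
proof -
  show "(\<Union>k\<in>K. A k) \<in> events" using assms by auto
  have "prob (\<Union>k\<in>K. A k) \<le> (\<Sum>k\<in>K. prob (A k))"
    using assms by (intro finite_measure_subadditive_finite) auto
  also have "\<dots> \<le> (\<Sum>k\<in>K. c k)" using assms by (intro sum_mono) auto
  finally show "prob (\<Union>k\<in>K. A k) \<le> p" using assms by simp
qed

end

section \<open>Integer net and light pairs\<close>

text \<open>
  A bilinear form is affine in each coordinate, so a real vector can be rounded up or down coordinate by
  coordinate to an integer one without decreasing the form.  After scaling to squared length at most
  \<open>n\<close>, only exponentially many integer vectors are needed.
\<close>

definition int_net :: "nat \<Rightarrow> (nat \<Rightarrow> int) set" where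
  "int_net n = {\<xi> \<in> PiE {..<n} (\<lambda>_. {- (2 * int n)..2 * int n}). (\<Sum>i<n. (\<xi> i)\<^sup>2) \<le> 4 * int n}"

lemma finite_int_net: "finite (int_net n)"
proof -
  have "finite (PiE {..<n} (\<lambda>_. {- (2 * int n)..2 * int n}))" by (rule finite_PiE) auto
  then show ?thesis unfolding int_net_def by (rule rev_finite_subset) blast
qed

lemma int_net_sq:
  assumes "\<xi> \<in> int_net n"
  shows "(\<Sum>i<n. (real_of_int (\<xi> i))\<^sup>2) \<le> 4 * n"
proof -
  have "real_of_int (\<Sum>i<n. (\<xi> i)\<^sup>2) \<le> real_of_int (4 * int n)"
    using assms by (simp only: of_int_le_iff int_net_def mem_Collect_eq)
  then show ?thesis by simp
qed

lemma sum_half_powers_le: "(\<Sum>m\<in>{- int k..int k}. (1 / 2 :: real) ^ nat \<bar>m\<bar>) \<le> 3 - 2 * (1 / 2) ^ k"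
proof (induction k)
  case (Suc k)
  have "{- int (Suc k)..int (Suc k)} = insert (int (Suc k)) (insert (- int (Suc k)) {- int k..int k})"
    by auto
  then have "(\<Sum>m\<in>{- int (Suc k)..int (Suc k)}. (1 / 2 :: real) ^ nat \<bar>m\<bar>)
      = 2 * (1 / 2) ^ Suc k + (\<Sum>m\<in>{- int k..int k}. (1 / 2) ^ nat \<bar>m\<bar>)"
    by (simp add: nat_add_distrib)
  then show ?case using Suc by simp
qed simp

text \<open>Counting by exponential moments: the length constraint makes the product of the factors
  \<open>exp (4 - (\<xi> i)^2)\<close> at least one on the net, and over the whole box the sum of
  these products factorises into \<open>n\<close> equal sums, each at most
  \<open>3 * exp 4 \<le> exp 6\<close>.\<close>

lemma card_int_net_le: "real (card (int_net n)) \<le> exp (6 * real n)"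
proof -
  define B where "B = {- (2 * int n)..2 * int n}"
  have ex1: "exp (- 1 :: real) \<le> 1 / 2"
    using exp_ge_add_one_self[of 1] by (simp add: exp_minus divide_simps)
  have one: "exp (- (real_of_int m)\<^sup>2) \<le> (1 / 2) ^ nat \<bar>m\<bar>" for m
  proof -
    have "\<bar>real_of_int m\<bar> \<le> (real_of_int m)\<^sup>2"
    proof (cases "m = 0")
      case False
      then have "1 \<le> \<bar>real_of_int m\<bar>" by linarith
      from mult_left_mono[OF this, of "\<bar>real_of_int m\<bar>"] show ?thesis by (simp add: power2_eq_square)
    qed simp
    then have "exp (- (real_of_int m)\<^sup>2) \<le> exp (real (nat \<bar>m\<bar>) * (- 1))" by simp
    also have "\<dots> = exp (- 1) ^ nat \<bar>m\<bar>" by (rule exp_of_nat_mult)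
    also have "\<dots> \<le> (1 / 2) ^ nat \<bar>m\<bar>" using ex1 by (intro power_mono) auto
    finally show ?thesis .
  qed
  have "(\<Sum>m\<in>B. exp (4 - (real_of_int m)\<^sup>2)) = exp 4 * (\<Sum>m\<in>B. exp (- (real_of_int m)\<^sup>2))"
    by (simp add: sum_distrib_left exp_add[symmetric])
  also have "\<dots> \<le> exp 4 * (\<Sum>m\<in>B. (1 / 2) ^ nat \<bar>m\<bar>)"
    by (intro mult_left_mono sum_mono one) auto
  also have "\<dots> \<le> exp 4 * 3"
  proof -
    have "(\<Sum>m\<in>B. (1 / 2 :: real) ^ nat \<bar>m\<bar>) \<le> 3 - 2 * (1 / 2) ^ (2 * n)"
      using sum_half_powers_le[of "2 * n"] by (simp add: B_def)
    also have "\<dots> \<le> 3" by simp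
    finally show ?thesis by simp
  qed
  also have "\<dots> \<le> exp 4 * exp 2"
    using exp_ge_add_one_self[of 2] by (intro mult_left_mono) auto
  finally have row: "(\<Sum>m\<in>B. exp (4 - (real_of_int m)\<^sup>2)) \<le> exp 6" by (simp add: exp_add[symmetric])
  define F where "F = (\<lambda>(i :: nat) m. exp (4 - (real_of_int m)\<^sup>2))"
  have finB: "finite (PiE {..<n} (\<lambda>_. B))" by (rule finite_PiE) (auto simp: B_def)
  have sub: "int_net n \<subseteq> PiE {..<n} (\<lambda>_. B)" unfolding int_net_def B_def by blast
  have "real (card (int_net n)) = (\<Sum>\<xi>\<in>int_net n. 1)" by simp
  also have "\<dots> \<le> (\<Sum>\<xi>\<in>int_net n. \<Prod>i<n. F i (\<xi> i))"
  proof (rule sum_mono)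
    fix \<xi> assume "\<xi> \<in> int_net n"
    from int_net_sq[OF this] show "1 \<le> (\<Prod>i<n. F i (\<xi> i))"
      by (simp add: F_def exp_sum[symmetric] sum_subtractf)
  qed
  also have "\<dots> \<le> (\<Sum>\<xi>\<in>PiE {..<n} (\<lambda>_. B). \<Prod>i<n. F i (\<xi> i))"
    by (rule sum_mono2[OF finB sub]) (rule prod_nonneg, simp add: F_def)
  also have "\<dots> = (\<Prod>i<n. \<Sum>m\<in>B. F i m)"
    using prod_sum_PiE[of "{..<n}" "\<lambda>_. B" F] by (simp add: B_def)
  also have "\<dots> = (\<Sum>m\<in>B. exp (4 - (real_of_int m)\<^sup>2)) ^ n" by (simp add: F_def)
  also have "\<dots> \<le> exp 6 ^ n"
    by (rule power_mono[OF row]) (rule sum_nonneg, simp)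
  also have "\<dots> = exp (6 * real n)" by (simp add: exp_of_nat_mult[symmetric] mult.commute)
  finally show ?thesis .
qed

text \<open>The sign of each coefficient decides between rounding up and down. Zeros stay zero, so a
  prescribed support is respected; this is what allows rows to be removed before passing to the
  net.\<close>

lemma int_rounding:
  fixes x L :: "nat \<Rightarrow> real"
  assumes "(\<Sum>i<n. (x i)\<^sup>2) \<le> n"
  shows "\<exists>\<xi>\<in>int_net n. (\<forall>i<n. x i = 0 \<longrightarrow> \<xi> i = 0) \<and> (\<Sum>i<n. L i * x i) \<le> (\<Sum>i<n. L i * \<xi> i)"
proof -
  define \<xi> where "\<xi> = (\<lambda>i. if i < n then if L i \<ge> 0 then \<lceil>x i\<rceil> else \<lfloor>x i\<rfloor> else undefined)"
  \<comment> \<open>An error of at most one per coordinate takes the squared length from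
    \<open>n\<close> to at most \<open>4 * n\<close>, the bound in \<open>int_net\<close>.\<close>
  have sq: "(real_of_int (\<xi> i))\<^sup>2 \<le> 2 * (x i)\<^sup>2 + 2" if "i < n" for i
  proof -
    have "\<bar>real_of_int (\<xi> i) - x i\<bar> \<le> 1" using that unfolding \<xi>_def by (auto simp: abs_if) linarith+
    then have "(real_of_int (\<xi> i) - x i)\<^sup>2 \<le> 1" by (simp add: abs_square_le_1)
    moreover have "0 \<le> (real_of_int (\<xi> i) - 2 * x i)\<^sup>2" by simp
    ultimately show ?thesis by (simp add: power2_diff)
  qed
  have "(\<Sum>i<n. (real_of_int (\<xi> i))\<^sup>2) \<le> (\<Sum>i<n. 2 * (x i)\<^sup>2 + 2)" using sq by (intro sum_mono) auto
  also have "\<dots> \<le> 4 * n" using assms by (simp add: sum.distrib sum_distrib_left[symmetric])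
  finally have "(\<Sum>i<n. (real_of_int (\<xi> i))\<^sup>2) \<le> 4 * n" .
  then have "real_of_int (\<Sum>i<n. (\<xi> i)\<^sup>2) \<le> real_of_int (4 * int n)" by simp
  then have S': "(\<Sum>i<n. (\<xi> i)\<^sup>2) \<le> 4 * int n" by (simp only: of_int_le_iff)
  have "\<xi> i \<in> {- (2 * int n)..2 * int n}" if "i < n" for i
  proof -
    have "(\<xi> i)\<^sup>2 \<le> (\<Sum>i<n. (\<xi> i)\<^sup>2)" using that by (intro member_le_sum) auto
    also have "\<dots> \<le> 4 * int n * int n"
      using S' that mult_left_mono[of 1 "int n" "4 * int n"] by linarith
    finally have "(\<xi> i)\<^sup>2 \<le> (2 * int n)\<^sup>2" by (simp add: power2_eq_square)
    then have "\<bar>\<xi> i\<bar> \<le> \<bar>2 * int n\<bar>" by (simp only: abs_le_square_iff)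
    then show ?thesis by auto
  qed
  then have "\<xi> \<in> int_net n" using S' by (auto simp: int_net_def \<xi>_def PiE_iff extensional_def)
  moreover have "L i * x i \<le> L i * \<xi> i" if "i < n" for i
    using that by (auto simp: \<xi>_def intro: mult_left_mono mult_left_mono_neg)
  ultimately show ?thesis by (intro bexI[of _ \<xi>]) (auto simp: \<xi>_def intro: sum_mono)
qed

lemma bilin_int_rounding:
  fixes x y :: "nat \<Rightarrow> real"
  assumes x: "(\<Sum>i<n. (x i)\<^sup>2) \<le> n" and y: "(\<Sum>i<n. (y i)\<^sup>2) \<le> n"
  shows "\<exists>\<xi>\<in>int_net n. \<exists>\<eta>\<in>int_net n. (\<forall>i<n. x i = 0 \<longrightarrow> \<xi> i = 0) \<and> (\<forall>i<n. y i = 0 \<longrightarrow> \<eta> i = 0)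
    \<and> bilin n w x y \<le> bilin n w (\<lambda>i. \<xi> i) (\<lambda>i. \<eta> i)"
proof -
  have l: "bilin n w u v = (\<Sum>i<n. (\<Sum>j<n. w i j * v j) * u i)" for u v
    by (simp add: bilin_def sum_distrib_left mult_ac)
  have r: "bilin n w u v = (\<Sum>j<n. (\<Sum>i<n. u i * w i j) * v j)" for u v
    unfolding bilin_def by (subst sum.swap) (simp add: sum_distrib_right)
  obtain \<xi> where \<xi>: "\<xi> \<in> int_net n" "\<forall>i<n. x i = 0 \<longrightarrow> \<xi> i = 0" "bilin n w x y \<le> bilin n w (\<lambda>i. \<xi> i) y"
    using int_rounding[OF x, of "\<lambda>i. \<Sum>j<n. w i j * y j"] unfolding l by blast
  obtain \<eta> where \<eta>: "\<eta> \<in> int_net n" "\<forall>i<n. y i = 0 \<longrightarrow> \<eta> i = 0"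
    "bilin n w (\<lambda>i. \<xi> i) y \<le> bilin n w (\<lambda>i. \<xi> i) (\<lambda>i. \<eta> i)"
    using int_rounding[OF y, of "\<lambda>j. \<Sum>i<n. \<xi> i * w i j"] unfolding r by blast
  show ?thesis using \<xi> \<eta> by (intro bexI[of _ \<xi>] bexI[of _ \<eta>]) auto
qed

text \<open>The two arguments are rounded independently, so a sign can be put on one of them:
  testing \<open>x\<close> against \<open>x\<close> and against \<open>- x\<close> gives the
  absolute value. \<open>H\<close> is a set of coordinates kept at zero.\<close>

lemma quadratic_form_le_of_int_net:
  fixes x :: "nat \<Rightarrow> real"
  assumes n: "n > 0"
    and le: "\<And>\<xi> \<eta>. \<xi> \<in> int_net n \<Longrightarrow> \<eta> \<in> int_net n \<Longrightarrow> (\<And>i. i < n \<Longrightarrow> i \<in> H \<Longrightarrow> \<xi> i = 0) \<Longrightarrow>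
      (\<And>i. i < n \<Longrightarrow> i \<in> H \<Longrightarrow> \<eta> i = 0) \<Longrightarrow> bilin n w (\<lambda>i. \<xi> i) (\<lambda>i. \<eta> i) \<le> c * n"
    and x: "\<And>i. i < n \<Longrightarrow> i \<in> H \<Longrightarrow> x i = 0"
  shows "\<bar>bilin n w x x\<bar> \<le> c * (\<Sum>i<n. (x i)\<^sup>2)"
proof (cases "(\<Sum>i<n. (x i)\<^sup>2) = 0")
  case True
  then have "x i = 0" if "i < n" for i using that by (simp add: sum_nonneg_eq_0_iff)
  then show ?thesis using True by (simp add: bilin_def)
next
  case False
  define q where "q = (\<Sum>i<n. (x i)\<^sup>2)"
  have "0 \<le> q" unfolding q_def by (intro sum_nonneg) auto
  then have q: "q > 0" using False by (simp add: q_def)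
  define r where "r = sqrt (n / q)"
  have r2: "r\<^sup>2 = n / q" using q by (simp add: r_def)
  have *: "s * bilin n w x x \<le> c * q" if "s\<^sup>2 = 1" for s :: real
  proof -
    define u where "u = (\<lambda>i. r * x i)"
    define v where "v = (\<lambda>i. s * (r * x i))"
    have "(\<Sum>i<n. (u i)\<^sup>2) = r\<^sup>2 * q" by (simp add: u_def power_mult_distrib sum_distrib_left q_def)
    then have u: "(\<Sum>i<n. (u i)\<^sup>2) \<le> n" using q by (simp add: r2)
    have v: "(\<Sum>i<n. (v i)\<^sup>2) \<le> n" using u that by (simp add: v_def u_def power_mult_distrib)
    obtain \<xi> \<eta> where "\<xi> \<in> int_net n" "\<eta> \<in> int_net n" "\<forall>i<n. u i = 0 \<longrightarrow> \<xi> i = 0" "\<forall>i<n. v i = 0 \<longrightarrow> \<eta> i = 0"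
      "bilin n w u v \<le> bilin n w (\<lambda>i. \<xi> i) (\<lambda>i. \<eta> i)"
      using bilin_int_rounding[OF u v, of w] by blast
    then have "bilin n w u v \<le> c * n" using le[of \<xi> \<eta>] x by (fastforce simp: u_def v_def)
    moreover have "bilin n w u v = s * r\<^sup>2 * bilin n w x x"
      by (simp add: bilin_def u_def v_def sum_distrib_left power2_eq_square mult_ac)
    ultimately have "s * (n / q) * bilin n w x x \<le> c * n" by (simp add: r2)
    then have "n * (s * bilin n w x x) \<le> n * (c * q)" using q by (simp add: field_simps)
    then show ?thesis using n by simp
  qed
  show ?thesis using *[of 1] *[of "-1"] by (simp add: q_def abs_le_iff)
qed

text \<open>The cut-off \<open>h\<close> keeps the exponential tilts in the range where a sparse
  entry still has a Gaussian-type moment bound.\<close>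

definition light_sum :: "nat \<Rightarrow> real \<Rightarrow> (nat \<Rightarrow> nat \<Rightarrow> real) \<Rightarrow> (nat \<Rightarrow> int) \<Rightarrow> (nat \<Rightarrow> int) \<Rightarrow> real" where
  "light_sum n h w \<xi> \<eta> = (\<Sum>i<n. \<Sum>j<n. (if \<bar>real_of_int (\<xi> i * \<eta> j)\<bar> \<le> h then \<xi> i * \<eta> j else 0) * w i j)"

text \<open>Budget of the union bound: at tilt \<open>l\<close> the log-moment of a net pair is at
  most \<open>8 * n\<close>, the deviation is \<open>21 * n\<close>, and the resulting
  \<open>exp (- 13 * n)\<close> absorbs at most \<open>exp (12 * n)\<close> pairs and leaves
  \<open>exp (- n)\<close>. Undoing the scale \<open>l\<close> turns 21 into 42.\<close>

lemma (in entry_model) light_sums_bounded: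
  fixes m :: "nat \<Rightarrow> nat \<Rightarrow> real" and v h :: real
  assumes v: "v > 0" and h: "h \<ge> 0" and msym: "\<And>i j. m i j = m j i"
    and mgf: "\<And>u i j. i \<le> j \<Longrightarrow> j < n \<Longrightarrow> \<bar>u\<bar> \<le> h / sqrt (n * v) \<Longrightarrow>
      (\<integral>\<^sup>+x. ennreal (exp (u * (x - m i j))) \<partial>D (\<sigma> $ i * \<sigma> $ j)) \<le> ennreal (exp (v * u\<^sup>2))"
  shows "\<exists>E\<in>events. 1 - exp (- real n) \<le> prob E \<and> (\<forall>\<omega>\<in>E. \<forall>\<xi>\<in>int_net n. \<forall>\<eta>\<in>int_net n.
    light_sum n h (\<lambda>i j. obs \<omega> i j - m i j) \<xi> \<eta> \<le> 42 * sqrt (n * v) * n)"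
proof -
  \<comment> \<open>The factor 2 leaves room for off-diagonal entries, which receive two
    coefficients: their tilt is at most \<open>2 * l * h = h / sqrt (n * v)\<close>.\<close>
  define l where "l = 1 / (2 * sqrt (n * v))"
  have sp: "sqrt (n * v) > 0" using n_pos v by simp
  have l: "l > 0" using sp by (simp add: l_def)
  define c where "c = (\<lambda>(\<xi> :: nat \<Rightarrow> int) (\<eta> :: nat \<Rightarrow> int) (i :: nat) (j :: nat). if \<bar>real_of_int (\<xi> i * \<eta> j)\<bar> \<le> h then real_of_int (\<xi> i * \<eta> j) else 0)"
  define g where "g = (\<lambda>\<xi> \<eta> i j x. l * c \<xi> \<eta> i j * (x - m i j))"
  define A where "A = (\<lambda>(\<xi>, \<eta>). {\<omega> \<in> space P. 21 * n \<le> (\<Sum>i<n. \<Sum>j<n. g \<xi> \<eta> i j (obs \<omega> i j))})"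
  have ch: "A (\<xi>, \<eta>) \<in> events \<and> prob (A (\<xi>, \<eta>)) \<le> exp (- 13 * n)" if \<xi>: "\<xi> \<in> int_net n" and \<eta>: "\<eta> \<in> int_net n" for \<xi> \<eta>
  proof -
    define b where "b = (\<lambda>i j. v * l\<^sup>2 * 2 * (c \<xi> \<eta> i j)\<^sup>2)"
    have cb: "\<bar>c \<xi> \<eta> i j\<bar> \<le> h" for i j using h by (simp add: c_def)
    have 2: "2 * l * h = h / sqrt (n * v)" by (simp add: l_def)
    have off: "(\<integral>\<^sup>+x. ennreal (exp (g \<xi> \<eta> i j x + g \<xi> \<eta> j i x)) \<partial>D (\<sigma> $ i * \<sigma> $ j)) \<le> ennreal (exp (b i j + b j i))"
      if "i < j" "j < n" for i j
    proof -
      define u where "u = l * (c \<xi> \<eta> i j + c \<xi> \<eta> j i)"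
      have "\<bar>u\<bar> \<le> l * (h + h)" unfolding u_def abs_mult using l cb[of i j] cb[of j i]
        by (intro mult_mono) auto
      then have ub: "\<bar>u\<bar> \<le> h / sqrt (n * v)" using 2 by simp
      have "g \<xi> \<eta> i j x + g \<xi> \<eta> j i x = u * (x - m i j)" for x
        by (simp add: g_def u_def msym[of j i] algebra_simps)
      then have 1: "(\<integral>\<^sup>+x. ennreal (exp (g \<xi> \<eta> i j x + g \<xi> \<eta> j i x)) \<partial>D (\<sigma> $ i * \<sigma> $ j)) \<le> ennreal (exp (v * u\<^sup>2))"
        using mgf[OF _ that(2) ub, of i] that by simp
      have "(c \<xi> \<eta> i j + c \<xi> \<eta> j i)\<^sup>2 \<le> 2 * (c \<xi> \<eta> i j)\<^sup>2 + 2 * (c \<xi> \<eta> j i)\<^sup>2"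
        using zero_le_power2[of "c \<xi> \<eta> i j - c \<xi> \<eta> j i"] by (simp add: power2_sum power2_diff)
      from mult_left_mono[OF this, of "v * l\<^sup>2"]
      have "v * l\<^sup>2 * (c \<xi> \<eta> i j + c \<xi> \<eta> j i)\<^sup>2 \<le> b i j + b j i"
        using v by (simp add: b_def distrib_left mult.assoc)
      then have "v * u\<^sup>2 \<le> b i j + b j i" by (simp add: u_def power_mult_distrib mult.assoc)
      then have "ennreal (exp (v * u\<^sup>2)) \<le> ennreal (exp (b i j + b j i))" by (simp add: ennreal_leI)
      with 1 show ?thesis by (rule order_trans)
    qed
    have diag: "(\<integral>\<^sup>+x. ennreal (exp (g \<xi> \<eta> i i x)) \<partial>D (\<sigma> $ i * \<sigma> $ i)) \<le> ennreal (exp (b i i))" if "i < n" for i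
    proof -
      define u where "u = l * c \<xi> \<eta> i i"
      have "\<bar>u\<bar> \<le> l * h" unfolding u_def abs_mult using l cb[of i i] by (intro mult_mono) auto
      also have "\<dots> \<le> 2 * l * h" using l h by simp
      finally have ub: "\<bar>u\<bar> \<le> h / sqrt (n * v)" using 2 by simp
      have "g \<xi> \<eta> i i x = u * (x - m i i)" for x by (simp add: g_def u_def)
      then have 1: "(\<integral>\<^sup>+x. ennreal (exp (g \<xi> \<eta> i i x)) \<partial>D (\<sigma> $ i * \<sigma> $ i)) \<le> ennreal (exp (v * u\<^sup>2))"
        using mgf[OF _ that ub, of i] by simp
      have "v * u\<^sup>2 \<le> b i i" using v by (simp add: b_def u_def power_mult_distrib)
      then have "ennreal (exp (v * u\<^sup>2)) \<le> ennreal (exp (b i i))" by (simp add: ennreal_leI)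
      with 1 show ?thesis by (rule order_trans)
    qed
    have gm: "\<And>i j. g \<xi> \<eta> i j \<in> borel_measurable borel" by (simp add: g_def)
    note t = tail[of "g \<xi> \<eta>" b "21 * real n", OF gm off diag]
    have "(\<Sum>i<n. (real_of_int (\<xi> i))\<^sup>2) * (\<Sum>j<n. (real_of_int (\<eta> j))\<^sup>2) \<le> (4 * real n) * (4 * real n)"
      using int_net_sq[OF \<xi>] int_net_sq[OF \<eta>] by (intro mult_mono) (auto intro: sum_nonneg)
    moreover have "(\<Sum>i<n. \<Sum>j<n. (c \<xi> \<eta> i j)\<^sup>2) \<le> (\<Sum>i<n. (real_of_int (\<xi> i))\<^sup>2) * (\<Sum>j<n. (real_of_int (\<eta> j))\<^sup>2)"
      unfolding sum_product by (intro sum_mono) (auto simp: c_def power_mult_distrib)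
    ultimately have cc: "(\<Sum>i<n. \<Sum>j<n. (c \<xi> \<eta> i j)\<^sup>2) \<le> 16 * real n * real n" by linarith
    have beq: "(\<Sum>i<n. \<Sum>j<n. b i j) = v * l\<^sup>2 * 2 * (\<Sum>i<n. \<Sum>j<n. (c \<xi> \<eta> i j)\<^sup>2)"
      by (simp add: b_def sum_distrib_left)
    have "v * l\<^sup>2 * 2 * (\<Sum>i<n. \<Sum>j<n. (c \<xi> \<eta> i j)\<^sup>2) \<le> v * l\<^sup>2 * 2 * (16 * real n * real n)"
      using v cc by (intro mult_left_mono) auto
    moreover have "v * l\<^sup>2 * 2 * (16 * real n * real n) = 8 * real n"
      using v n_pos by (simp add: l_def power_divide power_mult_distrib)
    ultimately have "(\<Sum>i<n. \<Sum>j<n. b i j) - 21 * real n \<le> - 13 * real n" unfolding beq by linarith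
    then have "exp ((\<Sum>i<n. \<Sum>j<n. b i j) - 21 * real n) \<le> exp (- 13 * n)" by simp
    then show ?thesis using t(1) order_trans[OF t(2)] by (simp add: A_def)
  qed
  define K where "K = int_net n \<times> int_net n"
  have "(\<Sum>k\<in>K. exp (- 13 * n)) \<le> exp (- real n)"
  proof -
    have "(\<Sum>k\<in>K. exp (- 13 * n)) = real (card (int_net n)) * real (card (int_net n)) * exp (- 13 * n)"
      by (simp add: K_def card_cartesian_product)
    also have "\<dots> \<le> exp (6 * real n) * exp (6 * real n) * exp (- 13 * n)"
      using card_int_net_le[of n] by (intro mult_right_mono mult_mono) auto
    also have "\<dots> = exp (- real n)" by (simp add: exp_add[symmetric])
    finally show ?thesis .
  qed
  then have U: "(\<Union>k\<in>K. A k) \<in> events" "prob (\<Union>k\<in>K. A k) \<le> exp (- real n)"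
    using prob_Union_le[of K A "\<lambda>_. exp (- 13 * n)" "exp (- real n)"] ch finite_int_net
    by (auto simp: K_def)
  show ?thesis
  proof (intro bexI[of _ "space P - (\<Union>k\<in>K. A k)"] conjI ballI)
    show "1 - exp (- real n) \<le> prob (space P - (\<Union>k\<in>K. A k))" using U by (simp add: prob_compl)
    fix \<omega> \<xi> \<eta> assume "\<omega> \<in> space P - (\<Union>k\<in>K. A k)" "\<xi> \<in> int_net n" "\<eta> \<in> int_net n"
    then have "(\<Sum>i<n. \<Sum>j<n. g \<xi> \<eta> i j (obs \<omega> i j)) < 21 * n" by (force simp: A_def K_def)
    moreover have "(\<Sum>i<n. \<Sum>j<n. g \<xi> \<eta> i j (obs \<omega> i j)) = l * light_sum n h (\<lambda>i j. obs \<omega> i j - m i j) \<xi> \<eta>"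
      unfolding light_sum_def sum_distrib_left by (intro sum.cong refl) (simp add: g_def c_def)
    ultimately show "light_sum n h (\<lambda>i j. obs \<omega> i j - m i j) \<xi> \<eta> \<le> 42 * sqrt (n * v) * n"
      using sp by (simp add: l_def field_simps)
  qed (use U in auto)
qed

section \<open>Heavy pairs\<close>

text \<open>The logarithm of \<open>(e * n / s)^s\<close>, the standard upper bound for the number
  of \<open>s\<close>-subsets.\<close>

definition entropy_bound :: "nat \<Rightarrow> nat \<Rightarrow> real" where
  "entropy_bound n s = s * (1 + ln (n / s))"

definition edge_mass :: "(nat \<Rightarrow> nat \<Rightarrow> real) \<Rightarrow> nat set \<Rightarrow> nat set \<Rightarrow> real" where
  "edge_mass a S T = (\<Sum>i\<in>S. \<Sum>j\<in>T. a i j)"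

lemma geometric_tail_le:
  fixes c :: real
  shows "(\<Sum>a<L. if real a \<le> c then exp (- (c - a) / 2) else 0) \<le> 3"
proof -
  define q :: real where "q = exp (- 1 / 2)"
  have q: "0 < q" "q \<le> 2 / 3"
    using exp_ge_add_one_self[of "1 / 2 :: real"] by (auto simp: q_def exp_minus divide_simps)
  show ?thesis
  proof (cases "c \<ge> 0")
    case False
    then show ?thesis by (simp add: sum.neutral)
  next
    case True
    define m where "m = nat \<lfloor>c\<rfloor>"
    have m: "real m \<le> c" "\<And>a. real a \<le> c \<Longrightarrow> a \<le> m" using True unfolding m_def by linarith+
    have "(\<Sum>a<L. if real a \<le> c then exp (- (c - a) / 2) else 0)
        \<le> (\<Sum>a<L. if a \<le> m then q ^ (m - a) else 0)"
    proof (rule sum_mono)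
      fix a
      show "(if real a \<le> c then exp (- (c - a) / 2) else 0) \<le> (if a \<le> m then q ^ (m - a) else 0)"
      proof (cases "real a \<le> c")
        case True
        then have am: "a \<le> m" by (rule m)
        then have "real (m - a) = real m - real a" by simp
        then have eq: "real (m - a) * (- 1 / 2) = - ((real m - real a) / 2)" by simp
        have "- (c - a) / 2 \<le> real (m - a) * (- 1 / 2)" 
        proof -
          have "(real m - a) / 2 \<le> (c - a) / 2" using m(1) by (intro divide_right_mono) auto
          then have "- (c - a) / 2 \<le> - ((real m - a) / 2)" by (simp only: minus_divide_left[symmetric] neg_le_iff_le)
          then show ?thesis by (simp only: eq)
        qed
        then have "exp (- (c - a) / 2) \<le> exp (real (m - a) * (- 1 / 2))" by simp
        also have "\<dots> = q ^ (m - a)" unfolding q_def by (rule exp_of_nat_mult)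
        finally show ?thesis using am True by simp
      qed (use q in auto)
    qed
    also have "\<dots> = (\<Sum>a\<in>{..<L} \<inter> {..m}. q ^ (m - a))"
      by (simp add: sum.inter_restrict)
    also have "\<dots> \<le> (\<Sum>a\<in>{..m}. q ^ (m - a))" using q by (intro sum_mono2) auto
    also have "\<dots> = (\<Sum>k\<in>{..m}. q ^ k)"
      by (rule sum.reindex_bij_witness[of _ "\<lambda>k. m - k" "\<lambda>k. m - k"]) auto
    also have "\<dots> = (1 - q ^ Suc m) / (1 - q)"
      using q sum_gp[of q 0 m] by (simp add: atMost_atLeast0)
    also have "\<dots> \<le> 1 / (1 - q)" using q by (intro divide_right_mono) auto
    also have "\<dots> \<le> 3" using q by (simp add: divide_simps)
    finally show ?thesis .
  qed
qed

lemma exp_neg_sum_le: "(\<Sum>b<L. exp (- real b)) \<le> 2"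
proof -
  define q :: real where "q = exp (- 1)"
  have q: "0 < q" "q \<le> 1 / 2"
    using exp_ge_add_one_self[of "1 :: real"] by (auto simp: q_def exp_minus divide_simps)
  have "(\<Sum>b<L. exp (- real b)) = (\<Sum>b<L. q ^ b)"
    using exp_of_nat_mult[of _ "- 1 :: real"] by (simp add: q_def)
  also have "\<dots> = (1 - q ^ L) / (1 - q)"
    using q geometric_sum[of q L] by (simp add: divide_simps) (simp add: algebra_simps)
  also have "\<dots> \<le> 1 / (1 - q)" using q by (intro divide_right_mono) auto
  also have "\<dots> \<le> 2" using q by (simp add: divide_simps)
  finally show ?thesis .
qed

text \<open>A level with \<open>t\<close> coordinates of size about \<open>exp b\<close> has squared
  mass \<beta>. With \<open>u = t * exp (2 * b) / n\<close> the scaled entropy is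
  \<open>n * (u * (1 + 2 * b) - u * ln u)\<close>. The logarithm costs at most
  \<open>2 * b * u\<close> unless \<open>u < exp (- 2 * b)\<close>, and then
  \<open>- u * ln u \<le> 2 * sqrt u\<close> is below \<open>2 * exp (- b)\<close>. Dividing by
  \<open>1 + b\<close> removes the linear factor and leaves a bound that is summable over the
  levels.\<close>

lemma scaled_entropy_le:
  assumes t: "t > 0" and n: "n > 0" and \<beta>: "real t * exp (2 * real b) \<le> \<beta>"
  shows "exp (2 * real b) * entropy_bound n t / (1 + real b) \<le> 4 * \<beta> + 2 * real n * exp (- real b)"
proof -
  define u where "u = t * exp (2 * real b) / n"
  have u: "u > 0" using t n by (simp add: u_def)
  have nu: "n * u \<le> \<beta>" using \<beta> n by (simp add: u_def)
  have "ln u = ln (real t) + 2 * b - ln (real n)"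
    using t n by (simp add: u_def ln_div ln_mult)
  then have "exp (2 * real b) * entropy_bound n t = n * (u * (1 + 2 * real b) + (- (u * ln u)))"
    using t n by (simp add: entropy_bound_def ln_div u_def) (simp add: field_simps)
  also have "\<dots> \<le> n * ((1 + real b) * (4 * u + 2 * exp (- real b)))"
  proof (rule mult_left_mono)
    have 1: "- (u * ln u) \<le> 2 * real b * u + 2 * exp (- real b)"
    proof (cases "u \<ge> exp (- 2 * real b)")
      case True
      then have "ln u \<ge> - 2 * real b" using ln_ge_iff[OF u] by simp
      then have "u * (- ln u) \<le> u * (2 * real b)" using u by (intro mult_left_mono) auto
      then have "- (u * ln u) \<le> 2 * real b * u" by (simp add: mult_ac)
      moreover have "0 \<le> 2 * exp (- real b)" by simp
      ultimately show ?thesis by linarith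
    next
      case False
      have su: "sqrt u > 0" using u by simp
      have "ln (1 / sqrt u) \<le> 1 / sqrt u - 1" using su by (intro ln_le_minus_one) auto
      moreover have "ln (1 / sqrt u) = - (ln u / 2)" using u by (simp add: ln_div ln_sqrt)
      moreover have "2 / sqrt u = 2 * (1 / sqrt u)" by simp
      ultimately have "- ln u \<le> 2 / sqrt u" by linarith
      then have "u * (- ln u) \<le> u * (2 / sqrt u)" using u by (intro mult_left_mono) auto
      also have "\<dots> = 2 * (u / sqrt u)" by simp
      also have "\<dots> = 2 * sqrt u" using u by (simp only: real_div_sqrt)
      also have "sqrt u \<le> sqrt (exp (- 2 * real b))" using False by simp
      also have "sqrt (exp (- 2 * real b)) = exp (- real b)"
        by (rule real_sqrt_unique) (simp_all add: power2_eq_square exp_add[symmetric])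
      finally have "- (u * ln u) \<le> 2 * exp (- real b)" by simp
      moreover have "0 \<le> 2 * real b * u" using u by simp
      ultimately show ?thesis by linarith
    qed
    have "u * (1 + 2 * real b) + (2 * real b * u + 2 * exp (- real b)) \<le> (1 + real b) * (4 * u + 2 * exp (- real b))"
      using u by (simp add: algebra_simps)
    then show "u * (1 + 2 * real b) + (- (u * ln u)) \<le> (1 + real b) * (4 * u + 2 * exp (- real b))" using 1 by linarith
  qed simp
  finally have "exp (2 * real b) * entropy_bound n t / (1 + real b) \<le> n * (4 * u + 2 * exp (- real b))"
    by (simp add: divide_simps mult_ac)
  also have "\<dots> \<le> 4 * \<beta> + 2 * real n * exp (- real b)" using nu by (simp add: algebra_simps)
  finally show ?thesis .
qed

text \<open>Supplies the factor \<open>1 / (1 + b)\<close> that \<open>scaled_entropy_le\<close>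
  consumes. With \<open>m = b + l + 1 - a\<close>, either \<open>m \<le> b + 3\<close> and \<rho>
  itself is at least \<open>1 + b\<close>, or half of the decay \<open>exp (- m)\<close> pays for
  \<open>1 + b\<close>; the other half remains as a geometric weight.\<close>

lemma level_ratio_le:
  fixes l \<rho> :: real and a b :: nat
  assumes \<rho>: "\<rho> \<ge> 1" "\<rho> \<ge> real a + real b - l + 3" and ab: "a \<le> b + l + 1"
  shows "exp (real a + b) / \<rho> \<le> 2 * exp 1 * exp l * (exp (2 * real b) / (1 + real b)) * exp (- (b + l + 1 - a) / 2)"
proof -
  define m where "m = b + l + 1 - a"
  have m: "m \<ge> 0" using ab by (simp add: m_def)
  have "1 + real b \<le> 2 * exp (m / 2) * \<rho>"
  proof (cases "m \<le> b + 3")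
    case True
    then have "1 + real b \<le> \<rho>" using \<rho> by (simp add: m_def)
    moreover have "1 \<le> 2 * exp (m / 2)" using m one_le_exp_iff[of "m / 2"] by linarith
    ultimately show ?thesis using mult_mono[of 1 "2 * exp (m / 2)" "1 + real b" \<rho>] by simp
  next
    case False
    then have "1 + real b \<le> 2 * exp (m / 2)" using exp_ge_add_one_self[of "m / 2"] by linarith
    moreover have "2 * exp (m / 2) * 1 \<le> 2 * exp (m / 2) * \<rho>" using \<rho> by (intro mult_left_mono) auto
    ultimately show ?thesis by linarith
  qed
  then have 1: "1 / \<rho> \<le> 2 * exp (m / 2) / (1 + real b)" using \<rho> by (simp add: divide_simps mult_ac)
  have 2: "exp (real a + b) = exp 1 * exp l * exp (2 * real b) * exp (- m)"
    by (simp add: m_def exp_add[symmetric])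
  have "exp (real a + b) / \<rho> = exp (real a + b) * (1 / \<rho>)" by simp
  also have "\<dots> \<le> exp (real a + b) * (2 * exp (m / 2) / (1 + real b))"
    using 1 by (intro mult_left_mono) auto
  also have "\<dots> = 2 * exp 1 * exp l * (exp (2 * real b) / (1 + real b)) * (exp (- m) * exp (m / 2))"
    unfolding 2 by simp
  also have "exp (- m) * exp (m / 2) = exp (- m / 2)" by (simp add: exp_add[symmetric])
  finally show ?thesis by (simp add: m_def)
qed

text \<open>
  The sum is split by the levels \<open>a = \<lfloor>ln \<bar>\<xi> i\<bar>\<rfloor>\<close>, \<open>b = \<lfloor>ln \<bar>\<eta> j\<bar>\<rfloor>\<close>, and the discrepancy hypothesis is used on
  each pair of level sets with \<open>r\<close> about \<open>a + b - ln d / 2 + 3\<close>, which makes the main term geometric.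
\<close>

definition heavy_const :: real where
  "heavy_const = 32 * exp 6 + 2880 * exp 3"

lemma balanced_heavy_sum_le:
  fixes a :: "nat \<Rightarrow> nat \<Rightarrow> real" and \<xi> \<eta> :: "nat \<Rightarrow> int" and d :: real
  assumes n: "n > 0" and d: "d \<ge> 1"
    and a: "\<And>i j. i < n \<Longrightarrow> j < n \<Longrightarrow> 0 \<le> a i j"
    and disc: "\<And>S T r. S \<subseteq> {..<n} \<Longrightarrow> T \<subseteq> {..<n} \<Longrightarrow> S \<noteq> {} \<Longrightarrow> T \<noteq> {} \<Longrightarrow> r \<in> {1..8 * n + 4} \<Longrightarrow>
      real r / 2 * edge_mass a S T \<le> d / n * card S * card T * exp r
        + 6 * (entropy_bound n (card S) + entropy_bound n (card T))"
    and \<xi>: "(\<Sum>i<n. (real_of_int (\<xi> i))\<^sup>2) \<le> 4 * real n" and \<eta>: "(\<Sum>i<n. (real_of_int (\<eta> i))\<^sup>2) \<le> 4 * real n"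
  defines "x \<equiv> \<lambda>i. \<bar>real_of_int (\<xi> i)\<bar>" and "y \<equiv> \<lambda>i. \<bar>real_of_int (\<eta> i)\<bar>"
  shows "(\<Sum>i<n. \<Sum>j<n. if x i * y j > sqrt d \<and> x i \<le> sqrt d * y j \<and> y j \<le> sqrt d * x i
      then a i j * x i * y j else 0) \<le> heavy_const * sqrt d * real n"
proof -
  define l where "l = ln d / 2"
  have l0: "l \<ge> 0" using d by (simp add: l_def)
  have el: "exp l = sqrt d" using d by (simp add: l_def ln_sqrt[symmetric])
  define lev where "lev = (\<lambda>z :: real. nat \<lfloor>ln z\<rfloor>)"
  have lev: "exp (real (lev z)) \<le> z" "z < exp (real (lev z) + 1)" if "z \<ge> 1" for z
  proof -
    have "real (lev z) = of_int \<lfloor>ln z\<rfloor>" using that by (simp add: lev_def)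
    then have *: "real (lev z) \<le> ln z" "ln z < real (lev z) + 1" by linarith+
    show "exp (real (lev z)) \<le> z" using that * ln_ge_iff[of z "real (lev z)"] by simp
    have "exp (ln z) < exp (real (lev z) + 1)" using *(2) by simp
    then show "z < exp (real (lev z) + 1)" using that by simp
  qed
  \<comment> \<open>A crude bound on the levels is enough: the sums over them are controlled by
    geometric series of any length, so only the range \<open>8 * n + 4\<close> of \<open>r\<close>
    depends on it.\<close>
  define Lv where "Lv = 4 * n"
  have levL: "lev \<bar>real_of_int (\<zeta> i)\<bar> < Lv" if "(\<Sum>i<n. (real_of_int (\<zeta> i))\<^sup>2) \<le> 4 * real n" "i < n" "\<zeta> i \<noteq> 0" for \<zeta> :: "nat \<Rightarrow> int" and i
  proof -
    define z where "z = \<bar>real_of_int (\<zeta> i)\<bar>"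
    have z1: "z \<ge> 1" using that(3) unfolding z_def by linarith
    have "z \<le> z\<^sup>2" using mult_left_mono[OF z1, of z] z1 by (simp add: power2_eq_square)
    also have "z\<^sup>2 \<le> (\<Sum>i<n. (real_of_int (\<zeta> i))\<^sup>2)"
      unfolding z_def power2_abs using that(2) by (intro member_le_sum) auto
    finally have "z \<le> 4 * real n" using that(1) by linarith
    moreover have "ln z \<le> z - 1" using z1 by (intro ln_le_minus_one) auto
    ultimately have "ln z < 4 * real n" by linarith
    then show ?thesis unfolding z_def[symmetric] lev_def Lv_def using z1 n by (simp add: nat_less_iff floor_less_iff)
  qed
  define S where "S = (\<lambda>k. {i. i < n \<and> \<xi> i \<noteq> 0 \<and> lev (x i) = k})"
  define T where "T = (\<lambda>k. {i. i < n \<and> \<eta> i \<noteq> 0 \<and> lev (y i) = k})"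
  have fS: "finite (S k)" "S k \<subseteq> {..<n}" and fT: "finite (T k)" "T k \<subseteq> {..<n}" for k by (auto simp: S_def T_def)
  have x1: "x i \<ge> 1" if "\<xi> i \<noteq> 0" for i using that unfolding x_def by linarith
  have y1: "y i \<ge> 1" if "\<eta> i \<noteq> 0" for i using that unfolding y_def by linarith
  have SD: "i < n" "exp (real k) \<le> x i" "x i < exp (real k + 1)" if "i \<in> S k" for i k
    using that lev[OF x1, of i] by (auto simp: S_def)
  have TD: "i < n" "exp (real k) \<le> y i" "y i < exp (real k + 1)" if "i \<in> T k" for i k
    using that lev[OF y1, of i] by (auto simp: T_def)
  define \<alpha> where "\<alpha> = (\<lambda>k. \<Sum>i\<in>S k. (x i)\<^sup>2)"
  define \<beta> where "\<beta> = (\<lambda>k. \<Sum>i\<in>T k. (y i)\<^sup>2)"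
  have group: "(\<Sum>k<Lv. \<Sum>i\<in>{i. i < n \<and> \<zeta> i \<noteq> 0 \<and> lev \<bar>real_of_int (\<zeta> i)\<bar> = k}. f i) = (\<Sum>i\<in>{i. i < n \<and> \<zeta> i \<noteq> 0}. f i)"
    if "(\<Sum>i<n. (real_of_int (\<zeta> i))\<^sup>2) \<le> 4 * real n" for \<zeta> :: "nat \<Rightarrow> int" and f :: "nat \<Rightarrow> real"
    using sum.group[of "{i. i < n \<and> \<zeta> i \<noteq> 0}" "{..<Lv}" "\<lambda>i. lev \<bar>real_of_int (\<zeta> i)\<bar>" f] levL[OF that]
    by (auto simp: conj_assoc)
  have gS: "(\<Sum>k<Lv. \<Sum>i\<in>S k. f i) = (\<Sum>i\<in>{i. i < n \<and> \<xi> i \<noteq> 0}. f i)" for f :: "nat \<Rightarrow> real"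
    using group[OF \<xi>, of f] by (simp add: S_def x_def)
  have gT: "(\<Sum>k<Lv. \<Sum>i\<in>T k. f i) = (\<Sum>i\<in>{i. i < n \<and> \<eta> i \<noteq> 0}. f i)" for f :: "nat \<Rightarrow> real"
    using group[OF \<eta>, of f] by (simp add: T_def y_def)
  have \<alpha>0: "0 \<le> \<alpha> k" and \<beta>0: "0 \<le> \<beta> k" for k by (auto simp: \<alpha>_def \<beta>_def intro: sum_nonneg)
  have \<alpha>sum: "(\<Sum>k<Lv. \<alpha> k) \<le> 4 * real n"
  proof -
    have "(\<Sum>k<Lv. \<alpha> k) \<le> (\<Sum>i<n. (x i)\<^sup>2)" unfolding \<alpha>_def gS by (intro sum_mono2) auto
    then show ?thesis using \<xi> by (simp add: x_def)
  qed
  have \<beta>sum: "(\<Sum>k<Lv. \<beta> k) \<le> 4 * real n"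
  proof -
    have "(\<Sum>k<Lv. \<beta> k) \<le> (\<Sum>i<n. (y i)\<^sup>2)" unfolding \<beta>_def gT by (intro sum_mono2) auto
    then show ?thesis using \<eta> by (simp add: y_def)
  qed
  have \<alpha>card: "card (S k) * exp (2 * real k) \<le> \<alpha> k" for k
  proof -
    have "(\<Sum>i\<in>S k. exp (2 * real k)) \<le> \<alpha> k" unfolding \<alpha>_def
    proof (rule sum_mono)
      fix i assume "i \<in> S k"
      then have "(exp (real k))\<^sup>2 \<le> (x i)\<^sup>2" using SD(2) by (intro power_mono) auto
      then show "exp (2 * real k) \<le> (x i)\<^sup>2" by (simp add: exp_double[symmetric] mult.commute)
    qed
    then show ?thesis by simp
  qed
  have \<beta>card: "card (T k) * exp (2 * real k) \<le> \<beta> k" for k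
  proof -
    have "(\<Sum>i\<in>T k. exp (2 * real k)) \<le> \<beta> k" unfolding \<beta>_def
    proof (rule sum_mono)
      fix i assume "i \<in> T k"
      then have "(exp (real k))\<^sup>2 \<le> (y i)\<^sup>2" using TD(2) by (intro power_mono) auto
      then show "exp (2 * real k) \<le> (y i)\<^sup>2" by (simp add: exp_double[symmetric] mult.commute)
    qed
    then show ?thesis by simp
  qed
  define ok where "ok = (\<lambda>i j. x i * y j > sqrt d \<and> x i \<le> sqrt d * y j \<and> y j \<le> sqrt d * x i)"
  define f where "f = (\<lambda>i j. if ok i j then a i j * x i * y j else 0)"
  \<comment> \<open>\<open>F\<close> is the right-hand side of \<open>scaled_entropy_le\<close> and
    \<open>g\<close> the geometric weight of \<open>level_ratio_le\<close>; the cut-off in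
    \<open>g\<close> is the level form of the ratio conditions in \<open>ok\<close>.\<close>
  define F where "F = (\<lambda>\<beta> b. 4 * \<beta> b + 2 * real n * exp (- real b))"
  define g where "g = (\<lambda>(b :: nat) (a :: nat). if real a \<le> b + l + 1 then exp (- (b + l + 1 - a) / 2) else 0)"
  define c where "c = 24 * exp 3 * sqrt d"
  have c0: "c \<ge> 0" using d by (simp add: c_def)
  have F0: "0 \<le> F \<alpha> k" "0 \<le> F \<beta> k" for k using \<alpha>0 \<beta>0 by (auto simp: F_def)
  have g0: "0 \<le> g p q" for p q by (simp add: g_def)
  have blk: "(\<Sum>i\<in>S p. \<Sum>j\<in>T q. f i j) \<le> 2 * exp 6 * sqrt d / n * (\<alpha> p * \<beta> q) + c * (F \<beta> q * g q p) + c * (F \<alpha> p * g p q)" for p q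
  proof (cases "\<exists>i\<in>S p. \<exists>j\<in>T q. ok i j")
    case False
    then have "(\<Sum>i\<in>S p. \<Sum>j\<in>T q. f i j) = 0" by (auto simp: f_def intro!: sum.neutral)
    then show ?thesis using \<alpha>0 \<beta>0 F0 g0 c0 d by simp
  next
    case True
    then obtain i j where i: "i \<in> S p" and j: "j \<in> T q" and okij: "ok i j" by blast
    have ne: "S p \<noteq> {}" "T q \<noteq> {}" using i j by auto
    have cp: "card (S p) > 0" "card (T q) > 0" using ne fS fT by (auto simp: card_gt_0_iff)
    have xpos: "x i > 0" "y j > 0" using SD(2)[OF i] TD(2)[OF j] by (auto intro: less_le_trans[OF exp_gt_zero])
    \<comment> \<open>The three conditions in \<open>ok\<close> become inequalities between the
      levels, with slack from rounding the logarithms: the product gives \<open>A1\<close>, the two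
      ratios \<open>A2\<close> and \<open>A3\<close>.\<close>
    have "exp l < exp (real p + 1) * exp (real q + 1)"
      using okij mult_strict_mono[OF SD(3)[OF i] TD(3)[OF j]] xpos unfolding el ok_def by simp
    then have A1: "l < real p + real q + 2" by (simp add: exp_add[symmetric])
    have "exp (real p) < exp l * exp (real q + 1)"
    proof -
      have "x i \<le> exp l * y j" using okij unfolding el ok_def by simp
      moreover have "exp l * y j < exp l * exp (real q + 1)" using TD(3)[OF j] by simp
      ultimately show ?thesis using SD(2)[OF i] by linarith
    qed
    then have A2: "p \<le> q + l + 1" by (simp add: exp_add[symmetric])
    have "exp (real q) < exp l * exp (real p + 1)"
    proof -
      have "y j \<le> exp l * x i" using okij unfolding el ok_def by simp
      moreover have "exp l * x i < exp l * exp (real p + 1)" using SD(3)[OF i] by simp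
      ultimately show ?thesis using TD(2)[OF j] by linarith
    qed
    then have A3: "q \<le> p + l + 1" by (simp add: exp_add[symmetric])
    \<comment> \<open>Up to constants \<open>exp r\<close> is \<open>exp (p + q) / sqrt d\<close>.
      Multiplied by \<open>d * exp (p + q)\<close> this gives
      \<open>sqrt d * exp (2 * p) * exp (2 * q)\<close>, so the main term is controlled by the
      product of the level masses. \<open>A1\<close> makes \<open>r\<close> at least one.\<close>
    define r where "r = nat \<lceil>real p + real q - l + 3\<rceil>"
    have r1: "real r \<ge> real p + real q - l + 3" "real r < real p + real q - l + 4" using A1 unfolding r_def by (auto simp: of_nat_nat) linarith+
    have "p < Lv" "q < Lv" using levL[OF \<xi>, of i] levL[OF \<eta>, of j] i j by (auto simp: S_def T_def x_def y_def)
    then have rR: "r \<in> {1..8 * n + 4}"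
    proof -
      have "real r < real p + real q + 4" using r1 l0 by linarith
      then have "r < p + q + 4" by linarith
      moreover have "r \<ge> 1" using r1(1) A1 by linarith
      ultimately show ?thesis using \<open>p < Lv\<close> \<open>q < Lv\<close> unfolding Lv_def by auto
    qed
    define s t where "s = card (S p)" and "t = card (T q)"
    define e where "e = edge_mass a (S p) (T q)"
    define H where "H = d / n * s * t * exp r"
    have rp: "real r \<ge> 1" using rR by auto
    have "real r / 2 * e \<le> H + 6 * (entropy_bound n s + entropy_bound n t)"
      using disc[OF fS(2) fT(2) ne rR] by (simp add: e_def H_def s_def t_def)
    then have eb: "e \<le> 2 * H / r + 12 * entropy_bound n s / r + 12 * entropy_bound n t / r"
      using rp by (simp add: divide_simps) (simp add: algebra_simps)
    have H0: "H \<ge> 0" using d by (simp add: H_def)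
    have "(\<Sum>i\<in>S p. \<Sum>j\<in>T q. f i j) \<le> (\<Sum>i\<in>S p. \<Sum>j\<in>T q. exp 2 * exp (real p + q) * a i j)"
    proof (intro sum_mono)
      fix i j assume ij: "i \<in> S p" "j \<in> T q"
      have a0: "0 \<le> a i j" using a SD(1)[OF ij(1)] TD(1)[OF ij(2)] by auto
      have "x i * y j \<le> exp (real p + 1) * exp (real q + 1)"
        using SD[OF ij(1)] TD[OF ij(2)] by (intro mult_mono) (auto simp: y_def)
      also have "\<dots> = exp 2 * exp (real p + q)" by (simp add: exp_add[symmetric])
      finally have "a i j * (x i * y j) \<le> a i j * (exp 2 * exp (real p + q))" using a0 by (intro mult_left_mono)
      then show "f i j \<le> exp 2 * exp (real p + q) * a i j" using a0 by (simp add: f_def mult_ac)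
    qed
    also have "\<dots> = exp 2 * exp (real p + q) * e" by (simp add: e_def edge_mass_def sum_distrib_left)
    also have "\<dots> \<le> exp 2 * exp (real p + q) * (2 * H / r + 12 * entropy_bound n s / r + 12 * entropy_bound n t / r)"
      using eb by (intro mult_left_mono) auto
    also have "\<dots> = exp 2 * exp (real p + q) * (2 * H / r) + 12 * exp 2 * (exp (real p + q) / r * entropy_bound n t)
        + 12 * exp 2 * (exp (real q + p) / r * entropy_bound n s)"
      by (simp add: algebra_simps)
    finally have main: "(\<Sum>i\<in>S p. \<Sum>j\<in>T q. f i j) \<le> \<dots>" .
    have st: "s > 0" "t > 0" "s \<le> n" "t \<le> n"
      using cp card_mono[OF _ fS(2)] card_mono[OF _ fT(2)] by (auto simp: s_def t_def)
    have eb0: "entropy_bound n s \<ge> 0" "entropy_bound n t \<ge> 0"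
      using st by (auto simp: entropy_bound_def)
    have M1: "exp 2 * exp (real p + q) * (2 * H / r) \<le> 2 * exp 6 * sqrt d / n * (\<alpha> p * \<beta> q)"
    proof -
      have er: "exp r \<le> exp (real p + q) * exp 4 / sqrt d"
      proof -
        have "exp r \<le> exp (real p + real q - l + 4)" using r1 by simp
        also have "\<dots> = exp (real p + q) * exp 4 / exp l" by (simp add: exp_add exp_diff)
        finally show ?thesis by (simp add: el)
      qed
      have "2 * H / r \<le> 2 * H" using mult_left_mono[OF rp, of H] rp H0 by (simp add: divide_simps)
      also have "\<dots> \<le> 2 * (d / n * s * t * (exp (real p + q) * exp 4 / sqrt d))"
        unfolding H_def using er d by (intro mult_left_mono) auto
      finally have "exp 2 * exp (real p + q) * (2 * H / r)
          \<le> exp 2 * exp (real p + q) * (2 * (d / n * s * t * (exp (real p + q) * exp 4 / sqrt d)))"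
        by (intro mult_left_mono) auto
      also have "\<dots> = 2 * (exp 2 * exp 4) * (d / sqrt d) / n * ((s * (exp (real p + q) * exp (real p + q))) * t)"
        by (simp add: mult_ac)
      also have "\<dots> = 2 * exp 6 * sqrt d / n * ((s * exp (2 * real p)) * (t * exp (2 * real q)))"
      proof -
        have "exp (real p + q) * exp (real p + q) = exp (2 * real p) * exp (2 * real q)"
          "exp 2 * exp 4 = exp (6 :: real)" "d / sqrt d = sqrt d"
          using d by (auto simp: exp_add[symmetric] real_div_sqrt)
        then show ?thesis by (simp only: mult_ac)
      qed
      also have "\<dots> \<le> 2 * exp 6 * sqrt d / n * (\<alpha> p * \<beta> q)"
        using \<alpha>card[of p] \<beta>card[of q] \<alpha>0 d unfolding s_def t_def
        by (intro mult_left_mono mult_mono) auto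
      finally show ?thesis .
    qed
    have M2: "12 * exp 2 * (exp (real p + q) / r * entropy_bound n t) \<le> c * (F \<beta> q * g q p)"
    proof -
      have "exp (real p + q) / r * entropy_bound n t
        \<le> 2 * exp 1 * exp l * (exp (2 * real q) / (1 + q)) * exp (- (q + l + 1 - p) / 2) * entropy_bound n t"
        using level_ratio_le[OF rp r1(1) A2] eb0 by (intro mult_right_mono) auto
      also have "\<dots> = 2 * exp 1 * sqrt d * g q p * (exp (2 * real q) * entropy_bound n t / (1 + q))"
        using A2 by (simp add: g_def el)
      also have "\<dots> \<le> 2 * exp 1 * sqrt d * g q p * F \<beta> q"
        unfolding F_def using scaled_entropy_le[OF st(2) n, of q "\<beta> q"] \<beta>card[of q] d g0 unfolding t_def
        by (intro mult_left_mono) auto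
      finally have "12 * exp 2 * (exp (real p + q) / r * entropy_bound n t) \<le> 12 * exp 2 * (2 * exp 1 * sqrt d * g q p * F \<beta> q)"
        by (intro mult_left_mono) auto
      also have "\<dots> = 24 * (exp 2 * exp 1) * sqrt d * (F \<beta> q * g q p)" by simp
      also have "exp 2 * exp 1 = exp (3 :: real)" by (simp add: exp_add[symmetric])
      finally show ?thesis by (simp add: c_def)
    qed
    have M3: "12 * exp 2 * (exp (real q + p) / r * entropy_bound n s) \<le> c * (F \<alpha> p * g p q)"
    proof -
      have r2: "real r \<ge> real q + real p - l + 3" using r1 by simp
      have "exp (real q + p) / r * entropy_bound n s
        \<le> 2 * exp 1 * exp l * (exp (2 * real p) / (1 + p)) * exp (- (p + l + 1 - q) / 2) * entropy_bound n s"
        using level_ratio_le[OF rp r2 A3] eb0 by (intro mult_right_mono) auto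
      also have "\<dots> = 2 * exp 1 * sqrt d * g p q * (exp (2 * real p) * entropy_bound n s / (1 + p))"
        using A3 by (simp add: g_def el)
      also have "\<dots> \<le> 2 * exp 1 * sqrt d * g p q * F \<alpha> p"
        unfolding F_def using scaled_entropy_le[OF st(1) n, of p "\<alpha> p"] \<alpha>card[of p] d g0 unfolding s_def
        by (intro mult_left_mono) auto
      finally have "12 * exp 2 * (exp (real q + p) / r * entropy_bound n s) \<le> 12 * exp 2 * (2 * exp 1 * sqrt d * g p q * F \<alpha> p)"
        by (intro mult_left_mono) auto
      also have "\<dots> = 24 * (exp 2 * exp 1) * sqrt d * (F \<alpha> p * g p q)" by simp
      also have "exp 2 * exp 1 = exp (3 :: real)" by (simp add: exp_add[symmetric])
      finally show ?thesis by (simp add: c_def)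
    qed
    show ?thesis using main M1 M2 M3 by linarith
  qed
  have "(\<Sum>i<n. \<Sum>j<n. f i j) = (\<Sum>i\<in>{i. i < n \<and> \<xi> i \<noteq> 0}. \<Sum>j\<in>{j. j < n \<and> \<eta> j \<noteq> 0}. f i j)"
  proof -
    have z: "f i j = 0" if "\<xi> i = 0 \<or> \<eta> j = 0" for i j using that d by (auto simp: f_def ok_def x_def y_def)
    have "(\<Sum>j<n. f i j) = (\<Sum>j\<in>{j. j < n \<and> \<eta> j \<noteq> 0}. f i j)" for i
      by (rule sum.mono_neutral_right) (auto simp: z)
    moreover have "(\<Sum>i<n. G i) = (\<Sum>i\<in>{i. i < n \<and> \<xi> i \<noteq> 0}. G i)" if "\<And>i. \<xi> i = 0 \<Longrightarrow> G i = 0" for G :: "nat \<Rightarrow> real"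
      by (rule sum.mono_neutral_right) (auto simp: that)
    ultimately show ?thesis by (simp add: z)
  qed
  also have "\<dots> = (\<Sum>p<Lv. \<Sum>q<Lv. \<Sum>i\<in>S p. \<Sum>j\<in>T q. f i j)"
  proof -
    have "(\<Sum>q<Lv. \<Sum>i\<in>S p. \<Sum>j\<in>T q. f i j) = (\<Sum>i\<in>S p. \<Sum>j\<in>{j. j < n \<and> \<eta> j \<noteq> 0}. f i j)" for p
      by (subst sum.swap) (simp add: gT)
    then show ?thesis by (simp add: gS)
  qed
  also have "\<dots> \<le> (\<Sum>p<Lv. \<Sum>q<Lv. 2 * exp 6 * sqrt d / n * (\<alpha> p * \<beta> q) + c * (F \<beta> q * g q p) + c * (F \<alpha> p * g p q))"
    by (intro sum_mono blk)
  also have "\<dots> = 2 * exp 6 * sqrt d / n * ((\<Sum>p<Lv. \<alpha> p) * (\<Sum>q<Lv. \<beta> q))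
      + c * (\<Sum>p<Lv. \<Sum>q<Lv. F \<beta> q * g q p) + c * (\<Sum>p<Lv. F \<alpha> p * (\<Sum>q<Lv. g p q))"
    by (simp only: sum.distrib sum_product sum_distrib_left[symmetric])
  also have "(\<Sum>p<Lv. \<Sum>q<Lv. F \<beta> q * g q p) = (\<Sum>q<Lv. F \<beta> q * (\<Sum>p<Lv. g q p))"
    by (subst sum.swap) (simp add: sum_distrib_left)
  also have "2 * exp 6 * sqrt d / n * ((\<Sum>p<Lv. \<alpha> p) * (\<Sum>q<Lv. \<beta> q)) + c * (\<Sum>q<Lv. F \<beta> q * (\<Sum>p<Lv. g q p)) + c * (\<Sum>p<Lv. F \<alpha> p * (\<Sum>q<Lv. g p q))
     \<le> 2 * exp 6 * sqrt d / n * ((4 * real n) * (4 * real n)) + c * (60 * real n) + c * (60 * real n)"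
  proof -
    have gs: "(\<Sum>p<Lv. g q p) \<le> 3" for q unfolding g_def by (rule geometric_tail_le)
    have Fs: "(\<Sum>q<Lv. F \<theta> q * (\<Sum>p<Lv. g q p)) \<le> 60 * real n"
      if "\<And>q. 0 \<le> F \<theta> q" "(\<Sum>q<Lv. \<theta> q) \<le> 4 * real n" for \<theta>
    proof -
      have "(\<Sum>q<Lv. F \<theta> q * (\<Sum>p<Lv. g q p)) \<le> (\<Sum>q<Lv. F \<theta> q * 3)"
        by (intro sum_mono mult_left_mono gs that)
      also have "\<dots> = 12 * (\<Sum>q<Lv. \<theta> q) + 6 * real n * (\<Sum>q<Lv. exp (- real q))"
        by (simp add: F_def sum.distrib sum_distrib_left sum_distrib_right algebra_simps)
      also have "\<dots> \<le> 12 * (4 * real n) + 6 * real n * 2"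
        using that(2) exp_neg_sum_le[of Lv] by (intro add_mono mult_left_mono) auto
      finally show ?thesis by simp
    qed
    have "(\<Sum>p<Lv. \<alpha> p) * (\<Sum>q<Lv. \<beta> q) \<le> (4 * real n) * (4 * real n)"
      using \<alpha>sum \<beta>sum \<alpha>0 \<beta>0 by (intro mult_mono) (auto intro: sum_nonneg)
    then have "2 * exp 6 * sqrt d / n * ((\<Sum>p<Lv. \<alpha> p) * (\<Sum>q<Lv. \<beta> q)) \<le> 2 * exp 6 * sqrt d / n * ((4 * real n) * (4 * real n))"
      using d by (intro mult_left_mono) auto
    moreover have "c * (\<Sum>q<Lv. F \<beta> q * (\<Sum>p<Lv. g q p)) \<le> c * (60 * real n)"
      using Fs[of \<beta>] F0 \<beta>sum c0 by (intro mult_left_mono) auto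
    moreover have "c * (\<Sum>p<Lv. F \<alpha> p * (\<Sum>q<Lv. g p q)) \<le> c * (60 * real n)"
      using Fs[of \<alpha>] F0 \<alpha>sum c0 by (intro mult_left_mono) auto
    ultimately show ?thesis by linarith
  qed
  \<comment> \<open>Origin of \<open>heavy_const\<close>: \<open>32 = 2 * 4 * 4\<close> from the two
    squared lengths, \<open>2880 = 2 * 24 * 60\<close> from the two entropy sums.\<close>
  also have "2 * exp 6 * sqrt d / n * ((4 * real n) * (4 * real n)) + c * (60 * real n) + c * (60 * real n) = heavy_const * sqrt d * real n"
    using n by (simp add: heavy_const_def c_def field_simps)
  finally show ?thesis by (simp add: f_def ok_def)
qed

section \<open>Discrepancy and degrees\<close>

text \<open>A weak form of Stirling's formula; the induction step is
  \<open>(1 + 1 / s)^s \<le> exp 1\<close>.\<close>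

lemma power_self_le_exp_fact: "real s ^ s \<le> exp s * fact s"
proof (induction s)
  case (Suc s)
  show ?case
  proof (cases "s = 0")
    case True
    then show ?thesis using exp_ge_add_one_self[of 1] by simp
  next
    case False
    have "(1 + 1 / s) ^ s \<le> exp (1 / s) ^ s"
      using exp_ge_add_one_self[of "1 / real s"] by (intro power_mono) auto
    also have "\<dots> = exp 1" using False by (simp add: exp_of_nat_mult[symmetric])
    finally have 1: "(1 + 1 / s) ^ s \<le> exp 1" .
    have "real (Suc s) = (1 + 1 / s) * s" using False by (simp add: field_simps)
    then have "real (Suc s) ^ Suc s = real (Suc s) * ((1 + 1 / s) ^ s * real s ^ s)"
      by (simp only: power_Suc power_mult_distrib)
    also have "\<dots> \<le> real (Suc s) * (exp 1 * (exp s * fact s))"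
      using 1 Suc.IH by (intro mult_left_mono mult_mono) auto
    also have "\<dots> = exp (real (Suc s)) * fact (Suc s)" by (simp add: exp_add mult_ac)
    finally show ?thesis .
  qed
qed simp

lemma binomial_le_exp_entropy:
  assumes "0 < s" "s \<le> n"
  shows "real (n choose s) \<le> exp (entropy_bound n s)"
proof -
  have pos: "real s > 0" "real n > 0" using assms by auto
  have "exp (entropy_bound n s) = exp (real s) * exp (real s * ln (n / s))"
    by (simp add: entropy_bound_def distrib_left exp_add)
  also have "exp (real s * ln (n / s)) = (n / s) ^ s"
    using pos by (simp add: exp_of_nat_mult)
  finally have e: "exp (entropy_bound n s) = exp s * real n ^ s / real s ^ s" by (simp add: power_divide)
  have "real (n choose s) * fact s \<le> real n ^ s"
    using binomial_fact_pow[of n s] by (metis of_nat_fact of_nat_le_iff of_nat_mult of_nat_power)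
  then have "real (n choose s) * (fact s * real s ^ s) \<le> real n ^ s * real s ^ s"
    using mult_right_mono[of _ _ "real s ^ s"] by (simp add: mult.assoc[symmetric])
  also have "\<dots> \<le> real n ^ s * (exp s * fact s)" by (intro mult_left_mono power_self_le_exp_fact) auto
  finally have "fact s * (real (n choose s) * real s ^ s) \<le> fact s * (real n ^ s * exp s)" by (simp add: mult_ac)
  then have "real (n choose s) * real s ^ s \<le> real n ^ s * exp s" by simp
  then show ?thesis unfolding e using pos by (simp add: field_simps)
qed

text \<open>Singletons have the least entropy among nonempty sets: the excess is
  \<open>(s - 1 - ln s) + (s - 1) * ln (n / s)\<close>, a sum of nonnegative terms.\<close>

lemma entropy_bound_ge:
  assumes "0 < s" "s \<le> n"
  shows "1 + ln n \<le> entropy_bound n s"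
proof -
  have "ln (real s) \<le> real s - 1" using assms by (intro ln_le_minus_one) auto
  moreover have "0 \<le> (real s - 1) * ln (n / s)" using assms by (intro mult_nonneg_nonneg) auto
  moreover have "entropy_bound n s = real s + (real s - 1) * ln (n / s) + ln n - ln s"
    using assms by (simp add: entropy_bound_def ln_div algebra_simps)
  ultimately show ?thesis by linarith
qed

text \<open>One unit of \<open>c\<close> pays for the number of subsets of each size; the remaining
  \<open>c - 1\<close> is evaluated at singletons, the worst of the \<open>n\<close> sizes.\<close>

lemma sum_subsets_exp_entropy_le:
  fixes c :: real
  assumes c: "c \<ge> 1"
  shows "(\<Sum>S\<in>{S. S \<subseteq> {..<n} \<and> S \<noteq> {}}. exp (- c * entropy_bound n (card S))) \<le> n * exp (- ((c - 1) * (1 + ln n)))"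
proof -
  define F where "F = {S. S \<subseteq> {..<n} \<and> S \<noteq> {}}"
  have finF: "finite F" unfolding F_def by (rule finite_subset[of _ "Pow {..<n}"]) auto
  have cardF: "card S \<in> {1..n}" if "S \<in> F" for S
    using that card_mono[of "{..<n}" S] finite_subset[of S "{..<n}"] by (auto simp: F_def card_gt_0_iff Suc_le_eq)
  have "(\<Sum>S\<in>F. exp (- c * entropy_bound n (card S))) = (\<Sum>s\<in>{1..n}. \<Sum>S\<in>{S \<in> F. card S = s}. exp (- c * entropy_bound n (card S)))"
    by (rule sum.group[symmetric]) (use finF cardF in auto)
  also have "\<dots> \<le> (\<Sum>s\<in>{1..n}. exp (- ((c - 1) * (1 + ln n))))"
  proof (rule sum_mono)
    fix s assume s: "s \<in> {1..n}"
    have "{S \<in> F. card S = s} = {S. S \<subseteq> {..<n} \<and> card S = s}" using s by (auto simp: F_def)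
    then have "card {S \<in> F. card S = s} = n choose s" using n_subsets[of "{..<n}" s] by simp
    then have "(\<Sum>S\<in>{S \<in> F. card S = s}. exp (- c * entropy_bound n (card S))) = (n choose s) * exp (- c * entropy_bound n s)"
      by simp
    also have "\<dots> \<le> exp (entropy_bound n s) * exp (- c * entropy_bound n s)"
      using s by (intro mult_right_mono binomial_le_exp_entropy) auto
    also have "\<dots> = exp (- ((c - 1) * entropy_bound n s))" by (simp add: exp_add[symmetric] algebra_simps)
    also have "\<dots> \<le> exp (- ((c - 1) * (1 + ln n)))"
      using c entropy_bound_ge[of s n] s by (simp add: mult_left_mono)
    finally show "(\<Sum>S\<in>{S \<in> F. card S = s}. exp (- c * entropy_bound n (card S))) \<le> exp (- ((c - 1) * (1 + ln n)))" by simp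
  qed
  also have "\<dots> = n * exp (- ((c - 1) * (1 + ln n)))" by simp
  finally show ?thesis by (simp add: F_def)
qed

context entry_model
begin

text \<open>Domination of the absolute entries, in moment generating function, by a Poisson variable
  of mean \<alpha>.\<close>

definition abs_mgf_le :: "real \<Rightarrow> bool" where
  "abs_mgf_le \<alpha> \<longleftrightarrow> (\<forall>u i j. i \<le> j \<longrightarrow> j < n \<longrightarrow> 0 \<le> u \<longrightarrow>
    (\<integral>\<^sup>+x. ennreal (exp (u * \<bar>x\<bar>)) \<partial>D (\<sigma> $ i * \<sigma> $ j)) \<le> ennreal (exp (\<alpha> * (exp u - 1))))"

text \<open>The tilt is \<open>r / 2\<close> because an entry with both indices in \<open>S\<close>
  and in \<open>T\<close> is counted twice. Its total tilt is then still \<open>r\<close>, and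
  \<open>exp (q * r / 2) - 1 \<le> q * exp r\<close> for multiplicities \<open>q\<close> up to 2
  adds up to the main term.\<close>

lemma edge_mass_tail:
  fixes \<alpha> r z :: real
  assumes \<alpha>: "\<alpha> \<ge> 0" and r: "r \<ge> 0" and ST: "S \<subseteq> {..<n}" "T \<subseteq> {..<n}"
    and mgf: "abs_mgf_le \<alpha>"
  defines "A \<equiv> {\<omega> \<in> space P. \<alpha> * card S * card T * exp r + z \<le> r / 2 * edge_mass (\<lambda>i j. \<bar>obs \<omega> i j\<bar>) S T}"
  shows "A \<in> events" "prob A \<le> exp (- z)"
proof -
  define k :: "nat \<Rightarrow> nat \<Rightarrow> real" where "k = (\<lambda>i j. if i \<in> S \<and> j \<in> T then 1 else 0)"
  define g where "g = (\<lambda>i j x. k i j * (r / 2) * \<bar>x :: real\<bar>)"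
  define b where "b = (\<lambda>i j. k i j * (\<alpha> * exp r))"
  have k: "k i j = 0 \<or> k i j = 1" for i j by (simp add: k_def)
  have ineq: "\<alpha> * (exp (q * (r / 2)) - 1) \<le> q * (\<alpha> * exp r)" if "q = 0 \<or> q = 1 \<or> q = 2" for q
  proof -
    have "exp (r / 2) \<le> exp r" using r by simp
    moreover have "- 1 \<le> exp r" by (rule order_trans[OF _ exp_ge_zero]) simp
    ultimately have "exp (q * (r / 2)) - 1 \<le> q * exp r"
      using that by (elim disjE; simp del: exp_le_cancel_iff)
    from mult_left_mono[OF this \<alpha>] show ?thesis by (simp add: mult_ac)
  qed
  have off: "(\<integral>\<^sup>+x. ennreal (exp (g i j x + g j i x)) \<partial>D (\<sigma> $ i * \<sigma> $ j)) \<le> ennreal (exp (b i j + b j i))"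
    if "i < j" "j < n" for i j
  proof -
    define q where "q = k i j + k j i"
    have q: "q = 0 \<or> q = 1 \<or> q = 2" "q \<ge> 0" using k[of i j] k[of j i] by (auto simp: q_def)
    have "g i j x + g j i x = (q * (r / 2)) * \<bar>x\<bar>" for x by (simp add: g_def q_def algebra_simps)
    moreover have "(\<integral>\<^sup>+x. ennreal (exp ((q * (r / 2)) * \<bar>x\<bar>)) \<partial>D (\<sigma> $ i * \<sigma> $ j)) \<le> ennreal (exp (\<alpha> * (exp (q * (r / 2)) - 1)))"
      using mgf[unfolded abs_mgf_le_def, rule_format, of i j "q * (r / 2)"] that q r by simp
    ultimately have "(\<integral>\<^sup>+x. ennreal (exp (g i j x + g j i x)) \<partial>D (\<sigma> $ i * \<sigma> $ j)) \<le> ennreal (exp (\<alpha> * (exp (q * (r / 2)) - 1)))"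
      by (simp only:)
    moreover have "ennreal (exp (\<alpha> * (exp (q * (r / 2)) - 1))) \<le> ennreal (exp (b i j + b j i))"
      using ineq[OF q(1)] by (simp add: ennreal_leI b_def q_def algebra_simps)
    ultimately show ?thesis by (rule order_trans)
  qed
  have diag: "(\<integral>\<^sup>+x. ennreal (exp (g i i x)) \<partial>D (\<sigma> $ i * \<sigma> $ i)) \<le> ennreal (exp (b i i))" if "i < n" for i
  proof -
    have "(\<integral>\<^sup>+x. ennreal (exp (g i i x)) \<partial>D (\<sigma> $ i * \<sigma> $ i)) \<le> ennreal (exp (\<alpha> * (exp (k i i * (r / 2)) - 1)))"
      using mgf[unfolded abs_mgf_le_def, rule_format, of i i "k i i * (r / 2)"] that r k[of i i] by (auto simp: g_def)
    moreover have "ennreal (exp (\<alpha> * (exp (k i i * (r / 2)) - 1))) \<le> ennreal (exp (b i i))"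
      using ineq[of "k i i"] k[of i i] by (auto simp: ennreal_leI b_def)
    ultimately show ?thesis by (rule order_trans)
  qed
  have gm: "\<And>i j. g i j \<in> borel_measurable borel" by (simp add: g_def)
  have kind: "(\<Sum>i<n. \<Sum>j<n. k i j * h i j) = (\<Sum>i\<in>S. \<Sum>j\<in>T. h i j)" for h :: "nat \<Rightarrow> nat \<Rightarrow> real"
  proof -
    have "(\<Sum>j<n. k i j * h i j) = (if i \<in> S then \<Sum>j\<in>T. h i j else 0)" for i
      unfolding k_def using ST(2) by (auto intro!: sum.mono_neutral_cong_right)
    then have "(\<Sum>i<n. \<Sum>j<n. k i j * h i j) = (\<Sum>i<n. if i \<in> S then \<Sum>j\<in>T. h i j else 0)" by simp
    also have "\<dots> = (\<Sum>i\<in>S. \<Sum>j\<in>T. h i j)" using ST(1) by (auto intro!: sum.mono_neutral_cong_right)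
    finally show ?thesis .
  qed
  have gs: "(\<Sum>i<n. \<Sum>j<n. g i j (obs \<omega> i j)) = r / 2 * edge_mass (\<lambda>i j. \<bar>obs \<omega> i j\<bar>) S T" for \<omega>
    using kind[of "\<lambda>i j. r / 2 * \<bar>obs \<omega> i j\<bar>"] by (simp add: g_def edge_mass_def sum_distrib_left mult.assoc)
  have bs: "(\<Sum>i<n. \<Sum>j<n. b i j) = \<alpha> * card S * card T * exp r"
    unfolding b_def kind by simp
  note t = tail[of g b "\<alpha> * card S * card T * exp r + z", OF gm off diag]
  show "A \<in> events" using t(1) unfolding A_def gs .
  show "prob A \<le> exp (- z)" using t(2) unfolding A_def gs bs by simp
qed

text \<open>The tilt \<open>r\<close> remains a parameter and the bound holds for all its integer
  values at once, so each application may choose the value that suits its sets. The factor 6 leaves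
  \<open>n^(-4)\<close> for each of the two sums over sets, more than enough for the
  \<open>8 * n + 4\<close> values of \<open>r\<close>.\<close>

lemma discrepancy_event:
  fixes \<alpha> :: real
  assumes \<alpha>: "\<alpha> \<ge> 0"
    and mgf: "abs_mgf_le \<alpha>"
  shows "\<exists>E\<in>events. 1 - 1 / n \<le> prob E \<and> (\<forall>\<omega>\<in>E. \<forall>S T r. S \<subseteq> {..<n} \<longrightarrow> T \<subseteq> {..<n} \<longrightarrow> S \<noteq> {} \<longrightarrow> T \<noteq> {} \<longrightarrow> r \<in> {1..8 * n + 4} \<longrightarrow>
      real r / 2 * edge_mass (\<lambda>i j. \<bar>obs \<omega> i j\<bar>) S T \<le> \<alpha> * card S * card T * exp r
        + 6 * (entropy_bound n (card S) + entropy_bound n (card T)))"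
proof -
  define F where "F = {S. S \<subseteq> {..<n} \<and> S \<noteq> {}}"
  have finF: "finite F" unfolding F_def by (rule finite_subset[of _ "Pow {..<n}"]) auto
  define z where "z = (\<lambda>(S :: nat set) (T :: nat set). 6 * (entropy_bound n (card S) + entropy_bound n (card T)))"
  define A where "A = (\<lambda>(r :: nat, S :: nat set, T :: nat set). {\<omega> \<in> space P. \<alpha> * card S * card T * exp r + z S T \<le> r / 2 * edge_mass (\<lambda>i j. \<bar>obs \<omega> i j\<bar>) S T})"
  define K where "K = {1..8 * n + 4} \<times> F \<times> F"
  have A: "A (r, S, T) \<in> events \<and> prob (A (r, S, T)) \<le> exp (- z S T)" if "S \<in> F" "T \<in> F" for r S T
  proof -
    have "S \<subseteq> {..<n}" "T \<subseteq> {..<n}" using that by (auto simp: F_def)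
    from edge_mass_tail[OF \<alpha> of_nat_0_le_iff this mgf, of r "z S T"]
    show ?thesis unfolding A_def prod.case by (rule conjI)
  qed
  have "(\<Sum>(r, S, T)\<in>K. exp (- z S T)) = (8 * real n + 4) * ((\<Sum>S\<in>F. exp (- 6 * entropy_bound n (card S))) * (\<Sum>T\<in>F. exp (- 6 * entropy_bound n (card T))))"
    unfolding K_def sum.cartesian_product[symmetric] sum_product z_def by (simp add: exp_add[symmetric] algebra_simps)
  also have "\<dots> \<le> (12 * real n) * ((n * exp (- (5 * (1 + ln n)))) * (n * exp (- (5 * (1 + ln n)))))"
    using n_pos sum_subsets_exp_entropy_le[of 6 n] by (intro mult_mono) (auto simp: F_def intro: sum_nonneg)
  also have "\<dots> \<le> 1 / n"
  proof -
    have "exp (- (5 * (1 + ln n))) = exp (- 5) * (exp (- ln n)) ^ 5"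
      by (simp add: exp_of_nat_mult[symmetric] exp_add[symmetric] algebra_simps)
    also have "exp (- ln n) = 1 / n" using n_pos by (simp add: exp_minus inverse_eq_divide)
    finally have e: "exp (- (5 * (1 + ln n))) = exp (- 5) / real n ^ 5" by (simp add: power_one_over)
    have "exp (5 :: real) * exp 5 \<ge> 6 * 6" using exp_ge_add_one_self[of 5] by (intro mult_mono) auto
    then have "12 * (exp (- 5) * exp (- 5)) \<le> (1 :: real)" by (simp add: exp_minus divide_simps)
    moreover have "real n * (real n / real n ^ 5) * (real n / real n ^ 5) \<le> 1 / n"
    proof -
      have "1 \<le> real n ^ 6" using n_pos by (intro one_le_power) auto
      then show ?thesis using n_pos by (simp add: divide_simps eval_nat_numeral)
    qed
    ultimately have "12 * (exp (- 5) * exp (- 5)) * (real n * (real n / real n ^ 5) * (real n / real n ^ 5)) \<le> 1 * (1 / real n)"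
      by (intro mult_mono) auto
    then show ?thesis unfolding e by (simp add: mult_ac)
  qed
  finally have S: "(\<Sum>(r, S, T)\<in>K. exp (- z S T)) \<le> 1 / n" .
  have U: "(\<Union>k\<in>K. A k) \<in> events" "prob (\<Union>k\<in>K. A k) \<le> 1 / n"
    using prob_Union_le[of K A "\<lambda>(r, S, T). exp (- z S T)" "1 / n"] A S finF by (auto simp: K_def)
  show ?thesis
  proof (intro bexI[of _ "space P - (\<Union>k\<in>K. A k)"] conjI ballI allI impI)
    show "1 - 1 / n \<le> prob (space P - (\<Union>k\<in>K. A k))" using U by (simp add: prob_compl)
    fix \<omega> S T r assume \<omega>: "\<omega> \<in> space P - (\<Union>k\<in>K. A k)" and "S \<subseteq> {..<n}" "T \<subseteq> {..<n}" "S \<noteq> {}" "T \<noteq> {}" "r \<in> {1..8 * n + 4}"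
    then have "(r, S, T) \<in> K" by (simp add: K_def F_def)
    then have "\<omega> \<notin> A (r, S, T)" "\<omega> \<in> space P" using \<omega> by blast+
    then show "real r / 2 * edge_mass (\<lambda>i j. \<bar>obs \<omega> i j\<bar>) S T \<le> \<alpha> * card S * card T * exp r
        + 6 * (entropy_bound n (card S) + entropy_bound n (card T))" by (simp add: A_def z_def)
  qed (use U in auto)
qed

text \<open>Tilt one, with the whole index set on the other side, and
  \<open>2 * exp 1 \<le> 6\<close>. Large sets have total degree of order
  \<open>n * \<alpha>\<close> per row; small sets can exceed this only by their entropy.\<close>

lemma degree_event:
  fixes \<alpha> :: real
  assumes \<alpha>: "\<alpha> \<ge> 0"
    and mgf: "abs_mgf_le \<alpha>"
  shows "\<exists>E\<in>events. 1 - 1 / n \<le> prob E \<and> (\<forall>\<omega>\<in>E. \<forall>S. S \<subseteq> {..<n} \<longrightarrow> S \<noteq> {} \<longrightarrow>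
      edge_mass (\<lambda>i j. \<bar>obs \<omega> i j\<bar>) S {..<n} \<le> 6 * (n * \<alpha>) * card S + 8 * entropy_bound n (card S))"
proof -
  define F where "F = {S. S \<subseteq> {..<n} \<and> S \<noteq> {}}"
  have finF: "finite F" unfolding F_def by (rule finite_subset[of _ "Pow {..<n}"]) auto
  define z where "z = (\<lambda>S. 4 * entropy_bound n (card (S :: nat set)))"
  define A where "A = (\<lambda>S :: nat set. {\<omega> \<in> space P. \<alpha> * card S * card {..<n} * exp 1 + z S \<le> 1 / 2 * edge_mass (\<lambda>i j. \<bar>obs \<omega> i j\<bar>) S {..<n}})"
  have A: "A S \<in> events \<and> prob (A S) \<le> exp (- z S)" if "S \<in> F" for S
  proof -
    have "S \<subseteq> {..<n}" using that by (auto simp: F_def)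
    from edge_mass_tail[OF \<alpha> zero_le_one this subset_refl mgf, of "z S"]
    show ?thesis unfolding A_def by (rule conjI)
  qed
  have "(\<Sum>S\<in>F. exp (- z S)) \<le> n * exp (- (3 * (1 + ln n)))"
    using sum_subsets_exp_entropy_le[of 4 n] by (simp add: z_def F_def)
  also have "\<dots> \<le> 1 / n"
  proof -
    have "0 \<le> ln (real n)" using n_pos by simp
    then have "exp (- (3 * (1 + ln n))) \<le> exp (- 2 * ln n)" by simp
    also have "\<dots> = (exp (- ln n)) ^ 2" by (simp add: exp_of_nat_mult[symmetric])
    also have "exp (- ln n) = 1 / n" using n_pos by (simp add: exp_minus inverse_eq_divide)
    finally have "n * exp (- (3 * (1 + ln n))) \<le> n * (1 / n) ^ 2" by (intro mult_left_mono) auto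
    then show ?thesis using n_pos by (simp add: power2_eq_square)
  qed
  finally have U: "(\<Union>k\<in>F. A k) \<in> events" "prob (\<Union>k\<in>F. A k) \<le> 1 / n"
    using prob_Union_le[of F A "\<lambda>S. exp (- z S)" "1 / n"] A finF by auto
  show ?thesis
  proof (intro bexI[of _ "space P - (\<Union>k\<in>F. A k)"] conjI ballI allI impI)
    show "1 - 1 / n \<le> prob (space P - (\<Union>k\<in>F. A k))" using U by (simp add: prob_compl)
    fix \<omega> S assume "\<omega> \<in> space P - (\<Union>k\<in>F. A k)" "S \<subseteq> {..<n}" "S \<noteq> {}"
    then have "\<omega> \<notin> A S" "\<omega> \<in> space P" unfolding F_def by blast+
    then have "edge_mass (\<lambda>i j. \<bar>obs \<omega> i j\<bar>) S {..<n} \<le> 2 * exp 1 * (n * \<alpha> * card S) + 8 * entropy_bound n (card S)"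
      by (simp add: A_def z_def algebra_simps)
    also have "2 * exp 1 * (n * \<alpha> * card S) \<le> 6 * (n * \<alpha> * card S)"
      using exp_le \<alpha> by (intro mult_right_mono) auto
    finally show "edge_mass (\<lambda>i j. \<bar>obs \<omega> i j\<bar>) S {..<n} \<le> 6 * (n * \<alpha>) * card S + 8 * entropy_bound n (card S)"
      by (simp add: mult_ac)
  qed (use U in auto)
qed

end

section \<open>Quadratic forms of sparse matrices\<close>

text \<open>
  The vectors \<open>\<lambda>k. x k i\<close> play the role of the rows of a Gram factor. Restricting to systems whose trace
  is not below the scale \<open>n * exp (- \<nu>)\<close> is what makes the bound true for sparse matrices: a smaller
  trace could be concentrated on the few rows of very large degree.
\<close>

definition form_bound :: "nat \<Rightarrow> (nat \<Rightarrow> nat \<Rightarrow> real) \<Rightarrow> real \<Rightarrow> real \<Rightarrow> bool" where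
  "form_bound n w \<nu> \<theta> \<longleftrightarrow> (\<forall>x :: nat \<Rightarrow> nat \<Rightarrow> real.
     (\<forall>i<n. (\<Sum>k<n. (x k i)\<^sup>2) \<le> 4) \<longrightarrow>
     n * exp (- \<nu>) \<le> real (max 1 (nat \<lfloor>(\<Sum>i<n. \<Sum>k<n. (x k i)\<^sup>2) / 4\<rfloor>)) \<longrightarrow>
     \<bar>\<Sum>k<n. bilin n w (x k) (x k)\<bar> \<le> \<theta> * (\<Sum>i<n. \<Sum>k<n. (x k i)\<^sup>2))"

text \<open>Averaging over \<open>k\<close>-subsets for weights up to 4, the bound on the diagonal
  of the compressed Gram matrix.\<close>

lemma weighted_sum_le_subset_average:
  fixes w y :: "nat \<Rightarrow> real" and \<gamma> c :: real
  assumes w: "\<And>i. i < n \<Longrightarrow> 0 \<le> w i" "\<And>i. i < n \<Longrightarrow> w i \<le> 4"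
    and \<gamma>: "\<gamma> = (\<Sum>i<n. w i)" "\<gamma> > 0"
    and k: "k = max 1 (nat \<lfloor>\<gamma> / 4\<rfloor>)"
    and le: "\<And>S. S \<subseteq> {..<n} \<Longrightarrow> card S = k \<Longrightarrow> (\<Sum>i\<in>S. y i) \<le> k * c"
  shows "(\<Sum>i<n. w i * y i) \<le> \<gamma> * c"
proof -
  have "\<gamma> / 4 = (\<Sum>i<n. w i / 4)" by (simp add: \<gamma> sum_divide_distrib)
  then obtain S where S: "S \<subseteq> {..<n}" "card S = k"
    "k * (\<Sum>i<n. w i / 4 * y i) \<le> \<gamma> / 4 * (\<Sum>i\<in>S. y i)"
    using card_subset_sum_ge_weighted_sum[of n "\<lambda>i. w i / 4" "\<gamma> / 4" k y] w \<gamma> k by auto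
  have "\<gamma> / 4 * (\<Sum>i\<in>S. y i) \<le> \<gamma> / 4 * (k * c)"
    using le[OF S(1,2)] \<gamma> by (intro mult_left_mono) auto
  with S(3) have "k * (\<Sum>i<n. w i / 4 * y i) \<le> k * (\<gamma> / 4 * c)" by (simp add: mult_ac)
  moreover have "k > 0" using k by simp
  ultimately have "(\<Sum>i<n. w i / 4 * y i) \<le> \<gamma> / 4 * c" by simp
  moreover have "(\<Sum>i<n. w i / 4 * y i) = (\<Sum>i<n. w i * y i) / 4" by (simp add: sum_divide_distrib)
  ultimately show ?thesis by simp
qed

text \<open>Collects what the good events provide, so that the remaining argument concerns one fixed
  matrix. The degree scale is \<open>d\<close>; admissible traces are not below the scale
  \<open>n * exp (- \<nu>)\<close>, and \<open>\<nu> \<le> B * d\<close> says that this scale is at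
  worst exponentially small in the degree.\<close>

locale sparse_instance =
  fixes n :: nat and a w :: "nat \<Rightarrow> nat \<Rightarrow> real" and d B \<nu> :: real
  assumes n: "n > 0" and d: "d \<ge> 1" and B: "B \<ge> 0" and \<nu>: "0 \<le> \<nu>" "\<nu> \<le> B * d"
    and a0: "\<And>i j. 0 \<le> a i j" and asym: "\<And>i j. a i j = a j i"
    and w: "\<And>i j. i < n \<Longrightarrow> j < n \<Longrightarrow> \<bar>w i j\<bar> \<le> a i j + d / n"
    and disc: "\<And>S T r. S \<subseteq> {..<n} \<Longrightarrow> T \<subseteq> {..<n} \<Longrightarrow> S \<noteq> {} \<Longrightarrow> T \<noteq> {} \<Longrightarrow> r \<in> {1..8 * n + 4} \<Longrightarrow>
      real r / 2 * edge_mass a S T \<le> d / n * card S * card T * exp r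
        + 6 * (entropy_bound n (card S) + entropy_bound n (card T))"
    and deg: "\<And>S. S \<subseteq> {..<n} \<Longrightarrow> S \<noteq> {} \<Longrightarrow> edge_mass a S {..<n} \<le> 6 * d * card S + 8 * entropy_bound n (card S)"
    and light: "\<And>\<xi> \<eta>. \<xi> \<in> int_net n \<Longrightarrow> \<eta> \<in> int_net n \<Longrightarrow> light_sum n (sqrt d) w \<xi> \<eta> \<le> 42 * sqrt d * n"
begin

definition dg where "dg i = (\<Sum>j<n. a i j)"
text \<open>Rows above \<open>K * d\<close> exceed the term \<open>6 * d\<close> in
  \<open>deg\<close> by \<open>8 * (B + 3) * d\<close> each. Only the entropy term can account for
  this, which makes \<open>H\<close> exponentially small in \<open>(B + 3) * d\<close>.\<close>

definition K where "K = 8 * (B + 3) + 6"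
definition H where "H = {i. i < n \<and> dg i > K * d}"

lemma sqrt_d: "sqrt d \<ge> 1" "sqrt d * sqrt d = d" "d / sqrt d = sqrt d"
  using d by (auto simp: real_div_sqrt)

lemma H_sub: "H \<subseteq> {..<n}" "finite H"
  by (auto simp: H_def)

text \<open>Light pairs are covered by \<open>light\<close>, heavy pairs with ratio up to
  \<open>sqrt d\<close> by the discrepancy sum. In the other heavy pairs the product
  \<open>x i * y j\<close> is at most the larger square divided by \<open>sqrt d\<close>, so row
  sums up to \<open>K * d\<close> suffice; this is where removing \<open>H\<close> enters. The mean
  \<open>d / n\<close> on heavy pairs is absorbed because their product exceeds
  \<open>sqrt d\<close>.\<close>

lemma trimmed_net_bound:
  assumes \<xi>: "\<xi> \<in> int_net n" "\<And>i. i < n \<Longrightarrow> i \<in> H \<Longrightarrow> \<xi> i = 0"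
    and \<eta>: "\<eta> \<in> int_net n" "\<And>i. i < n \<Longrightarrow> i \<in> H \<Longrightarrow> \<eta> i = 0"
  shows "bilin n w (\<lambda>i. \<xi> i) (\<lambda>i. \<eta> i) \<le> (58 + heavy_const + 8 * K) * sqrt d * n"
proof -
  define x where "x = (\<lambda>i. \<bar>real_of_int (\<xi> i)\<bar>)"
  define y where "y = (\<lambda>i. \<bar>real_of_int (\<eta> i)\<bar>)"
  have x0: "0 \<le> x i" "0 \<le> y i" for i by (auto simp: x_def y_def)
  have sx: "(\<Sum>i<n. (x i)\<^sup>2) \<le> 4 * real n" and sy: "(\<Sum>i<n. (y i)\<^sup>2) \<le> 4 * real n"
    using int_net_sq[OF \<xi>(1)] int_net_sq[OF \<eta>(1)] by (auto simp: x_def y_def)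
  define s where "s = sqrt d"
  have s: "s \<ge> 1" "s * s = d" using sqrt_d by (auto simp: s_def)
  define ok where "ok = (\<lambda>i j. x i * y j > s \<and> x i \<le> s * y j \<and> y j \<le> s * x i)"
  define f where "f = (\<lambda>i j. if ok i j then a i j * x i * y j else 0)"
  define l where "l = (\<lambda>i j. (if \<bar>real_of_int (\<xi> i * \<eta> j)\<bar> \<le> s then real_of_int (\<xi> i * \<eta> j) else 0) * w i j)"
  have pt: "\<xi> i * w i j * \<eta> j \<le> l i j + f i j + (x i)\<^sup>2 / s * a i j + (y j)\<^sup>2 / s * a i j + d / n / s * ((x i)\<^sup>2 * (y j)\<^sup>2)"
    if ij: "i < n" "j < n" for i j
  proof -
    have nn: "0 \<le> f i j" "0 \<le> (x i)\<^sup>2 / s * a i j" "0 \<le> (y j)\<^sup>2 / s * a i j" "0 \<le> d / n / s * ((x i)\<^sup>2 * (y j)\<^sup>2)"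
      using a0 x0 s d by (auto simp: f_def)
    have xy: "\<bar>real_of_int (\<xi> i * \<eta> j)\<bar> = x i * y j" by (simp add: x_def y_def abs_mult)
    show ?thesis
    proof (cases "x i * y j \<le> s")
      case True
      then have "l i j = \<xi> i * w i j * \<eta> j" unfolding l_def xy by (simp add: mult_ac)
      then show ?thesis using nn by linarith
    next
      case False
      then have l0: "l i j = 0" unfolding l_def xy by simp
      have "\<xi> i * w i j * \<eta> j \<le> \<bar>w i j\<bar> * (x i * y j)"
        unfolding xy[symmetric] abs_mult[symmetric] by (simp add: mult_ac)
      also have "\<dots> \<le> (a i j + d / n) * (x i * y j)"
        using w[OF ij] x0 by (intro mult_right_mono) auto
      also have "\<dots> = a i j * (x i * y j) + d / n * (x i * y j)" by (simp add: distrib_right)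
      finally have 1: "\<xi> i * w i j * \<eta> j \<le> a i j * (x i * y j) + d / n * (x i * y j)" .
      have "x i * y j * s \<le> x i * y j * (x i * y j)" using False x0 by (intro mult_left_mono) auto
      then have "x i * y j \<le> (x i)\<^sup>2 * (y j)\<^sup>2 / s" using s by (simp add: pos_le_divide_eq power2_eq_square mult_ac)
      then have "d / n * (x i * y j) \<le> d / n * ((x i)\<^sup>2 * (y j)\<^sup>2 / s)" using d by (intro mult_left_mono) auto
      then have 2: "d / n * (x i * y j) \<le> d / n / s * ((x i)\<^sup>2 * (y j)\<^sup>2)" by simp
      have 3: "a i j * (x i * y j) \<le> f i j + (x i)\<^sup>2 / s * a i j + (y j)\<^sup>2 / s * a i j"
      proof (cases "ok i j")
        case True
        then show ?thesis using nn by (simp add: f_def mult_ac)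
      next
        case nok: False
        then consider "s * y j \<le> x i" | "s * x i \<le> y j" using False unfolding ok_def by linarith
        then show ?thesis
        proof cases
          case 1
          then have "y j \<le> x i / s" using s by (simp add: pos_le_divide_eq mult.commute)
          then have "x i * y j \<le> x i * (x i / s)" using x0 by (intro mult_left_mono)
          then have "a i j * (x i * y j) \<le> a i j * (x i * (x i / s))" by (rule mult_left_mono) (rule a0)
          also have "\<dots> = (x i)\<^sup>2 / s * a i j" by (simp add: power2_eq_square)
          finally show ?thesis using nn by linarith
        next
          case 2
          then have "x i \<le> y j / s" using s by (simp add: pos_le_divide_eq mult.commute)
          then have "x i * y j \<le> y j / s * y j" using x0 by (intro mult_right_mono)
          then have "a i j * (x i * y j) \<le> a i j * (y j / s * y j)" by (rule mult_left_mono) (rule a0)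
          also have "\<dots> = (y j)\<^sup>2 / s * a i j" by (simp add: power2_eq_square)
          finally show ?thesis using nn by linarith
        qed
      qed
      show ?thesis using 1 2 3 l0 by linarith
    qed
  qed
  have "bilin n w (\<lambda>i. \<xi> i) (\<lambda>i. \<eta> i)
    \<le> (\<Sum>i<n. \<Sum>j<n. l i j + f i j + (x i)\<^sup>2 / s * a i j + (y j)\<^sup>2 / s * a i j + d / n / s * ((x i)\<^sup>2 * (y j)\<^sup>2))"
    unfolding bilin_def by (intro sum_mono, rule pt) auto
  also have "\<dots> = (\<Sum>i<n. \<Sum>j<n. l i j) + (\<Sum>i<n. \<Sum>j<n. f i j) + (\<Sum>i<n. \<Sum>j<n. (x i)\<^sup>2 / s * a i j)
     + (\<Sum>i<n. \<Sum>j<n. (y j)\<^sup>2 / s * a i j) + (\<Sum>i<n. \<Sum>j<n. d / n / s * ((x i)\<^sup>2 * (y j)\<^sup>2))"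
    by (simp only: sum.distrib)
  finally have main: "bilin n w (\<lambda>i. \<xi> i) (\<lambda>i. \<eta> i) \<le> \<dots>" .
  have m1: "(\<Sum>i<n. \<Sum>j<n. l i j) \<le> 42 * s * n"
    using light[OF \<xi>(1) \<eta>(1)] by (simp add: l_def light_sum_def s_def cong: if_cong)
  have m2: "(\<Sum>i<n. \<Sum>j<n. f i j) \<le> heavy_const * s * n"
    using balanced_heavy_sum_le[OF n d a0 disc, of \<xi> \<eta>] int_net_sq[OF \<xi>(1)] int_net_sq[OF \<eta>(1)]
    by (simp add: f_def ok_def x_def y_def s_def cong: if_cong)
  have row: "(\<Sum>i<n. (z i)\<^sup>2 / s * dg i) \<le> 4 * K * s * n"
    if "(\<Sum>i<n. (z i)\<^sup>2) \<le> 4 * real n" "\<And>i. i < n \<Longrightarrow> i \<in> H \<Longrightarrow> z i = 0" for z :: "nat \<Rightarrow> real"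
  proof -
    have "(\<Sum>i<n. (z i)\<^sup>2 / s * dg i) \<le> (\<Sum>i<n. (z i)\<^sup>2 / s * (K * d))"
    proof (rule sum_mono)
      fix i assume i: "i \<in> {..<n}"
      show "(z i)\<^sup>2 / s * dg i \<le> (z i)\<^sup>2 / s * (K * d)"
      proof (cases "i \<in> H")
        case True
        then show ?thesis using that(2)[of i] i by simp
      next
        case False
        then have "dg i \<le> K * d" using i by (auto simp: H_def)
        then show ?thesis using s by (intro mult_left_mono) auto
      qed
    qed
    also have "\<dots> = (\<Sum>i<n. (z i)\<^sup>2) * (K * (d / s))"
      by (simp add: sum_distrib_right sum_divide_distrib)
    also have "\<dots> \<le> (4 * real n) * (K * (d / s))"
      using that(1) B d s by (intro mult_right_mono) (auto simp: K_def)
    also have "d / s = s" using s by (simp add: divide_eq_eq)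
    finally show ?thesis by (simp add: mult_ac)
  qed
  have m3: "(\<Sum>i<n. \<Sum>j<n. (x i)\<^sup>2 / s * a i j) \<le> 4 * K * s * n"
    using row[of x] sx \<xi>(2) by (simp add: dg_def sum_distrib_left x_def)
  have m4: "(\<Sum>i<n. \<Sum>j<n. (y j)\<^sup>2 / s * a i j) \<le> 4 * K * s * n"
  proof -
    have "(\<Sum>i<n. \<Sum>j<n. (y j)\<^sup>2 / s * a i j) = (\<Sum>j<n. (y j)\<^sup>2 / s * dg j)"
      unfolding dg_def sum_distrib_left by (subst sum.swap) (simp add: asym)
    then show ?thesis using row[of y] sy \<eta>(2) by (simp add: y_def)
  qed
  have m5: "(\<Sum>i<n. \<Sum>j<n. d / n / s * ((x i)\<^sup>2 * (y j)\<^sup>2)) \<le> 16 * s * n"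
  proof -
    have "(\<Sum>i<n. \<Sum>j<n. d / n / s * ((x i)\<^sup>2 * (y j)\<^sup>2)) = d / n / s * ((\<Sum>i<n. (x i)\<^sup>2) * (\<Sum>j<n. (y j)\<^sup>2))"
      unfolding sum_product by (simp only: sum_distrib_left)
    also have "\<dots> \<le> d / n / s * ((4 * real n) * (4 * real n))"
      using sx sy d s by (intro mult_left_mono mult_mono) (auto intro: sum_nonneg)
    also have "\<dots> = 16 * (d / s) * n" using n by simp
    also have "d / s = s" using s by (simp add: divide_eq_eq)
    finally show ?thesis .
  qed
  \<comment> \<open>\<open>58 = 42 + 16\<close> joins the light pairs and the mean;
    \<open>8 * K\<close> joins the two row terms.\<close>
  show ?thesis using main m1 m2 m3 m4 m5 unfolding s_def[symmetric] by (simp add: algebra_simps)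
qed

lemma trimmed_quadratic_form:
  fixes x :: "nat \<Rightarrow> real"
  assumes "\<And>i. i < n \<Longrightarrow> i \<in> H \<Longrightarrow> x i = 0"
  shows "\<bar>bilin n w x x\<bar> \<le> (58 + heavy_const + 8 * K) * sqrt d * (\<Sum>i<n. (x i)\<^sup>2)"
  using trimmed_net_bound by (intro quadratic_form_le_of_int_net[OF n _ assms, of H]) auto

lemma heavy_degree_card:
  assumes "H \<noteq> {}"
  shows "(B + 3) * d \<le> 1 + ln (n / card H)"
proof -
  define h where "h = card H"
  have h: "h > 0" using assms H_sub by (simp add: h_def card_gt_0_iff)
  have "h * (K * d) \<le> edge_mass a H {..<n}"
  proof -
    have "(\<Sum>i\<in>H. K * d) \<le> (\<Sum>i\<in>H. dg i)" by (intro sum_mono) (auto simp: H_def)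
    then show ?thesis by (simp add: h_def edge_mass_def dg_def)
  qed
  also have "\<dots> \<le> 6 * d * h + 8 * entropy_bound n h" using deg[OF H_sub(1) assms] by (simp add: h_def)
  finally have "h * (K * d) \<le> h * (6 * d + 8 * (1 + ln (n / h)))"
    by (simp add: entropy_bound_def algebra_simps)
  then have "K * d \<le> 6 * d + 8 * (1 + ln (n / h))" using h by simp
  then show ?thesis by (simp add: K_def h_def algebra_simps)
qed

text \<open>Both follow from \<open>card H \<le> n * exp (1 - (B + 3) * d)\<close>. The part
  \<open>B * d\<close> of the exponent beats \<nu>, so \<open>H\<close> is smaller than every
  admissible index set; the remainder leaves \<open>exp (1 - d)\<close>, which beats the factor
  \<open>d\<close>.\<close>

lemma heavy_card_le:
  assumes "H \<noteq> {}"
  shows "card H * d \<le> 3 * n" "card H \<le> n * exp (- \<nu>)"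
proof -
  have h: "real (card H) > 0" using assms H_sub by (simp add: card_gt_0_iff)
  have Bd: "B * d \<ge> 0" using B d by simp
  have *: "card H \<le> n * exp (1 - (B + 3) * d)"
  proof -
    have "exp ((B + 3) * d - 1) \<le> exp (ln (n / card H))" using heavy_degree_card[OF assms] by simp
    also have "\<dots> = n / card H" using h n by simp
    finally have "exp ((B + 3) * d - 1) * card H \<le> n" using h by (simp add: pos_le_divide_eq)
    then have "exp ((B + 3) * d - 1) * card H * exp (1 - (B + 3) * d) \<le> n * exp (1 - (B + 3) * d)"
      by (rule mult_right_mono) simp
    moreover have "exp ((B + 3) * d - 1) * card H * exp (1 - (B + 3) * d)
        = card H * (exp ((B + 3) * d - 1) * exp (1 - (B + 3) * d))" by (simp only: mult_ac)
    moreover have "exp ((B + 3) * d - 1) * exp (1 - (B + 3) * d) = 1" by (simp add: exp_add[symmetric])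
    ultimately show ?thesis by simp
  qed
  have "exp (1 - (B + 3) * d) \<le> exp (- \<nu>)" using \<nu> d by (simp add: algebra_simps)
  then have "n * exp (1 - (B + 3) * d) \<le> n * exp (- \<nu>)" by (intro mult_left_mono) auto
  with * show "card H \<le> n * exp (- \<nu>)" by linarith
  have "exp (1 - (B + 3) * d) \<le> exp (1 - d)" using Bd d by (simp add: algebra_simps)
  then have "n * exp (1 - (B + 3) * d) \<le> n * exp (1 - d)" by (intro mult_left_mono) auto
  with * have "card H * d \<le> n * exp (1 - d) * d" using d by (intro mult_right_mono) linarith+
  also have "\<dots> = n * (exp 1 * (d * exp (- d)))" by (simp add: exp_add[symmetric])
  also have "\<dots> \<le> real n * (3 * 1)"
  proof -
    have "d \<le> exp d" using exp_ge_add_one_self[of d] by linarith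
    then have "d * exp (- d) \<le> 1" by (simp add: exp_minus divide_simps)
    then show ?thesis using exp_le d by (intro mult_left_mono mult_mono) auto
  qed
  finally show "card H * d \<le> 3 * n" by simp
qed

text \<open>Here \<open>L = 1 + ln (n / card H)\<close> is at least \<open>(B + 3) * d\<close>.
  Discrepancy with \<open>r\<close> about \<open>L\<close> has main term \<open>d * card S\<close>;
  after division by \<open>r\<close> this term and the entropies of \<open>S\<close> and of
  \<open>H\<close> are all bounded multiples of \<open>card S\<close>. So an average row of
  \<open>S\<close> has bounded mass in \<open>H\<close>, although the rows of \<open>H\<close> are
  long.\<close>

lemma heavy_edges_le:
  assumes H: "H \<noteq> {}" and S: "S \<subseteq> {..<n}" "S \<noteq> {}" and k: "n * exp (- \<nu>) \<le> card S"
  shows "edge_mass a S H \<le> 78 * card S"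
proof -
  define h where "h = card H"
  define k where "k = card S"
  have h: "real h > 0" "h \<le> n" using H H_sub card_mono[OF _ H_sub(1)] by (auto simp: h_def card_gt_0_iff)
  have kk: "real k > 0" using S finite_subset[OF S(1)] by (auto simp: k_def card_gt_0_iff)
  define L where "L = 1 + ln (n / h)"
  have L: "(B + 3) * d \<le> L" using heavy_degree_card[OF H] by (simp add: L_def h_def)
  have "3 * 1 \<le> (B + 3) * d" using B d by (intro mult_mono) auto
  then have L3: "L \<ge> 3" using L by simp
  have Bd4: "B * d \<ge> 0" using B d by simp
  \<comment> \<open>Rounding down gives \<open>exp r \<le> n / card H\<close>, and
    \<open>L \<ge> 3\<close> still ensures \<open>r \<ge> L - 2 \<ge> L / 3\<close>.\<close>
  define r where "r = nat \<lfloor>ln (real n / h)\<rfloor>"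
  have "0 \<le> \<lfloor>ln (real n / h)\<rfloor>" using L3 unfolding L_def by (simp only: zero_le_floor)
  then have "real r = of_int \<lfloor>ln (real n / h)\<rfloor>" by (simp add: r_def)
  then have r: "real r \<le> L - 1" "real r \<ge> L - 2" unfolding L_def by linarith+
  have r1: "r \<ge> 1"
  proof -
    have "real r \<ge> 1" using r(2) L3 by simp
    then show ?thesis by simp
  qed
  have er: "exp r \<le> n / h"
  proof -
    have "exp r \<le> exp (ln (real n / h))" using r(1) by (simp add: L_def)
    then show ?thesis using h n by simp
  qed
  have "ln (real n / h) \<le> real n / h - 1" using h n by (intro ln_le_minus_one) auto
  moreover have "real n / h \<le> n" using h n by (simp add: divide_le_eq mult_le_cancel_left1)
  ultimately have "real r \<le> n" using r(1) by (simp add: L_def)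
  then have rR: "r \<in> {1..8 * n + 4}" using r1 by simp
  have lnk: "entropy_bound n k \<le> k * (1 + B * d)"
  proof -
    have "n / k \<le> exp \<nu>" using k kk by (simp add: k_def[symmetric] divide_le_eq exp_minus field_simps)
    then have "ln (n / k) \<le> ln (exp \<nu>)" using kk n by (subst ln_le_cancel_iff) auto
    then have "ln (n / k) \<le> B * d" using \<nu> by simp
    then show ?thesis unfolding entropy_bound_def by (intro mult_left_mono) auto
  qed
  define e where "e = edge_mass a S H"
  have e0: "e \<ge> 0" using a0 by (auto simp: e_def edge_mass_def intro!: sum_nonneg)
  have "real r / 2 * e \<le> d / n * k * h * exp r + 6 * (entropy_bound n k + entropy_bound n h)"
    using disc[OF S(1) H_sub(1) S(2) H rR] by (simp add: e_def k_def h_def)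
  also have "d / n * k * h * exp r \<le> d / n * k * h * (n / h)"
    using er d by (intro mult_left_mono) auto
  also have "d / n * k * h * (n / h) = d * k" using n h by simp
  also have "6 * (entropy_bound n k + entropy_bound n h) \<le> 6 * (k * (1 + B * d) + h * L)"
    using lnk by (simp add: entropy_bound_def L_def)
  finally have re: "real r / 2 * e \<le> d * k + 6 * (k * (1 + B * d) + h * L)" by simp
  have "L / 6 * e \<le> real r / 2 * e" using r(2) L3 e0 by (intro mult_right_mono) linarith+
  with re have 1: "L * e \<le> 6 * (d * k) + 36 * (k * (1 + B * d)) + 36 * (h * L)" by (simp add: algebra_simps)
  have hk: "h \<le> k" using heavy_card_le(2)[OF H] k by (simp add: h_def k_def)
  have "k * (6 * d + 36 * (1 + B * d)) \<le> k * (42 * L)"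
  proof (intro mult_left_mono)
    have "6 * d + 36 * (1 + B * d) \<le> 42 * ((B + 3) * d)" using d Bd4 by (simp add: algebra_simps)
    then show "6 * d + 36 * (1 + B * d) \<le> 42 * L" using L by linarith
  qed simp
  moreover have "36 * (h * L) \<le> 36 * (k * L)" using hk L3 by (intro mult_left_mono mult_right_mono) auto
  ultimately have "L * e \<le> L * (78 * k)" using 1 by (simp add: algebra_simps)
  then have "e \<le> 78 * k" using L3 by simp
  then show ?thesis by (simp add: e_def k_def)
qed

text \<open>A weighted arithmetic-geometric mean. In its use \<open>i\<close> is a heavy row, with
  weighted degree of order \<open>d\<close>, while the mass that \<open>j\<close> has in
  \<open>H\<close> is bounded on average; the weights \<open>1 / sqrt d\<close> and
  \<open>sqrt d\<close> bring both contributions to order \<open>sqrt d\<close>.\<close>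

lemma gram_product_le:
  fixes x :: "nat \<Rightarrow> nat \<Rightarrow> real"
  shows "(\<Sum>k<n. \<bar>x k i\<bar> * \<bar>x k j\<bar>) \<le> ((\<Sum>k<n. (x k i)\<^sup>2) / sqrt d + sqrt d * (\<Sum>k<n. (x k j)\<^sup>2)) / 2"
proof -
  define s where "s = sqrt d"
  have s: "s \<ge> 1" using sqrt_d by (simp add: s_def)
  have "2 * (\<bar>p\<bar> * \<bar>q\<bar>) \<le> p\<^sup>2 / s + s * q\<^sup>2" for p q :: real
  proof -
    have "0 \<le> (\<bar>p\<bar> - s * \<bar>q\<bar>)\<^sup>2" by simp
    moreover have "(\<bar>p\<bar> - s * \<bar>q\<bar>)\<^sup>2 = p\<^sup>2 + s\<^sup>2 * q\<^sup>2 - 2 * \<bar>p\<bar> * (s * \<bar>q\<bar>)"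
      unfolding power2_diff power_mult_distrib power2_abs by simp
    moreover have "s\<^sup>2 * q\<^sup>2 = s * q\<^sup>2 * s" "2 * \<bar>p\<bar> * (s * \<bar>q\<bar>) = 2 * (\<bar>p\<bar> * \<bar>q\<bar>) * s"
      by (simp_all add: power2_eq_square)
    ultimately have "2 * (\<bar>p\<bar> * \<bar>q\<bar>) * s \<le> p\<^sup>2 + s * q\<^sup>2 * s" by linarith
    then have "2 * (\<bar>p\<bar> * \<bar>q\<bar>) \<le> (p\<^sup>2 + s * q\<^sup>2 * s) / s" using s by (simp add: pos_le_divide_eq)
    then show ?thesis using s by (simp add: add_divide_distrib)
  qed
  then have "(\<Sum>k<n. 2 * (\<bar>x k i\<bar> * \<bar>x k j\<bar>)) \<le> (\<Sum>k<n. (x k i)\<^sup>2 / s + s * (x k j)\<^sup>2)" by (intro sum_mono)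
  then show ?thesis by (simp add: sum.distrib sum_distrib_left[symmetric] sum_divide_distrib[symmetric] s_def)
qed

text \<open>\<open>96 = 14 + 1 + 78 + 3\<close> collects the degrees of the heavy rows, the mean
  against \<open>v i\<close>, the mass in \<open>H\<close>, and the mean against \<open>v j\<close>.
  The trace condition bounds the entropy of a \<open>k\<close>-subset by
  \<open>k * (1 + B * d)\<close>, so the averages over such subsets see no exceptional rows.\<close>

lemma heavy_rows_le:
  fixes v :: "nat \<Rightarrow> real"
  assumes H: "H \<noteq> {}" and v: "\<And>i. i < n \<Longrightarrow> 0 \<le> v i" "\<And>i. i < n \<Longrightarrow> v i \<le> 4"
    and \<gamma>: "\<gamma> = (\<Sum>i<n. v i)" "\<gamma> > 0"
    and k: "n * exp (- \<nu>) \<le> real (max 1 (nat \<lfloor>\<gamma> / 4\<rfloor>))"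
  shows "(\<Sum>i\<in>H. \<Sum>j<n. (a i j + d / n) * (v i / sqrt d + sqrt d * v j)) \<le> (96 + 8 * B) * sqrt d * \<gamma>"
proof -
  define s where "s = sqrt d"
  have s: "s \<ge> 1" "s * s = d" using sqrt_d by (auto simp: s_def)
  define k where "k = max 1 (nat \<lfloor>\<gamma> / 4\<rfloor>)"
  have kk: "k > 0" "n * exp (- \<nu>) \<le> k" using k by (auto simp: k_def)
  have A: "(\<Sum>i<n. v i * dg i) \<le> \<gamma> * (14 * d + 8 * (B * d))"
  proof (rule weighted_sum_le_subset_average[where w = v and y = dg and k = k and \<gamma> = \<gamma>])
    fix S assume S: "S \<subseteq> {..<n}" "card S = k"
    then have ne: "S \<noteq> {}" using kk by auto
    have "n / real k \<le> exp \<nu>" using kk by (simp add: divide_le_eq exp_minus field_simps)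
    then have "ln (n / real k) \<le> ln (exp \<nu>)" using kk n by (subst ln_le_cancel_iff) auto
    then have "entropy_bound n k \<le> k * (1 + B * d)"
      unfolding entropy_bound_def using \<nu> by (intro mult_left_mono) auto
    moreover have "(\<Sum>i\<in>S. dg i) \<le> 6 * d * k + 8 * entropy_bound n k"
      using deg[OF S(1) ne] S(2) by (simp add: edge_mass_def dg_def)
    ultimately have "(\<Sum>i\<in>S. dg i) \<le> k * (6 * d + 8 * (1 + B * d))" by (simp add: algebra_simps)
    also have "\<dots> \<le> k * (14 * d + 8 * (B * d))" using d by (intro mult_left_mono) auto
    finally show "(\<Sum>i\<in>S. dg i) \<le> k * (14 * d + 8 * (B * d))" .
  qed (use v \<gamma> k_def in auto)
  have Bh: "(\<Sum>j<n. v j * (\<Sum>i\<in>H. a i j)) \<le> \<gamma> * 78"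
  proof (rule weighted_sum_le_subset_average[where w = v and y = "\<lambda>j. \<Sum>i\<in>H. a i j" and k = k and \<gamma> = \<gamma>])
    fix S assume S: "S \<subseteq> {..<n}" "card S = k"
    then have ne: "S \<noteq> {}" using kk by auto
    have "(\<Sum>j\<in>S. \<Sum>i\<in>H. a i j) = edge_mass a S H" unfolding edge_mass_def by (simp add: asym)
    then show "(\<Sum>j\<in>S. \<Sum>i\<in>H. a i j) \<le> real k * 78" using heavy_edges_le[OF H S(1) ne] S(2) kk by simp
  qed (use v \<gamma> k_def in auto)
  have vH: "(\<Sum>i\<in>H. v i) \<le> \<gamma>" unfolding \<gamma> using v H_sub by (intro sum_mono2) auto
  have dg0: "0 \<le> dg i" for i using a0 by (auto simp: dg_def intro: sum_nonneg)
  have vdH: "(\<Sum>i\<in>H. v i * dg i) \<le> (\<Sum>i<n. v i * dg i)" using v H_sub dg0 by (intro sum_mono2) auto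
  have "(\<Sum>i\<in>H. \<Sum>j<n. (a i j + d / n) * (v i / s + s * v j))
    = (\<Sum>i\<in>H. \<Sum>j<n. a i j * (v i / s)) + (\<Sum>i\<in>H. \<Sum>j<n. d / n * (v i / s))
      + (\<Sum>i\<in>H. \<Sum>j<n. a i j * (s * v j)) + (\<Sum>i\<in>H. \<Sum>j<n. d / n * (s * v j))"
  proof -
    have "(\<Sum>i\<in>H. \<Sum>j<n. (a i j + d / n) * (v i / s + s * v j))
      = (\<Sum>i\<in>H. \<Sum>j<n. a i j * (v i / s) + d / n * (v i / s) + a i j * (s * v j) + d / n * (s * v j))"
      by (intro sum.cong refl) (simp add: distrib_left distrib_right add_divide_distrib)
    then show ?thesis by (simp only: sum.distrib)
  qed
  also have "(\<Sum>i\<in>H. \<Sum>j<n. a i j * (v i / s)) = (\<Sum>i\<in>H. v i * dg i) / s"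
    by (simp add: dg_def sum_distrib_left sum_divide_distrib mult.commute)
  also have "(\<Sum>i\<in>H. \<Sum>j<n. d / n * (v i / s)) = (d / s) * (\<Sum>i\<in>H. v i)"
    using n by (simp add: sum_distrib_left)
  also have "(\<Sum>i\<in>H. \<Sum>j<n. a i j * (s * v j)) = s * (\<Sum>j<n. v j * (\<Sum>i\<in>H. a i j))"
    by (subst sum.swap) (simp add: sum_distrib_left mult_ac)
  also have "(\<Sum>i\<in>H. \<Sum>j<n. d / n * (s * v j)) = s * (card H * d / n * \<gamma>)"
    by (simp add: \<gamma> sum_distrib_left sum_distrib_right sum_divide_distrib mult_ac)
  also have "d / s = s" using s by (simp add: divide_eq_eq)
  also have "(\<Sum>i\<in>H. v i * dg i) / s + s * (\<Sum>i\<in>H. v i) + s * (\<Sum>j<n. v j * (\<Sum>i\<in>H. a i j)) + s * (card H * d / n * \<gamma>)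
    \<le> s * ((14 + 8 * B) * \<gamma>) + s * \<gamma> + s * (\<gamma> * 78) + s * (3 * \<gamma>)"
  proof (intro add_mono mult_left_mono)
    have "(\<Sum>i\<in>H. v i * dg i) / s \<le> \<gamma> * (14 * d + 8 * (B * d)) / s"
      using A vdH s by (intro divide_right_mono) auto
    also have "\<dots> = (14 + 8 * B) * \<gamma> * (d / s)" by (simp add: field_simps)
    also have "d / s = s" using s by (simp add: divide_eq_eq)
    finally show "(\<Sum>i\<in>H. v i * dg i) / s \<le> s * ((14 + 8 * B) * \<gamma>)" by (simp add: mult_ac)
    have "card H * d / n \<le> 3" using heavy_card_le(1)[OF H] n by (simp add: divide_le_eq)
    then show "card H * d / n * \<gamma> \<le> 3 * \<gamma>" using \<gamma> by (intro mult_right_mono) auto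
  qed (use vH Bh s in auto)
  also have "\<dots> = (96 + 8 * B) * s * \<gamma>" by (simp add: algebra_simps)
  finally show ?thesis by (simp add: s_def)
qed

text \<open>The rows in \<open>H\<close> are set to zero for the net bound, and the error consists
  of pairs that meet \<open>H\<close>. Since \<open>8 * K = 240 + 64 * B\<close>, the constants are
  \<open>394 = 58 + 240 + 96\<close> and \<open>72 = 64 + 8\<close>.\<close>

lemma form_bound_sparse: "form_bound n w \<nu> ((394 + heavy_const + 72 * B) * sqrt d)"
  unfolding form_bound_def
proof (intro allI impI)
  fix x :: "nat \<Rightarrow> nat \<Rightarrow> real"
  assume x4: "\<forall>i<n. (\<Sum>k<n. (x k i)\<^sup>2) \<le> 4"
    and k: "n * exp (- \<nu>) \<le> real (max 1 (nat \<lfloor>(\<Sum>i<n. \<Sum>k<n. (x k i)\<^sup>2) / 4\<rfloor>))"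
  define v where "v = (\<lambda>i. \<Sum>k<n. (x k i)\<^sup>2)"
  define \<gamma> where "\<gamma> = (\<Sum>i<n. v i)"
  have v: "0 \<le> v i" "i < n \<Longrightarrow> v i \<le> 4" for i using x4 by (auto simp: v_def intro: sum_nonneg)
  have \<gamma>0: "\<gamma> \<ge> 0" using v by (auto simp: \<gamma>_def intro: sum_nonneg)
  define u where "u = (\<lambda>k i. if i \<in> H then 0 else x k i)"
  have "\<bar>\<Sum>k<n. bilin n w (u k) (u k)\<bar> \<le> (\<Sum>k<n. \<bar>bilin n w (u k) (u k)\<bar>)" by (rule sum_abs)
  also have "\<dots> \<le> (\<Sum>k<n. (58 + heavy_const + 8 * K) * sqrt d * (\<Sum>i<n. (x k i)\<^sup>2))"
  proof (rule sum_mono)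
    fix k
    have "\<bar>bilin n w (u k) (u k)\<bar> \<le> (58 + heavy_const + 8 * K) * sqrt d * (\<Sum>i<n. (u k i)\<^sup>2)"
      by (rule trimmed_quadratic_form) (simp add: u_def)
    also have "\<dots> \<le> (58 + heavy_const + 8 * K) * sqrt d * (\<Sum>i<n. (x k i)\<^sup>2)"
      using B d by (intro mult_left_mono sum_mono) (auto simp: u_def K_def heavy_const_def)
    finally show "\<bar>bilin n w (u k) (u k)\<bar> \<le> \<dots>" .
  qed
  also have "\<dots> = (58 + heavy_const + 8 * K) * sqrt d * \<gamma>"
  proof -
    have "\<gamma> = (\<Sum>k<n. \<Sum>i<n. (x k i)\<^sup>2)" unfolding \<gamma>_def v_def by (rule sum.swap)
    then show ?thesis by (simp add: sum_distrib_left)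
  qed
  finally have good: "\<bar>\<Sum>k<n. bilin n w (u k) (u k)\<bar> \<le> (58 + heavy_const + 8 * K) * sqrt d * \<gamma>" .
  have bad: "\<bar>(\<Sum>k<n. bilin n w (x k) (x k)) - (\<Sum>k<n. bilin n w (u k) (u k))\<bar> \<le> (96 + 8 * B) * sqrt d * \<gamma>"
  proof (cases "H = {} \<or> \<gamma> = 0")
    case True
    then show ?thesis
    proof
      assume "H = {}"
      then have "u = x" by (simp add: u_def)
      then show ?thesis using \<gamma>0 B d by simp
    next
      assume g: "\<gamma> = 0"
      then have "v i = 0" if "i < n" for i using v that by (simp add: \<gamma>_def sum_nonneg_eq_0_iff)
      then have "x k i = 0" if "i < n" "k < n" for i k using that by (simp add: v_def sum_nonneg_eq_0_iff)
      moreover from this have "u k i = 0" if "i < n" "k < n" for i k using that by (simp add: u_def)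
      ultimately show ?thesis using g by (simp add: bilin_def)
    qed
  next
    case False
    define p where "p = (\<lambda>i j. \<Sum>k<n. \<bar>x k i\<bar> * \<bar>x k j\<bar>)"
    have p0: "0 \<le> p i j" for i j by (auto simp: p_def intro: sum_nonneg)
    have psym: "p i j = p j i" for i j by (simp add: p_def mult.commute)
    define q where "q = (\<lambda>i j. if i \<in> H then (a i j + d / n) * p i j else 0)"
    have q0: "0 \<le> q i j" for i j using a0 p0 d by (auto simp: q_def)
    define \<Delta> where "\<Delta> = (\<Sum>k<n. bilin n w (x k) (x k)) - (\<Sum>k<n. bilin n w (u k) (u k))"
    have eq: "\<Delta> = (\<Sum>i<n. \<Sum>j<n. w i j * (\<Sum>k<n. x k i * x k j - u k i * u k j))"
      unfolding bilin_gram \<Delta>_def by (simp add: sum_subtractf algebra_simps)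
    have "\<bar>\<Delta>\<bar> \<le> (\<Sum>i<n. \<Sum>j<n. \<bar>w i j * (\<Sum>k<n. x k i * x k j - u k i * u k j)\<bar>)"
      unfolding eq by (intro order_trans[OF sum_abs] sum_mono) auto
    also have "\<dots> \<le> (\<Sum>i<n. \<Sum>j<n. q i j + q j i)"
    proof (intro sum_mono)
      fix i j assume ij: "i \<in> {..<n}" "j \<in> {..<n}"
      show "\<bar>w i j * (\<Sum>k<n. x k i * x k j - u k i * u k j)\<bar> \<le> q i j + q j i"
      proof (cases "i \<in> H \<or> j \<in> H")
        case False
        then have "u k i = x k i" "u k j = x k j" for k by (auto simp: u_def)
        then show ?thesis using add_nonneg_nonneg[OF q0 q0, of i j j i] by simp
      next
        case True
        then have "\<bar>\<Sum>k<n. x k i * x k j - u k i * u k j\<bar> \<le> p i j"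
          unfolding p_def by (intro order_trans[OF sum_abs] sum_mono) (auto simp: u_def abs_mult)
        then have "\<bar>w i j * (\<Sum>k<n. x k i * x k j - u k i * u k j)\<bar> \<le> (a i j + d / n) * p i j"
          unfolding abs_mult using w[of i j] ij p0 by (intro mult_mono) auto
        also have "\<dots> \<le> q i j + q j i"
          using True q0[of i j] q0[of j i] by (auto simp: q_def asym[of j i] psym[of j i])
        finally show ?thesis .
      qed
    qed
    also have "\<dots> = (\<Sum>i<n. \<Sum>j<n. q i j) + (\<Sum>i<n. \<Sum>j<n. q j i)" by (simp only: sum.distrib)
    also have "(\<Sum>i<n. \<Sum>j<n. q j i) = (\<Sum>i<n. \<Sum>j<n. q i j)" by (rule sum.swap)
    also have "(\<Sum>i<n. \<Sum>j<n. q i j) = (\<Sum>i\<in>H. \<Sum>j<n. (a i j + d / n) * p i j)"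
      using H_sub by (intro sum.mono_neutral_cong_right) (auto simp: q_def)
    finally have 1: "\<bar>\<Delta>\<bar> \<le> 2 * (\<Sum>i\<in>H. \<Sum>j<n. (a i j + d / n) * p i j)" by simp
    have "(\<Sum>i\<in>H. \<Sum>j<n. (a i j + d / n) * p i j) \<le> (\<Sum>i\<in>H. \<Sum>j<n. (a i j + d / n) * ((v i / sqrt d + sqrt d * v j) / 2))"
      using gram_product_le a0 d by (intro sum_mono mult_left_mono) (auto simp: p_def v_def)
    also have "\<dots> = (\<Sum>i\<in>H. \<Sum>j<n. (a i j + d / n) * (v i / sqrt d + sqrt d * v j)) / 2"
      by (simp add: sum_divide_distrib)
    also have "\<dots> \<le> (96 + 8 * B) * sqrt d * \<gamma> / 2"
    proof -
      have k': "n * exp (- \<nu>) \<le> real (max 1 (nat \<lfloor>\<gamma> / 4\<rfloor>))" using k unfolding \<gamma>_def v_def .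
      have "H \<noteq> {}" "\<gamma> > 0" using False \<gamma>0 by auto
      from heavy_rows_le[OF this(1) _ _ \<gamma>_def this(2) k'] show ?thesis
        using v by (intro divide_right_mono) auto
    qed
    finally show ?thesis using 1 by (simp add: \<Delta>_def)
  qed
  have "\<bar>\<Sum>k<n. bilin n w (x k) (x k)\<bar> \<le> (58 + heavy_const + 8 * K) * sqrt d * \<gamma> + (96 + 8 * B) * sqrt d * \<gamma>"
    using good bad by linarith
  also have "\<dots> = (394 + heavy_const + 72 * B) * sqrt d * \<gamma>" by (simp add: K_def algebra_simps)
  finally show "\<bar>\<Sum>k<n. bilin n w (x k) (x k)\<bar> \<le> (394 + heavy_const + 72 * B) * sqrt d * (\<Sum>i<n. \<Sum>k<n. (x k i)\<^sup>2)"
    by (simp add: \<gamma>_def v_def)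
qed

end

section \<open>Sublevel sets of the semidefinite program\<close>

lemma mat_inner_observed:
  "mat_inner n (observed_mat n \<omega>) Y = (\<Sum>i<n. \<Sum>j<n. obs \<omega> i j * Y $$ (i, j))"
  by (simp add: mat_inner_def observed_mat_def obs_def)

lemma bilin_diff_matrix: "bilin n (\<lambda>i j. a i j - b i j) u v = bilin n a u v - bilin n b u v"
  by (simp add: bilin_def sum_subtractf[symmetric] algebra_simps)

lemma bilin_two_block:
  fixes s :: "nat \<Rightarrow> real"
  shows "bilin n (\<lambda>i j. c * (s i * s j) + c') u u = c * (\<Sum>i<n. s i * u i)\<^sup>2 + c' * (\<Sum>i<n. u i)\<^sup>2"
proof -
  have "bilin n (\<lambda>i j. c * (s i * s j) + c') u u
    = (\<Sum>i<n. \<Sum>j<n. c * ((s i * u i) * (s j * u j)) + c' * (u i * u j))"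
    unfolding bilin_def by (intro sum.cong refl) (simp add: algebra_simps)
  also have "\<dots> = c * (\<Sum>i<n. \<Sum>j<n. (s i * u i) * (s j * u j)) + c' * (\<Sum>i<n. \<Sum>j<n. u i * u j)"
    by (simp only: sum.distrib sum_distrib_left)
  finally show ?thesis by (simp only: power2_eq_square sum_product)
qed

text \<open>The second conclusion is the crude bound: the noise is estimated on \<open>Y\<close> and
  on the truth, both of trace \<open>n\<close>, and compared with the signal
  \<open>c\<^sub>1\<close>; it keeps the set of the third conclusion small. For the third the noise
  form is taken on the compression, where the mean vanishes: its \<sigma> part by orthogonality, its
  constant part \<open>c\<^sub>2\<close> by balance.\<close>

lemma sublevel_deterministic:
  fixes Y :: "real mat" and c\<^sub>1 c\<^sub>2 \<theta> \<nu> :: real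
  assumes n: "n > 0" and \<sigma>: "label_vec n \<sigma>" and Y: "Y \<in> sublevel_set n F \<sigma> (observed_mat n \<omega>)"
    and F: "F \<subseteq> sdp_feasible n" "c\<^sub>2 = 0 \<or> (balanced n \<sigma> \<and> F \<subseteq> sdp_feasible_balanced n)"
    and fb: "form_bound n (\<lambda>i j. obs \<omega> i j - (c\<^sub>1 * (\<sigma> $ i * \<sigma> $ j) + c\<^sub>2)) \<nu> \<theta>"
    and \<nu>: "\<nu> \<ge> 3"
  defines "\<gamma> \<equiv> entry_l1_norm n (Y - truth_mat n \<sigma>) / n"
  shows "0 \<le> \<gamma>" "c\<^sub>1 * \<gamma> \<le> 2 * \<theta>"
    and "\<And>k. \<gamma> \<noteq> 0 \<Longrightarrow> k = max 1 (nat \<lfloor>\<gamma> / 4\<rfloor>) \<Longrightarrow> n * exp (- \<nu>) \<le> real k \<Longrightarrow>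
      \<exists>S. S \<subseteq> {..<n} \<and> card S = k \<and> (\<Sum>i\<in>S. \<Sum>j<n. obs \<omega> i j * (\<sigma> $ i * \<sigma> $ j)) \<le> \<theta> * k"
proof -
  have YF: "Y \<in> F" and ge0: "mat_inner n (observed_mat n \<omega>) (truth_mat n \<sigma>) \<le> mat_inner n (observed_mat n \<omega>) Y"
    using Y by (auto simp: sublevel_set_def)
  have Yf: "Y \<in> sdp_feasible n" using YF F by auto
  define s where "s = (\<lambda>i. \<sigma> $ i)"
  have s2: "(s i)\<^sup>2 = 1" if "i < n" for i using \<sigma> that by (auto simp: label_vec_def s_def)
  define y where "y = (\<lambda>i j. Y $$ (i, j))"
  define \<mu> where "\<mu> = (\<lambda>i j. c\<^sub>1 * (s i * s j) + c\<^sub>2)"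
  define w where "w = (\<lambda>i j. obs \<omega> i j - \<mu> i j)"
  have fb': "form_bound n w \<nu> \<theta>" using fb by (simp add: w_def \<mu>_def s_def)
  have ge: "(\<Sum>i<n. \<Sum>j<n. obs \<omega> i j * (s i * s j)) \<le> (\<Sum>i<n. \<Sum>j<n. obs \<omega> i j * y i j)"
    using ge0 unfolding mat_inner_observed by (simp add: truth_mat_def s_def y_def)
  obtain b where b: "\<And>i j. i < n \<Longrightarrow> j < n \<Longrightarrow> y i j = (\<Sum>k<n. b k i * b k j)"
    unfolding y_def using sdp_feasible_gram[OF Yf] by blast
  have diag: "y i i = 1" if "i < n" for i using sdp_feasibleD(4)[OF Yf that] by (simp add: y_def)
  have b1: "(\<Sum>k<n. (b k i)\<^sup>2) = 1" if "i < n" for i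
    using b[OF that that] diag[OF that] by (simp add: power2_eq_square)
  define G where "G = (\<Sum>i<n. \<Sum>j<n. 1 - s i * s j * y i j)"
  have g: "\<gamma> = G / n" unfolding \<gamma>_def entry_l1_dist_truth[OF Yf \<sigma>] by (simp add: G_def s_def y_def)
  \<comment> \<open>The entries of \<open>Y\<close> add up to the sum of the squared row sums of its
    Gram factor, so the balance constraint makes every row sum vanish.\<close>
  have bal: "c\<^sub>2 = 0 \<or> ((\<Sum>i<n. s i) = 0 \<and> (\<forall>k<n. (\<Sum>i<n. b k i) = 0))"
  proof (cases "c\<^sub>2 = 0")
    case False
    then have s0: "(\<Sum>i<n. s i) = 0" and "Y \<in> sdp_feasible_balanced n"
      using F YF by (auto simp: balanced_def s_def)
    then have "(\<Sum>i<n. \<Sum>j<n. y i j) = 0" by (simp add: sdp_feasible_balanced_def y_def)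
    moreover have "(\<Sum>i<n. \<Sum>j<n. y i j) = (\<Sum>i<n. \<Sum>j<n. 1 * (\<Sum>k<n. b k i * b k j))"
      by (intro sum.cong refl) (simp add: b)
    moreover have "\<dots> = (\<Sum>k<n. (\<Sum>i<n. b k i)\<^sup>2)"
      unfolding bilin_gram[symmetric] bilin_def by (simp add: power2_eq_square sum_product)
    ultimately have "(\<Sum>k<n. (\<Sum>i<n. b k i)\<^sup>2) = 0" by simp
    then have "\<forall>k<n. (\<Sum>i<n. b k i) = 0" by (simp add: sum_nonneg_eq_0_iff)
    then show ?thesis using s0 by simp
  qed simp
  define x where "x = (\<lambda>k i. b k i - (\<Sum>l<n. s l * b k l) / n * s i)"
  have x4: "(\<Sum>k<n. (x k i)\<^sup>2) \<le> 4" if "i < n" for i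
    unfolding x_def by (rule projected_gram(1)[OF n s2 b diag obs_sym ge]) (simp_all add: that)
  have pg2: "(\<Sum>i<n. \<Sum>k<n. (x k i)\<^sup>2) = G / n"
    unfolding x_def G_def by (rule projected_gram(2)[OF n s2 b diag obs_sym ge]) simp_all
  have pg3: "(\<Sum>i<n. (\<Sum>j<n. obs \<omega> i j * (s i * s j)) * (\<Sum>k<n. (x k i)\<^sup>2)) \<le> (\<Sum>k<n. bilin n (obs \<omega>) (x k) (x k))"
    unfolding x_def by (rule projected_gram(3)[OF n s2 b diag obs_sym ge]) simp_all
  have pg4: "(\<Sum>i<n. s i * x k i) = 0" for k
    unfolding x_def by (rule projected_gram(4)[OF n s2 b diag obs_sym ge]) simp_all
  define v where "v = (\<lambda>i. \<Sum>k<n. (x k i)\<^sup>2)"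
  have v0: "0 \<le> v i" for i by (auto simp: v_def intro: sum_nonneg)
  have vg: "(\<Sum>i<n. v i) = \<gamma>" using pg2 by (simp add: v_def g)
  show g0: "0 \<le> \<gamma>" unfolding vg[symmetric] using v0 by (intro sum_nonneg) auto
  \<comment> \<open>Trace \<open>n\<close> is admissible: \<open>exp (- \<nu>) \<le> 1 / 8\<close>
    for \<open>\<nu> \<ge> 3\<close>, and the rounded \<open>n / 4\<close> is at least
    \<open>n / 8\<close>.\<close>
  have nk: "n * exp (- \<nu>) \<le> real (max 1 (nat \<lfloor>real n / 4\<rfloor>))"
  proof -
    have "(8 :: real) \<le> 2 * 2 * 2" by simp
    also have "\<dots> \<le> exp 1 * exp 1 * exp 1"
      using exp_ge_add_one_self[of "1 :: real"] by (intro mult_mono) auto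
    also have "\<dots> = exp 3" by (simp add: exp_add[symmetric])
    also have "\<dots> \<le> exp \<nu>" using \<nu> by simp
    finally have "exp (- \<nu>) \<le> 1 / 8" by (simp add: exp_minus divide_simps)
    then have "n * exp (- \<nu>) \<le> n * (1 / 8)" by (intro mult_left_mono) auto
    also have "\<dots> \<le> real (max 1 (nat \<lfloor>real n / 4\<rfloor>))" by linarith
    finally show ?thesis .
  qed
  have fbn: "\<bar>\<Sum>k<n. bilin n w (x k) (x k)\<bar> \<le> \<theta> * n" if "\<And>i. i < n \<Longrightarrow> (\<Sum>k<n. (x k i)\<^sup>2) = 1" for x :: "nat \<Rightarrow> nat \<Rightarrow> real"
    using fb'[unfolded form_bound_def, rule_format, of x] that nk by simp
  show "c\<^sub>1 * \<gamma> \<le> 2 * \<theta>"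
  proof -
    have B1: "(\<Sum>i<n. \<Sum>j<n. w i j * y i j) \<le> \<theta> * n"
    proof -
      have "(\<Sum>k<n. bilin n w (b k) (b k)) = (\<Sum>i<n. \<Sum>j<n. w i j * y i j)"
        unfolding bilin_gram by (intro sum.cong refl) (simp add: b)
      then show ?thesis using fbn[of b] b1 by simp
    qed
    have B2: "- (\<theta> * n) \<le> (\<Sum>i<n. \<Sum>j<n. w i j * (s i * s j))"
    proof -
      \<comment> \<open>A Gram factor of the true matrix with a single nonzero row, in the shape
        that \<open>form_bound\<close> expects.\<close>
      define u where "u = (\<lambda>(k :: nat) (i :: nat). if k = 0 then s i else (0 :: real))"
      have su: "(\<Sum>k<n. if k = (0 :: nat) then c else (0 :: real)) = c" for c using n by (simp add: sum.delta)
      have "(\<Sum>k<n. (u k i)\<^sup>2) = 1" if "i < n" for i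
        using su[of "(s i)\<^sup>2"] s2[OF that] by (simp add: u_def if_distrib[of "\<lambda>z. z\<^sup>2"] cong: if_cong)
      then have "\<bar>\<Sum>k<n. bilin n w (u k) (u k)\<bar> \<le> \<theta> * n" by (intro fbn) auto
      then have "- (\<theta> * n) \<le> (\<Sum>k<n. bilin n w (u k) (u k))" by linarith
      also have "\<dots> = (\<Sum>k<n. if k = 0 then bilin n w s s else 0)"
        by (intro sum.cong refl) (simp add: u_def bilin_def)
      also have "\<dots> = bilin n w s s" by (rule su)
      finally show ?thesis by (simp add: bilin_def mult_ac)
    qed
    have "(\<Sum>i<n. \<Sum>j<n. \<mu> i j * (s i * s j - y i j)) = c\<^sub>1 * G + c\<^sub>2 * ((\<Sum>i<n. \<Sum>j<n. s i * s j) - (\<Sum>i<n. \<Sum>j<n. y i j))"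
    proof -
      have "\<mu> i j * (s i * s j - y i j) = c\<^sub>1 * (1 - s i * s j * y i j) + c\<^sub>2 * (s i * s j - y i j)" if "i < n" "j < n" for i j
      proof -
        have "s i * s j * (s i * s j) = 1" using s2[OF that(1)] s2[OF that(2)]
            by (metis mult.assoc mult.commute mult.right_neutral power2_eq_square)
        then show ?thesis by (simp add: \<mu>_def algebra_simps)
      qed
      then have "(\<Sum>i<n. \<Sum>j<n. \<mu> i j * (s i * s j - y i j)) = (\<Sum>i<n. \<Sum>j<n. c\<^sub>1 * (1 - s i * s j * y i j) + c\<^sub>2 * (s i * s j - y i j))"
        by (intro sum.cong refl) auto
      also have "\<dots> = c\<^sub>1 * G + c\<^sub>2 * (\<Sum>i<n. \<Sum>j<n. s i * s j - y i j)"
        by (simp only: sum.distrib sum_distrib_left G_def)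
      finally show ?thesis by (simp only: sum_subtractf)
    qed
    also have "c\<^sub>2 * ((\<Sum>i<n. \<Sum>j<n. s i * s j) - (\<Sum>i<n. \<Sum>j<n. y i j)) = 0"
    proof (cases "c\<^sub>2 = 0")
      case False
      then have s0: "(\<Sum>i<n. s i) = 0" and bk: "\<And>k. k < n \<Longrightarrow> (\<Sum>i<n. b k i) = 0" using bal by auto
      have "(\<Sum>i<n. \<Sum>j<n. s i * s j) = (\<Sum>i<n. s i) * (\<Sum>j<n. s j)" by (simp only: sum_product)
      moreover have "(\<Sum>i<n. \<Sum>j<n. y i j) = 0"
        using False F YF by (auto simp: y_def sdp_feasible_balanced_def)
      ultimately show ?thesis using s0 by simp
    qed simp
    finally have "(\<Sum>i<n. \<Sum>j<n. \<mu> i j * (s i * s j - y i j)) = c\<^sub>1 * G" by simp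
    moreover have "(\<Sum>i<n. \<Sum>j<n. \<mu> i j * (s i * s j - y i j)) = (\<Sum>i<n. \<Sum>j<n. obs \<omega> i j * (s i * s j)) - (\<Sum>i<n. \<Sum>j<n. obs \<omega> i j * y i j)
        + (\<Sum>i<n. \<Sum>j<n. w i j * y i j) - (\<Sum>i<n. \<Sum>j<n. w i j * (s i * s j))"
      unfolding w_def by (simp add: left_diff_distrib right_diff_distrib sum_subtractf)
    ultimately have "c\<^sub>1 * G \<le> 2 * \<theta> * n" using ge B1 B2 by linarith
    then show ?thesis using n by (simp add: g divide_le_eq)
  qed
  fix k assume gn: "\<gamma> \<noteq> 0" and k: "k = max 1 (nat \<lfloor>\<gamma> / 4\<rfloor>)" and nk: "n * exp (- \<nu>) \<le> real k"
  have xv: "(\<Sum>i<n. \<Sum>k<n. (x k i)\<^sup>2) = \<gamma>" using vg by (simp add: v_def)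
  have "\<bar>\<Sum>k<n. bilin n w (x k) (x k)\<bar> \<le> \<theta> * \<gamma>"
    using fb'[unfolded form_bound_def, rule_format, of x] x4 nk unfolding k xv by blast
  moreover have "(\<Sum>k<n. bilin n w (x k) (x k)) = (\<Sum>k<n. bilin n (obs \<omega>) (x k) (x k))"
  proof (rule sum.cong[OF refl])
    fix k assume "k \<in> {..<n}"
    then have kn: "k < n" by simp
    have "(\<Sum>i<n. s i * x k i) = 0" by (rule pg4)
    moreover have "c\<^sub>2 * (\<Sum>i<n. x k i)\<^sup>2 = 0"
    proof (cases "c\<^sub>2 = 0")
      case False
      then have s0: "(\<Sum>i<n. s i) = 0" and bk: "(\<Sum>i<n. b k i) = 0" using bal kn by auto
      have "(\<Sum>i<n. x k i) = (\<Sum>i<n. b k i) - (\<Sum>l<n. s l * b k l) / n * (\<Sum>i<n. s i)"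
        by (simp add: x_def sum_subtractf sum_distrib_left)
      then show ?thesis using s0 bk by simp
    qed simp
    ultimately have "bilin n \<mu> (x k) (x k) = 0" unfolding \<mu>_def bilin_two_block by simp
    then show "bilin n w (x k) (x k) = bilin n (obs \<omega>) (x k) (x k)"
      unfolding w_def bilin_diff_matrix by simp
  qed
  ultimately have up: "(\<Sum>i<n. (\<Sum>j<n. obs \<omega> i j * (s i * s j)) * v i) \<le> \<theta> * \<gamma>"
    using pg3 unfolding v_def by linarith
  define D where "D = (\<lambda>i. \<Sum>j<n. obs \<omega> i j * (s i * s j))"
  have gp: "\<gamma> / 4 > 0" using g0 gn by simp
  \<comment> \<open>The averaging selects large values; it is applied to \<open>- D\<close> because
    small row sums are wanted.\<close>
  have "\<gamma> / 4 = (\<Sum>i<n. v i / 4)" by (simp add: vg[symmetric] sum_divide_distrib)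
  then obtain S where S: "S \<subseteq> {..<n}" "card S = k"
    "k * (\<Sum>i<n. v i / 4 * (- D i)) \<le> \<gamma> / 4 * (\<Sum>i\<in>S. - D i)"
    using card_subset_sum_ge_weighted_sum[of n "\<lambda>i. v i / 4" "\<gamma> / 4" k "\<lambda>i. - D i"] v0 x4 gp k by (auto simp: v_def)
  have eqD: "(\<Sum>i<n. v i / 4 * (- D i)) = - ((\<Sum>i<n. D i * v i) / 4)"
    by (simp add: sum_divide_distrib sum_negf mult.commute)
  have "k * (- ((\<Sum>i<n. D i * v i) / 4)) \<le> \<gamma> / 4 * (- (\<Sum>i\<in>S. D i))"
    using S(3) unfolding eqD by (simp only: sum_negf)
  then have "\<gamma> / 4 * (\<Sum>i\<in>S. D i) \<le> k * ((\<Sum>i<n. D i * v i) / 4)" by simp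
  also have "\<dots> \<le> k * (\<theta> * \<gamma> / 4)" using up by (intro mult_left_mono) (auto simp: D_def)
  also have "\<dots> = \<gamma> / 4 * (\<theta> * k)" by simp
  finally have "(\<Sum>i\<in>S. D i) \<le> \<theta> * k" using gp by (simp only: mult_le_cancel_left_pos)
  then show "\<exists>S. S \<subseteq> {..<n} \<and> card S = k \<and> (\<Sum>i\<in>S. \<Sum>j<n. obs \<omega> i j * (\<sigma> $ i * \<sigma> $ j)) \<le> \<theta> * k"
    using S by (auto simp: D_def s_def)
qed

lemma exp_neg_series_le_one: "(\<Sum>k\<in>{1..n}. exp (- real k)) \<le> 1"
proof -
  have e: "exp (- real k) \<le> (1 / 2) ^ k" for k
  proof -
    have "exp (- 1 :: real) \<le> 1 / 2"
      using exp_ge_add_one_self[of "1 :: real"] by (simp add: exp_minus divide_simps)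
    then have "exp (- 1 :: real) ^ k \<le> (1 / 2) ^ k" by (intro power_mono) auto
    then show ?thesis using exp_of_nat_mult[of k "- 1 :: real"] by simp
  qed
  have "(\<Sum>k\<in>{1..n}. (1 / 2 :: real) ^ k) \<le> 1 - (1 / 2) ^ n" by (induction n) auto
  also have "\<dots> \<le> 1" by simp
  finally have "(\<Sum>k\<in>{1..n}. (1 / 2 :: real) ^ k) \<le> 1" .
  moreover have "(\<Sum>k\<in>{1..n}. exp (- real k)) \<le> (\<Sum>k\<in>{1..n}. (1 / 2) ^ k)" by (intro sum_mono e)
  ultimately show ?thesis by linarith
qed

section \<open>Lower tails of signed row sums over index sets\<close>

context entry_model
begin

text \<open>
  Inside \<open>S\<close> each pair is counted twice, so its moment generating function is taken at \<open>2 t\<close>; at the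
  Chernoff-optimal \<open>t\<close> it contributes nothing there, up to the factors \<open>\<kappa>\<close> that cancel by balance.
\<close>

lemma row_sums_tail:
  fixes t \<kappa> J \<theta> :: real
  assumes S: "S \<subseteq> {..<n}" "S \<noteq> {}" and t: "t > 0" and \<kappa>: "\<kappa> * (\<Sum>i<n. \<sigma> $ i) = 0"
    and mgf1: "\<And>i j. i \<le> j \<Longrightarrow> j < n \<Longrightarrow>
      (\<integral>\<^sup>+x. ennreal (exp (- t * (\<sigma> $ i * \<sigma> $ j) * x)) \<partial>D (\<sigma> $ i * \<sigma> $ j)) \<le> ennreal (exp (\<sigma> $ i * \<sigma> $ j * \<kappa> - J))"
    and mgf2: "\<And>i j. i < j \<Longrightarrow> j < n \<Longrightarrow>
      (\<integral>\<^sup>+x. ennreal (exp (- (2 * t) * (\<sigma> $ i * \<sigma> $ j) * x)) \<partial>D (\<sigma> $ i * \<sigma> $ j)) \<le> ennreal (exp (2 * (\<sigma> $ i * \<sigma> $ j * \<kappa>)))"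
  defines "A \<equiv> {\<omega> \<in> space P. (\<Sum>i\<in>S. \<Sum>j<n. obs \<omega> i j * (\<sigma> $ i * \<sigma> $ j)) \<le> \<theta> * card S}"
  shows "A \<in> events" "prob A \<le> exp (t * \<theta> * card S - card S * (real n - card S + 1) * J)"
proof -
  define g where "g = (\<lambda>i j x. if i \<in> S then - t * (\<sigma> $ i * \<sigma> $ j) * x else (0 :: real))"
  \<comment> \<open>The gain \<open>J\<close> is credited to entries that are tilted once, those
    leaving \<open>S\<close> and the diagonal: \<open>n - card S + 1\<close> of them in each row of
    \<open>S\<close>.\<close>
  define b where "b = (\<lambda>i j. if i \<in> S then \<sigma> $ i * \<sigma> $ j * \<kappa> - (if j \<notin> S \<or> j = i then J else 0) else 0)"
  have gm: "\<And>i j. g i j \<in> borel_measurable borel" by (simp add: g_def)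
  have off: "(\<integral>\<^sup>+x. ennreal (exp (g i j x + g j i x)) \<partial>D (\<sigma> $ i * \<sigma> $ j)) \<le> ennreal (exp (b i j + b j i))"
    if ij: "i < j" "j < n" for i j
  proof -
    consider "i \<in> S" "j \<in> S" | "i \<in> S" "j \<notin> S" | "i \<notin> S" "j \<in> S" | "i \<notin> S" "j \<notin> S" by blast
    then show ?thesis
    proof cases
      case 1
      have "g i j x + g j i x = - (2 * t) * (\<sigma> $ i * \<sigma> $ j) * x" for x using 1 by (simp add: g_def)
      moreover have "b i j + b j i = 2 * (\<sigma> $ i * \<sigma> $ j * \<kappa>)" using 1 ij by (simp add: b_def)
      ultimately show ?thesis using mgf2[OF ij] by (simp only:)
    next
      case 2
      have "g i j x + g j i x = - t * (\<sigma> $ i * \<sigma> $ j) * x" for x using 2 by (simp add: g_def)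
      moreover have "b i j + b j i = \<sigma> $ i * \<sigma> $ j * \<kappa> - J" using 2 ij by (simp add: b_def)
      ultimately show ?thesis using mgf1[of i j] ij by (simp only: less_imp_le)
    next
      case 3
      have "g i j x + g j i x = - t * (\<sigma> $ i * \<sigma> $ j) * x" for x using 3 by (simp add: g_def)
      moreover have "b i j + b j i = \<sigma> $ i * \<sigma> $ j * \<kappa> - J" using 3 ij by (simp add: b_def)
      ultimately show ?thesis using mgf1[of i j] ij by (simp only: less_imp_le)
    next
      case 4
      then show ?thesis using prob_space.emeasure_space_1[OF prob_D] by (simp add: g_def b_def)
    qed
  qed
  have diag: "(\<integral>\<^sup>+x. ennreal (exp (g i i x)) \<partial>D (\<sigma> $ i * \<sigma> $ i)) \<le> ennreal (exp (b i i))" if "i < n" for i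
  proof (cases "i \<in> S")
    case True
    then have "g i i x = - t * (\<sigma> $ i * \<sigma> $ i) * x" for x by (simp add: g_def)
    moreover have "b i i = \<sigma> $ i * \<sigma> $ i * \<kappa> - J" using True by (simp add: b_def)
    ultimately show ?thesis using mgf1[of i i] that by (simp only: order_refl)
  next
    case False
    then show ?thesis using prob_space.emeasure_space_1[OF prob_D] by (simp add: g_def b_def)
  qed
  note tl = tail[of g b "- (t * (\<theta> * card S))", OF gm off diag]
  have out: "(\<Sum>i<n. if i \<in> S then f i else 0) = (\<Sum>i\<in>S. f i)" for f :: "nat \<Rightarrow> real"
    using S(1) by (auto intro!: sum.mono_neutral_cong_right)
  have gs: "(\<Sum>i<n. \<Sum>j<n. g i j (obs \<omega> i j)) = - (t * (\<Sum>i\<in>S. \<Sum>j<n. obs \<omega> i j * (\<sigma> $ i * \<sigma> $ j)))" for \<omega>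
  proof -
    have "(\<Sum>i<n. \<Sum>j<n. g i j (obs \<omega> i j)) = (\<Sum>i<n. if i \<in> S then - (t * (\<Sum>j<n. obs \<omega> i j * (\<sigma> $ i * \<sigma> $ j))) else 0)"
      by (intro sum.cong refl) (simp add: g_def sum_distrib_left sum_negf[symmetric] mult_ac)
    then show ?thesis unfolding out by (simp add: sum_negf sum_distrib_left)
  qed
  have fin: "finite S" using S(1) finite_subset by blast
  have bs: "(\<Sum>i<n. \<Sum>j<n. b i j) = - (card S * (real n - card S + 1) * J)"
  proof -
    have row: "(\<Sum>j<n. if j \<notin> S \<or> j = i then J else 0) = (real n - card S + 1) * J" if "i \<in> S" for i
    proof -
      have "(\<Sum>j<n. if j \<notin> S \<or> j = i then J else 0) = (\<Sum>j\<in>insert i ({..<n} - S). J)"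
        using that S(1) by (intro sum.mono_neutral_cong_right) auto
      also have "\<dots> = real (card (insert i ({..<n} - S))) * J" by simp
      also have "card (insert i ({..<n} - S)) = n - card S + 1"
        using that S(1) fin by (simp add: card_Diff_subset)
      finally show ?thesis using card_mono[OF _ S(1)] by (simp add: of_nat_diff)
    qed
    have "(\<Sum>i<n. \<Sum>j<n. b i j) = (\<Sum>i<n. if i \<in> S then \<sigma> $ i * (\<kappa> * (\<Sum>j<n. \<sigma> $ j)) - (\<Sum>j<n. if j \<notin> S \<or> j = i then J else 0) else 0)"
      by (intro sum.cong refl) (simp add: b_def sum_subtractf sum_distrib_left mult_ac)
    also have "\<dots> = (\<Sum>i\<in>S. - ((real n - card S + 1) * J))"
      unfolding out \<kappa>
    proof (rule sum.cong[OF refl])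
      fix i assume "i \<in> S"
      from row[OF this] show "\<sigma> $ i * 0 - (\<Sum>j<n. if j \<notin> S \<or> j = i then J else 0) = - ((real n - card S + 1) * J)"
        by (simp only: mult_zero_right diff_0)
    qed
    finally show ?thesis by simp
  qed
  have Aeq: "A = {\<omega> \<in> space P. - (t * (\<theta> * card S)) \<le> (\<Sum>i<n. \<Sum>j<n. g i j (obs \<omega> i j))}"
    unfolding A_def gs using t by auto
  show "A \<in> events" unfolding Aeq by (rule tl(1))
  show "prob A \<le> exp (t * \<theta> * card S - card S * (real n - card S + 1) * J)"
    using tl(2) unfolding Aeq bs by (simp add: mult.assoc)
qed

text \<open>Here \<open>z = sqrt (n * I)\<close>. Above the threshold \<open>x\<close> the entropy
  \<open>ln (n / k)\<close> is below \<open>n * J\<close> by \<open>(3 / 2 * a + 4) * z\<close>. Of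
  this, \<open>a * z\<close> pays for the slack \<open>t * \<theta>\<close>,
  \<open>a * z / 2\<close> for the gain lost on pairs inside the set, and \<open>4 * z\<close>
  remains for summability and the probability.\<close>

lemma row_sums_event:
  fixes t \<kappa> J \<theta> a I z x :: real
  assumes t: "t > 0" and \<kappa>: "\<kappa> * (\<Sum>i<n. \<sigma> $ i) = 0"
    and mgf1: "\<And>i j. i \<le> j \<Longrightarrow> j < n \<Longrightarrow>
      (\<integral>\<^sup>+x. ennreal (exp (- t * (\<sigma> $ i * \<sigma> $ j) * x)) \<partial>D (\<sigma> $ i * \<sigma> $ j)) \<le> ennreal (exp (\<sigma> $ i * \<sigma> $ j * \<kappa> - J))"
    and mgf2: "\<And>i j. i < j \<Longrightarrow> j < n \<Longrightarrow>
      (\<integral>\<^sup>+x. ennreal (exp (- (2 * t) * (\<sigma> $ i * \<sigma> $ j) * x)) \<partial>D (\<sigma> $ i * \<sigma> $ j)) \<le> ennreal (exp (2 * (\<sigma> $ i * \<sigma> $ j * \<kappa>)))"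
    and z: "z \<ge> 1" "z\<^sup>2 = n * I" and J: "0 \<le> J" "J \<le> I" and a: "a \<ge> 0" and t\<theta>: "t * \<theta> \<le> a * z"
  defines "x \<equiv> n * exp (- (n * J) + (3 / 2 * a + 4) * z)"
  shows "\<exists>E\<in>events. 1 - exp (- sqrt (ln n)) \<le> prob E \<and> (\<forall>\<omega>\<in>E. \<forall>S. S \<subseteq> {..<n} \<longrightarrow> S \<noteq> {} \<longrightarrow>
    x \<le> card S \<longrightarrow> real (card S) - 1 \<le> a * n / (2 * z) \<longrightarrow>
    \<theta> * card S < (\<Sum>i\<in>S. \<Sum>j<n. obs \<omega> i j * (\<sigma> $ i * \<sigma> $ j)))"
proof -
  define F where "F = {S. S \<subseteq> {..<n} \<and> S \<noteq> {} \<and> x \<le> card S \<and> real (card S) - 1 \<le> a * n / (2 * z)}"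
  have finF: "finite F" unfolding F_def by (rule finite_subset[of _ "Pow {..<n}"]) auto
  define A where "A = (\<lambda>S. {\<omega> \<in> space P. (\<Sum>i\<in>S. \<Sum>j<n. obs \<omega> i j * (\<sigma> $ i * \<sigma> $ j)) \<le> \<theta> * card S})"
  define ex where "ex = (\<lambda>k :: nat. t * \<theta> * k - k * (real n - k + 1) * J)"
  have A: "A S \<in> events \<and> prob (A S) \<le> exp (ex (card S))" if "S \<in> F" for S
  proof -
    have "S \<subseteq> {..<n}" "S \<noteq> {}" using that by (auto simp: F_def)
    from row_sums_tail[OF this t \<kappa> mgf1 mgf2, of \<theta>] show ?thesis
      unfolding A_def ex_def by (intro conjI)
  qed
  have ln0: "0 \<le> ln (real n)" using n_pos by simp
  have key: "entropy_bound n k + ex k \<le> - real k - sqrt (ln n)"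
    if k: "0 < k" "k \<le> n" "x \<le> k" "real k - 1 \<le> a * n / (2 * z)" for k
  proof -
    have kr: "real k \<ge> 1" using k by simp
    have xp: "x > 0" using n_pos by (simp add: x_def)
    have "ln x \<le> ln (real k)" using k xp by simp
    moreover have "ln x = ln n + (- (n * J) + (3 / 2 * a + 4) * z)"
      using n_pos by (simp add: x_def ln_mult)
    ultimately have l: "ln (n / k) \<le> n * J - (3 / 2 * a + 4) * z" using n_pos k by (simp add: ln_div)
    have "(real k - 1) * J \<le> a * n / (2 * z) * I" using k J kr a z by (intro mult_mono) auto
    also have "\<dots> = a * (n * I) / (2 * z)" by simp
    also have "\<dots> = a * z / 2" unfolding z(2)[symmetric] using z(1) by (simp add: power2_eq_square)
    finally have kJ: "(real k - 1) * J \<le> a * z / 2" .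
    have "entropy_bound n k + ex k = k * (1 + ln (n / k) + t * \<theta> - n * J + (real k - 1) * J)"
      by (simp add: entropy_bound_def ex_def algebra_simps)
    also have "\<dots> \<le> k * (1 + (n * J - (3 / 2 * a + 4) * z) + a * z - n * J + a * z / 2)"
      using l t\<theta> kJ by (intro mult_left_mono) auto
    also have "\<dots> = - k - k * (4 * z - 2)" by (simp add: algebra_simps)
    finally have 1: "entropy_bound n k + ex k \<le> - k - k * (4 * z - 2)" .
    have "sqrt (ln n) \<le> k * (4 * z - 2)"
    \<comment> \<open>If \<open>n * J\<close> is at least half of \<open>ln n\<close>, then
      \<open>2 * z\<close> already exceeds \<open>sqrt (ln n)\<close>. Otherwise the threshold
      \<open>x\<close>, hence \<open>k\<close>, is at least \<open>sqrt n\<close>.\<close>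
    proof (cases "ln n \<le> 2 * (n * J)")
      case True
      have "n * J \<le> n * I" using J by (intro mult_left_mono) auto
      then have "ln n \<le> 2 * z\<^sup>2" using True z(2) by simp
      also have "\<dots> \<le> (2 * z)\<^sup>2" by (simp add: power_mult_distrib)
      finally have "sqrt (ln n) \<le> 2 * z" using z(1) by (intro real_le_lsqrt) (use ln0 in auto)
      also have "\<dots> \<le> 1 * (4 * z - 2)" using z(1) by simp
      also have "\<dots> \<le> k * (4 * z - 2)" using z(1) kr by (intro mult_right_mono) auto
      finally show ?thesis .
    next
      case False
      have "sqrt (real n) = n * exp (- (ln n / 2))"
      proof -
        have "exp (ln n / 2) = sqrt n"
          using n_pos by (simp add: ln_sqrt[symmetric])
        then show ?thesis using n_pos by (simp add: exp_minus field_simps)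
      qed
      also have "\<dots> \<le> x" unfolding x_def
      proof (intro mult_left_mono)
        have "0 \<le> (3 / 2 * a + 4) * z" using a z by simp
        then show "exp (- (ln n / 2)) \<le> exp (- (n * J) + (3 / 2 * a + 4) * z)" using False by simp
      qed simp
      also have "x \<le> k" by (rule k)
      finally have "sqrt n \<le> k" .
      moreover have "sqrt (ln n) \<le> sqrt n" using n_pos ln_le_minus_one[of "real n"] by simp
      moreover have "real k * 1 \<le> k * (4 * z - 2)" using z(1) by (intro mult_left_mono) auto
      ultimately show ?thesis by linarith
    qed
    with 1 show ?thesis by linarith
  qed
  have cardF: "card S \<in> {1..n}" if "S \<in> F" for S
    using that card_mono[of "{..<n}" S] finite_subset[of S "{..<n}"] by (auto simp: F_def card_gt_0_iff Suc_le_eq)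
  have "(\<Sum>S\<in>F. exp (ex (card S))) = (\<Sum>k\<in>{1..n}. \<Sum>S\<in>{S \<in> F. card S = k}. exp (ex (card S)))"
    by (rule sum.group[symmetric]) (use finF cardF in auto)
  also have "\<dots> \<le> (\<Sum>k\<in>{1..n}. exp (- real k) * exp (- sqrt (ln n)))"
  proof (rule sum_mono)
    fix k assume k: "k \<in> {1..n}"
    show "(\<Sum>S\<in>{S \<in> F. card S = k}. exp (ex (card S))) \<le> exp (- real k) * exp (- sqrt (ln n))"
    proof (cases "{S \<in> F. card S = k} = {}")
      case True
      show ?thesis unfolding True by simp
    next
      case False
      then have kx: "x \<le> k" "real k - 1 \<le> a * n / (2 * z)" by (auto simp: F_def)
      have "card {S \<in> F. card S = k} \<le> card {S. S \<subseteq> {..<n} \<and> card S = k}"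
        by (rule card_mono) (auto simp: F_def intro: finite_subset[of _ "Pow {..<n}"])
      then have "real (card {S \<in> F. card S = k}) \<le> real (n choose k)" using n_subsets[of "{..<n}" k] by simp
      also have "\<dots> \<le> exp (entropy_bound n k)" using k by (intro binomial_le_exp_entropy) auto
      finally have "(\<Sum>S\<in>{S \<in> F. card S = k}. exp (ex (card S))) \<le> exp (entropy_bound n k) * exp (ex k)"
        by (simp add: mult_right_mono)
      also have "\<dots> = exp (entropy_bound n k + ex k)" by (simp add: exp_add)
      also have "\<dots> \<le> exp (- real k - sqrt (ln n))" using key[OF _ _ kx] k by simp
      also have "\<dots> = exp (- real k) * exp (- sqrt (ln n))" by (simp add: exp_add[symmetric])
      finally show ?thesis .
    qed
  qed
  also have "\<dots> = (\<Sum>k\<in>{1..n}. exp (- real k)) * exp (- sqrt (ln n))" by (simp only: sum_distrib_right)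
  also have "\<dots> \<le> 1 * exp (- sqrt (ln n))" using exp_neg_series_le_one by (intro mult_right_mono) auto
  finally have sm: "(\<Sum>S\<in>F. exp (ex (card S))) \<le> exp (- sqrt (ln n))" by simp
  have U: "(\<Union>k\<in>F. A k) \<in> events" "prob (\<Union>k\<in>F. A k) \<le> exp (- sqrt (ln n))"
    using prob_Union_le[OF finF, of A "\<lambda>S. exp (ex (card S))" "exp (- sqrt (ln n))"] A sm by auto
  show ?thesis
  proof (intro bexI[of _ "space P - (\<Union>k\<in>F. A k)"] conjI ballI allI impI)
    show "1 - exp (- sqrt (ln n)) \<le> prob (space P - (\<Union>k\<in>F. A k))" using U by (simp add: prob_compl)
    fix \<omega> S assume \<omega>: "\<omega> \<in> space P - (\<Union>k\<in>F. A k)" and "S \<subseteq> {..<n}" "S \<noteq> {}" "x \<le> card S" "real (card S) - 1 \<le> a * n / (2 * z)"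
    then have "S \<in> F" by (simp add: F_def)
    then have "\<omega> \<notin> A S" "\<omega> \<in> space P" using \<omega> by blast+
    then show "\<theta> * card S < (\<Sum>i\<in>S. \<Sum>j<n. obs \<omega> i j * (\<sigma> $ i * \<sigma> $ j))" by (simp add: A_def)
  qed (use U in auto)
qed

end

section \<open>From quadratic form bounds to the two error bounds\<close>

context entry_model
begin

lemma prob_Int_ge:
  assumes "A \<in> events" "B \<in> events" "1 - p \<le> prob A" "1 - q \<le> prob B"
  shows "A \<inter> B \<in> events" "1 - (p + q) \<le> prob (A \<inter> B)"
proof -
  show "A \<inter> B \<in> events" using assms by blast
  have "prob ((space P - A) \<union> (space P - B)) \<le> prob (space P - A) + prob (space P - B)"
    using assms by (intro measure_Un_le) auto
  moreover have "(space P - A) \<union> (space P - B) = space P - A \<inter> B" by auto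
  ultimately show "1 - (p + q) \<le> prob (A \<inter> B)" using assms by (simp add: prob_compl)
qed

text \<open>The claimed probability is at most \<open>1 - 10 / e < 0\<close>, so the empty event
  serves. This leaves \<open>ln n \<ge> 1\<close>, where \<open>1 / n\<close> is at most
  \<open>exp (- sqrt (ln n))\<close>.\<close>

lemma sdp_error_bounds_of_small_n:
  assumes "ln n < 1"
  shows "sdp_error_bounds n D F \<sigma> I m C C'"
proof -
  have "0 \<le> ln (real n)" using n_pos by simp
  then have "sqrt (ln n) \<le> 1" using assms by simp
  then have "exp (- 1) \<le> exp (- sqrt (ln n))" by simp
  moreover have "1 / 3 \<le> exp (- 1 :: real)" using exp_le by (simp add: exp_minus divide_simps)
  ultimately have "1 - 10 * exp (- sqrt (ln n)) \<le> 0" by linarith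
  then show ?thesis unfolding sdp_error_bounds_def with_prob_at_least_def
    by (intro bexI[of _ "{}"]) auto
qed

text \<open>The interface to the models. A model supplies the optimal tilt \<open>t\<close>, the
  gain \<open>J\<close> per entry, an offset \<kappa> that cancels by balance, and the form event;
  \<open>a\<close> measures \<theta> relative to \<open>sqrt (n * I)\<close>, once on the scale of
  the tilt and once against the signal \<open>c\<^sub>1\<close>. Of the ten units of failure
  probability, nine go to the form event and one to the row sums.\<close>

lemma sdp_error_bounds_of_form_event:
  fixes t \<kappa> J \<theta> a I m c\<^sub>1 c\<^sub>2 :: real
  assumes F: "F \<subseteq> sdp_feasible n" "c\<^sub>2 = 0 \<or> (balanced n \<sigma> \<and> F \<subseteq> sdp_feasible_balanced n)"
    and t: "t > 0" and \<kappa>: "\<kappa> * (\<Sum>i<n. \<sigma> $ i) = 0"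
    and mgf1: "\<And>i j. i \<le> j \<Longrightarrow> j < n \<Longrightarrow>
      (\<integral>\<^sup>+x. ennreal (exp (- t * (\<sigma> $ i * \<sigma> $ j) * x)) \<partial>D (\<sigma> $ i * \<sigma> $ j)) \<le> ennreal (exp (\<sigma> $ i * \<sigma> $ j * \<kappa> - J))"
    and mgf2: "\<And>i j. i < j \<Longrightarrow> j < n \<Longrightarrow>
      (\<integral>\<^sup>+x. ennreal (exp (- (2 * t) * (\<sigma> $ i * \<sigma> $ j) * x)) \<partial>D (\<sigma> $ i * \<sigma> $ j)) \<le> ennreal (exp (2 * (\<sigma> $ i * \<sigma> $ j * \<kappa>)))"
    and nI: "6 \<le> n * I" and J: "I / 2 \<le> J" "J \<le> I" "n * J = m * I"
    and a: "a \<ge> 0" and t\<theta>: "t * \<theta> \<le> a * sqrt (n * I)" and c\<^sub>1: "c\<^sub>1 > 0" "\<theta> * sqrt (n * I) \<le> a * n * c\<^sub>1"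
    and form: "\<exists>E\<in>events. 1 - 9 * exp (- sqrt (ln n)) \<le> prob E \<and>
      (\<forall>\<omega>\<in>E. form_bound n (\<lambda>i j. obs \<omega> i j - (c\<^sub>1 * (\<sigma> $ i * \<sigma> $ j) + c\<^sub>2)) (n * J) \<theta>)"
  shows "sdp_error_bounds n D F \<sigma> I m (3 * a + 16) (3 * a + 20)"
proof -
  define z where "z = sqrt (n * I)"
  have z2: "z\<^sup>2 = n * I" using nI by (simp add: z_def)
  have z1: "z \<ge> 1" unfolding z_def using nI by simp
  define x where "x = n * exp (- (n * J) + (3 / 2 * a + 4) * z)"
  have "0 < n * I" using nI by linarith
  then have I0: "I > 0" using n_pos by (simp add: zero_less_mult_iff)
  have J0: "J \<ge> 0" using J I0 by simp
  obtain E\<^sub>1 where E\<^sub>1: "E\<^sub>1 \<in> events" "1 - 9 * exp (- sqrt (ln n)) \<le> prob E\<^sub>1"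
    "\<And>\<omega>. \<omega> \<in> E\<^sub>1 \<Longrightarrow> form_bound n (\<lambda>i j. obs \<omega> i j - (c\<^sub>1 * (\<sigma> $ i * \<sigma> $ j) + c\<^sub>2)) (n * J) \<theta>"
    using form by blast
  obtain E\<^sub>2 where E\<^sub>2: "E\<^sub>2 \<in> events" "1 - exp (- sqrt (ln n)) \<le> prob E\<^sub>2"
    and rows: "\<And>\<omega> S. \<omega> \<in> E\<^sub>2 \<Longrightarrow> S \<subseteq> {..<n} \<Longrightarrow> S \<noteq> {} \<Longrightarrow> x \<le> card S \<Longrightarrow> real (card S) - 1 \<le> a * n / (2 * z) \<Longrightarrow>
      \<theta> * card S < (\<Sum>i\<in>S. \<Sum>j<n. obs \<omega> i j * (\<sigma> $ i * \<sigma> $ j))"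
    using row_sums_event[OF t \<kappa> mgf1 mgf2 z1 z2 J0 J(2) a t\<theta>[folded z_def]] unfolding x_def by blast
  have nJ: "z / 2 \<le> n * J / z"
  proof -
    have "n * (I / 2) \<le> n * J" using J by (intro mult_left_mono) auto
    then have "z\<^sup>2 / 2 \<le> n * J" by (simp add: z2)
    then have "z / 2 * z \<le> n * J" by (simp add: power2_eq_square)
    then show ?thesis using z1 by (simp add: pos_le_divide_eq)
  qed
  \<comment> \<open>As \<open>m * I = n * J\<close>, the relative correction \<open>C / z\<close> is
    the absolute correction \<open>C * (n * J / z)\<close>. By \<open>nJ\<close>, a consequence of
    \<open>J \<ge> I / 2\<close>, it is at least \<open>C * z / 2\<close> for nonnegative
    \<open>C\<close> and can absorb multiples of \<open>z\<close>.\<close>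
  have ex: "(1 - C * sqrt (1 / (n * I))) * m * I = n * J - C * (n * J / z)" for C
    using J(3) by (simp add: z_def real_sqrt_divide algebra_simps)
  have e1: "exp (1 :: real) \<ge> 2" using exp_ge_add_one_self[of "1 :: real"] by simp
  define X where "X = n * exp (- (n * J - (3 * a + 16) * (n * J / z)))"
  \<comment> \<open>\<open>3 * a + 16\<close> is twice \<open>3 / 2 * a + 8\<close>. The surplus of
    \<open>4 * z\<close> over the exponent of \<open>x\<close> is at least 4 and gives the factor
    \<open>exp 4 \<ge> 16\<close>.\<close>
  have Xx: "16 * x \<le> X"
  proof -
    have "(3 / 2 * a + 4) * z + 4 * 1 \<le> (3 * a + 16) * (z / 2)" using z1 by (simp add: algebra_simps)
    also have "\<dots> \<le> (3 * a + 16) * (n * J / z)" using nJ a by (intro mult_left_mono) auto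
    finally have "exp (- (n * J) + (3 / 2 * a + 4) * z + 4) \<le> exp (- (n * J - (3 * a + 16) * (n * J / z)))" by simp
    then have "n * exp (- (n * J) + (3 / 2 * a + 4) * z + 4) \<le> X" unfolding X_def by (intro mult_left_mono) auto
    moreover have "n * exp (- (n * J) + (3 / 2 * a + 4) * z + 4) = x * exp 4" by (simp add: x_def exp_add)
    moreover have "x * 16 \<le> x * exp 4"
    proof (rule mult_left_mono)
      have "exp (4 :: real) = exp 1 ^ 4" using exp_of_nat_mult[of 4 "1 :: real"] by simp
      moreover have "(2 :: real) ^ 4 \<le> exp 1 ^ 4" using e1 by (intro power_mono) auto
      ultimately show "(16 :: real) \<le> exp 4" by simp
    qed (simp add: x_def)
    ultimately show ?thesis by simp
  qed
  have "(\<forall>Y\<in>sublevel_set n F \<sigma> (observed_mat n \<omega>).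
     entry_l1_norm n (Y - truth_mat n \<sigma>) / n \<le> of_int \<lfloor>n * exp (- ((1 - (3 * a + 16) * sqrt (1 / (n * I))) * m * I))\<rfloor> \<and>
     (\<forall>v. top_eigenvector Y v \<longrightarrow> err n (sign_vec v) \<sigma> \<le> exp (- ((1 - (3 * a + 20) * sqrt (1 / (n * I))) * m * I))))"
    if \<omega>: "\<omega> \<in> E\<^sub>1 \<inter> E\<^sub>2" for \<omega>
  proof (intro ballI conjI allI impI)
    fix Y assume Y: "Y \<in> sublevel_set n F \<sigma> (observed_mat n \<omega>)"
    have Yf: "Y \<in> sdp_feasible n" using Y F by (auto simp: sublevel_set_def)
    have "3 \<le> n * (I / 2)" using nI by simp
    also have "\<dots> \<le> n * J" using J by (intro mult_left_mono) auto
    finally have \<nu>: "3 \<le> n * J" .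
    have "\<omega> \<in> E\<^sub>1" using \<omega> by simp
    note det = sublevel_deterministic[OF n_pos label Y F E\<^sub>1(3)[OF this] \<nu>]
    define \<gamma> where "\<gamma> = entry_l1_norm n (Y - truth_mat n \<sigma>) / n"
    have \<gamma>0: "0 \<le> \<gamma>" using det(1) by (simp add: \<gamma>_def)
    have "\<gamma> \<le> of_int \<lfloor>X\<rfloor>"
    proof (cases "\<gamma> = 0")
      case True
      have "0 \<le> X" by (simp add: X_def)
      then show ?thesis using True by simp
    next
      case False
      define k where "k = max 1 (nat \<lfloor>\<gamma> / 4\<rfloor>)"
      have k1: "1 \<le> k" "real k - 1 \<le> \<gamma> / 4" "\<gamma> / 4 < real k + 1" using \<gamma>0 unfolding k_def by linarith+
      have "real k < x"
      proof (rule ccontr)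
        assume "\<not> real k < x"
        then have xk: "x \<le> k" by simp
        have "n * exp (- (n * J)) \<le> x" unfolding x_def using a z1 by (intro mult_left_mono) auto
        then have "n * exp (- (n * J)) \<le> k" using xk by simp
        then obtain S where S: "S \<subseteq> {..<n}" "card S = k"
          "(\<Sum>i\<in>S. \<Sum>j<n. obs \<omega> i j * (\<sigma> $ i * \<sigma> $ j)) \<le> \<theta> * k"
          using det(3)[of k] False unfolding \<gamma>_def k_def by blast
        have "S \<noteq> {}" using S k1 by auto
        have "\<gamma> / 4 \<le> a * n / (2 * z)"
        proof -
          have "c\<^sub>1 * \<gamma> * z \<le> 2 * \<theta> * z" using det(2) z1 by (intro mult_right_mono) (auto simp: \<gamma>_def)
          also have "\<dots> \<le> 2 * (a * n * c\<^sub>1)" using c\<^sub>1(2) by (simp add: z_def)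
          finally have "c\<^sub>1 * (\<gamma> * z) \<le> c\<^sub>1 * (2 * (a * n))" by (simp add: mult_ac)
          then have "\<gamma> * z \<le> 2 * (a * n)" using c\<^sub>1(1) by simp
          then show ?thesis using z1 by (simp add: field_simps)
        qed
        then have "real (card S) - 1 \<le> a * n / (2 * z)" using S(2) k1 by linarith
        from rows[OF _ S(1) \<open>S \<noteq> {}\<close> _ this, of \<omega>] show False using \<omega> xk S by auto
      qed
      \<comment> \<open>\<open>k \<ge> 1\<close> gives \<open>x > 1\<close>, so
        \<open>\<gamma> < 4 * (k + 1) < 8 * x \<le> X / 2\<close>; this gap of more than one puts
        \<gamma> below the integer part of \<open>X\<close>. For \<open>x \<le> 1\<close> only
        \<open>\<gamma> = 0\<close> is possible.\<close>
      then have "\<gamma> < 8 * x" "x > 1" using k1 by linarith+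
      then have "\<gamma> < X - 1" using Xx by linarith
      then show ?thesis by linarith
    qed
    then have "\<gamma> \<le> of_int \<lfloor>n * exp (- ((1 - (3 * a + 16) * sqrt (1 / (n * I))) * m * I))\<rfloor>"
      unfolding ex X_def .
    then show "entry_l1_norm n (Y - truth_mat n \<sigma>) / n \<le> of_int \<lfloor>n * exp (- ((1 - (3 * a + 16) * sqrt (1 / (n * I))) * m * I))\<rfloor>"
      by (simp add: \<gamma>_def)
    fix v assume "top_eigenvector Y v"
    then have "err n (sign_vec v) \<sigma> \<le> 4 * \<gamma> / n"
      using err_top_eigenvector_le[OF Yf n_pos label] by (simp add: \<gamma>_def)
    also have "\<dots> \<le> 4 * X / n"
    proof -
      have "\<gamma> \<le> X" using \<open>\<gamma> \<le> of_int \<lfloor>X\<rfloor>\<close> by linarith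
      then show ?thesis by (intro divide_right_mono mult_left_mono) auto
    qed
    also have "\<dots> = 4 * exp (- (n * J - (3 * a + 16) * (n * J / z)))" using n_pos by (simp add: X_def)
    \<comment> \<open>The factor 4 of the eigenvector bound moves into the exponent:
      \<open>4 \<le> exp 2\<close> and \<open>2 \<le> 4 * (n * J / z)\<close>, hence 20 in place of
      16.\<close>
    also have "\<dots> \<le> exp 2 * exp (- (n * J - (3 * a + 16) * (n * J / z)))"
    proof (rule mult_right_mono)
      have "exp (2 :: real) = exp 1 * exp 1" by (simp add: exp_add[symmetric])
      moreover have "(2 :: real) * 2 \<le> exp 1 * exp 1" using e1 by (intro mult_mono) auto
      ultimately show "(4 :: real) \<le> exp 2" by simp
    qed simp
    also have "\<dots> = exp (- (n * J) + ((3 * a + 16) * (n * J / z) + 2))" by (simp add: exp_add[symmetric] algebra_simps)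
    also have "\<dots> \<le> exp (- (n * J) + (3 * a + 20) * (n * J / z))"
    proof -
      define Q where "Q = n * J / z"
      have "2 \<le> 4 * Q" using nJ z1 unfolding Q_def by linarith
      moreover have "(3 * a + 20) * Q = (3 * a + 16) * Q + 4 * Q" by (simp add: algebra_simps)
      ultimately show ?thesis unfolding Q_def[symmetric] by simp
    qed
    also have "\<dots> = exp (- ((1 - (3 * a + 20) * sqrt (1 / (n * I))) * m * I))" unfolding ex by simp
    finally show "err n (sign_vec v) \<sigma> \<le> exp (- ((1 - (3 * a + 20) * sqrt (1 / (n * I))) * m * I))" .
  qed
  moreover have "E\<^sub>1 \<inter> E\<^sub>2 \<in> events" "1 - (9 * exp (- sqrt (ln n)) + exp (- sqrt (ln n))) \<le> prob (E\<^sub>1 \<inter> E\<^sub>2)"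
    using prob_Int_ge[OF E\<^sub>1(1) E\<^sub>2(1) E\<^sub>1(2) E\<^sub>2(2)] by auto
  ultimately show ?thesis unfolding sdp_error_bounds_def with_prob_at_least_def
    by (intro bexI[of _ "E\<^sub>1 \<inter> E\<^sub>2"]) auto
qed

lemma exp_sqrt_ln_bounds:
  assumes "1 \<le> ln n"
  shows "1 / n \<le> exp (- sqrt (ln n))" "exp (- real n) \<le> exp (- sqrt (ln n))"
proof -
  have "sqrt (ln n) * 1 \<le> sqrt (ln n) * sqrt (ln n)" using assms by (intro mult_left_mono) auto
  then have s: "sqrt (ln n) \<le> ln n" using assms by simp
  then have "exp (- ln n) \<le> exp (- sqrt (ln n))" by simp
  then show "1 / n \<le> exp (- sqrt (ln n))" using n_pos by (simp add: exp_minus inverse_eq_divide)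
  show "exp (- real n) \<le> exp (- sqrt (ln n))" using s ln_le_minus_one[of "real n"] n_pos by simp
qed

text \<open>Net vectors have entries at most \<open>2 * sqrt n\<close>, so with cut-off
  \<open>4 * n\<close> every pair is light, and a moment bound valid at all tilts lets the union
  bound over the net do all the work.\<close>

lemma subgaussian_form_event:
  fixes v \<nu> :: real and \<mu> :: "nat \<Rightarrow> nat \<Rightarrow> real"
  assumes v: "v > 0" and sym: "\<And>i j. \<mu> i j = \<mu> j i" and n1: "1 \<le> ln n"
    and mgf: "\<And>u i j. i \<le> j \<Longrightarrow> j < n \<Longrightarrow>
      (\<integral>\<^sup>+x. ennreal (exp (u * (x - \<mu> i j))) \<partial>D (\<sigma> $ i * \<sigma> $ j)) \<le> ennreal (exp (v * u\<^sup>2))"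
  shows "\<exists>E\<in>events. 1 - 9 * exp (- sqrt (ln n)) \<le> prob E \<and>
    (\<forall>\<omega>\<in>E. form_bound n (\<lambda>i j. obs \<omega> i j - \<mu> i j) \<nu> (42 * sqrt (n * v)))"
proof -
  have "\<exists>E\<in>events. 1 - exp (- real n) \<le> prob E \<and> (\<forall>\<omega>\<in>E. \<forall>\<xi>\<in>int_net n. \<forall>\<eta>\<in>int_net n.
    light_sum n (4 * real n) (\<lambda>i j. obs \<omega> i j - \<mu> i j) \<xi> \<eta> \<le> 42 * sqrt (n * v) * n)"
    by (rule light_sums_bounded[OF v _ sym]) (use mgf in auto)
  then obtain E where E: "E \<in> events" "1 - exp (- real n) \<le> prob E"
    and L: "\<And>\<omega> \<xi> \<eta>. \<omega> \<in> E \<Longrightarrow> \<xi> \<in> int_net n \<Longrightarrow> \<eta> \<in> int_net n \<Longrightarrow>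
      light_sum n (4 * real n) (\<lambda>i j. obs \<omega> i j - \<mu> i j) \<xi> \<eta> \<le> 42 * sqrt (n * v) * n" by blast
  have "1 - 9 * exp (- sqrt (ln n)) \<le> prob E"
  proof -
    have "0 \<le> exp (- sqrt (ln n))" by simp
    then show ?thesis using E(2) exp_sqrt_ln_bounds(2)[OF n1] by linarith
  qed
  moreover have "form_bound n (\<lambda>i j. obs \<omega> i j - \<mu> i j) \<nu> (42 * sqrt (n * v))" if "\<omega> \<in> E" for \<omega>
    unfolding form_bound_def
  proof (intro allI impI)
    fix x :: "nat \<Rightarrow> nat \<Rightarrow> real"
    define w where "w = (\<lambda>i j. obs \<omega> i j - \<mu> i j)"
    have net: "bilin n w (\<lambda>i. \<xi> i) (\<lambda>i. \<eta> i) \<le> 42 * sqrt (n * v) * n" if \<xi>: "\<xi> \<in> int_net n" and \<eta>: "\<eta> \<in> int_net n" for \<xi> \<eta>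
    proof -
      have small: "\<bar>real_of_int (\<zeta> i)\<bar> \<le> 2 * sqrt n" if "\<zeta> \<in> int_net n" "i < n" for \<zeta> i
      proof -
        have "(real_of_int (\<zeta> i))\<^sup>2 \<le> (\<Sum>i<n. (real_of_int (\<zeta> i))\<^sup>2)" using that(2) by (intro member_le_sum) auto
        also have "\<dots> \<le> (2 * sqrt n)\<^sup>2" using int_net_sq[OF that(1)] by (simp add: power_mult_distrib)
        finally have "\<bar>real_of_int (\<zeta> i)\<bar> \<le> \<bar>2 * sqrt n\<bar>" by (simp only: abs_le_square_iff)
        then show ?thesis by simp
      qed
      have "\<bar>real_of_int (\<xi> i * \<eta> j)\<bar> \<le> 4 * real n" if "i < n" "j < n" for i j
      proof -
        have "\<bar>real_of_int (\<xi> i)\<bar> * \<bar>real_of_int (\<eta> j)\<bar> \<le> (2 * sqrt n) * (2 * sqrt n)"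
          using small[OF \<xi> that(1)] small[OF \<eta> that(2)] by (intro mult_mono) auto
        then show ?thesis by (simp add: abs_mult)
      qed
      then have "light_sum n (4 * real n) w \<xi> \<eta> = bilin n w (\<lambda>i. \<xi> i) (\<lambda>i. \<eta> i)"
        unfolding light_sum_def bilin_def by (intro sum.cong refl) auto
      then show ?thesis using L[OF \<open>\<omega> \<in> E\<close> \<xi> \<eta>] by (simp add: w_def)
    qed
    have q: "\<bar>bilin n w (x k) (x k)\<bar> \<le> 42 * sqrt (n * v) * (\<Sum>i<n. (x k i)\<^sup>2)" for k
      by (rule quadratic_form_le_of_int_net[OF n_pos, of "{}"]) (use net in auto)
    have "\<bar>\<Sum>k<n. bilin n w (x k) (x k)\<bar> \<le> (\<Sum>k<n. \<bar>bilin n w (x k) (x k)\<bar>)" by (rule sum_abs)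
    also have "\<dots> \<le> (\<Sum>k<n. 42 * sqrt (n * v) * (\<Sum>i<n. (x k i)\<^sup>2))" by (intro sum_mono q)
    also have "\<dots> = 42 * sqrt (n * v) * (\<Sum>k<n. \<Sum>i<n. (x k i)\<^sup>2)" by (simp only: sum_distrib_left)
    also have "(\<Sum>k<n. \<Sum>i<n. (x k i)\<^sup>2) = (\<Sum>i<n. \<Sum>k<n. (x k i)\<^sup>2)" by (rule sum.swap)
    finally show "\<bar>\<Sum>k<n. bilin n (\<lambda>i j. obs \<omega> i j - \<mu> i j) (x k) (x k)\<bar> \<le> 42 * sqrt (n * v) * (\<Sum>i<n. \<Sum>k<n. (x k i)\<^sup>2)"
      by (simp add: w_def)
  qed
  ultimately show ?thesis using E(1) by blast
qed

text \<open>With degree scale \<open>d = n * \<alpha>\<close> the cut-off \<open>sqrt d\<close>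
  corresponds exactly to tilts of size at most one, the range of the quadratic moment bound. The
  three events fail with total probability at most \<open>exp (- n) + 2 / n\<close>.\<close>

lemma sparse_form_event:
  fixes \<alpha> B \<nu> :: real and \<mu> :: "nat \<Rightarrow> nat \<Rightarrow> real"
  assumes \<alpha>: "1 \<le> n * \<alpha>" and B: "0 \<le> B" "0 \<le> \<nu>" "\<nu> \<le> B * (n * \<alpha>)" and n1: "1 \<le> ln n"
    and sym: "\<And>i j. \<mu> i j = \<mu> j i" and \<mu>: "\<And>i j. i < n \<Longrightarrow> j < n \<Longrightarrow> \<bar>\<mu> i j\<bar> \<le> \<alpha>"
    and mgf: "\<And>u i j. i \<le> j \<Longrightarrow> j < n \<Longrightarrow> \<bar>u\<bar> \<le> 1 \<Longrightarrow>
      (\<integral>\<^sup>+x. ennreal (exp (u * (x - \<mu> i j))) \<partial>D (\<sigma> $ i * \<sigma> $ j)) \<le> ennreal (exp (\<alpha> * u\<^sup>2))"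
    and amgf: "abs_mgf_le \<alpha>"
  shows "\<exists>E\<in>events. 1 - 9 * exp (- sqrt (ln n)) \<le> prob E \<and>
    (\<forall>\<omega>\<in>E. form_bound n (\<lambda>i j. obs \<omega> i j - \<mu> i j) \<nu> ((394 + heavy_const + 72 * B) * sqrt (n * \<alpha>)))"
proof -
  have "0 < n * \<alpha>" using \<alpha> by linarith
  then have \<alpha>0: "\<alpha> > 0" using n_pos by (simp add: zero_less_mult_iff)
  define d where "d = n * \<alpha>"
  have dn: "d / n = \<alpha>" using n_pos by (simp add: d_def)
  have sd: "sqrt d / sqrt (n * \<alpha>) = 1" using \<alpha>0 n_pos by (simp add: d_def)
  have "\<exists>E\<in>events. 1 - exp (- real n) \<le> prob E \<and> (\<forall>\<omega>\<in>E. \<forall>\<xi>\<in>int_net n. \<forall>\<eta>\<in>int_net n.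
    light_sum n (sqrt d) (\<lambda>i j. obs \<omega> i j - \<mu> i j) \<xi> \<eta> \<le> 42 * sqrt (n * \<alpha>) * n)"
    by (rule light_sums_bounded[OF \<alpha>0 _ sym]) (use mgf \<alpha> \<alpha>0 in \<open>auto simp: sd d_def\<close>)
  then obtain E\<^sub>1 where E\<^sub>1: "E\<^sub>1 \<in> events" "1 - exp (- real n) \<le> prob E\<^sub>1"
    and L: "\<And>\<omega> \<xi> \<eta>. \<omega> \<in> E\<^sub>1 \<Longrightarrow> \<xi> \<in> int_net n \<Longrightarrow> \<eta> \<in> int_net n \<Longrightarrow>
      light_sum n (sqrt d) (\<lambda>i j. obs \<omega> i j - \<mu> i j) \<xi> \<eta> \<le> 42 * sqrt (n * \<alpha>) * n" by blast
  obtain E\<^sub>2 where E\<^sub>2: "E\<^sub>2 \<in> events" "1 - 1 / n \<le> prob E\<^sub>2"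
    and disc: "\<forall>\<omega>\<in>E\<^sub>2. \<forall>S T r. S \<subseteq> {..<n} \<longrightarrow> T \<subseteq> {..<n} \<longrightarrow> S \<noteq> {} \<longrightarrow> T \<noteq> {} \<longrightarrow> r \<in> {1..8 * n + 4} \<longrightarrow>
      real r / 2 * edge_mass (\<lambda>i j. \<bar>obs \<omega> i j\<bar>) S T \<le> \<alpha> * card S * card T * exp r
        + 6 * (entropy_bound n (card S) + entropy_bound n (card T))"
    using discrepancy_event[OF less_imp_le[OF \<alpha>0] amgf] by (elim bexE conjE) (rule that)
  obtain E\<^sub>3 where E\<^sub>3: "E\<^sub>3 \<in> events" "1 - 1 / n \<le> prob E\<^sub>3"
    and deg: "\<forall>\<omega>\<in>E\<^sub>3. \<forall>S. S \<subseteq> {..<n} \<longrightarrow> S \<noteq> {} \<longrightarrow>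
      edge_mass (\<lambda>i j. \<bar>obs \<omega> i j\<bar>) S {..<n} \<le> 6 * (n * \<alpha>) * card S + 8 * entropy_bound n (card S)"
    using degree_event[OF less_imp_le[OF \<alpha>0] amgf] by (elim bexE conjE) (rule that)
  note I12 = prob_Int_ge[OF E\<^sub>1(1) E\<^sub>2(1) E\<^sub>1(2) E\<^sub>2(2)]
  note I123 = prob_Int_ge[OF I12(1) E\<^sub>3(1) I12(2) E\<^sub>3(2)]
  have "1 - 9 * exp (- sqrt (ln n)) \<le> prob (E\<^sub>1 \<inter> E\<^sub>2 \<inter> E\<^sub>3)"
  proof -
    have "0 \<le> exp (- sqrt (ln n))" by simp
    then show ?thesis using I123(2) exp_sqrt_ln_bounds[OF n1] by linarith
  qed
  moreover have "form_bound n (\<lambda>i j. obs \<omega> i j - \<mu> i j) \<nu> ((394 + heavy_const + 72 * B) * sqrt d)"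
    if \<omega>: "\<omega> \<in> E\<^sub>1 \<inter> E\<^sub>2 \<inter> E\<^sub>3" for \<omega>
  proof -
    interpret sparse_instance n "\<lambda>i j. \<bar>obs \<omega> i j\<bar>" "\<lambda>i j. obs \<omega> i j - \<mu> i j" d B \<nu>
    proof
      show "\<bar>obs \<omega> i j - \<mu> i j\<bar> \<le> \<bar>obs \<omega> i j\<bar> + d / n" if "i < n" "j < n" for i j
        using \<mu>[OF that] unfolding dn by linarith
      show "real r / 2 * edge_mass (\<lambda>i j. \<bar>obs \<omega> i j\<bar>) S T \<le> d / n * card S * card T * exp r
        + 6 * (entropy_bound n (card S) + entropy_bound n (card T))"
        if "S \<subseteq> {..<n}" "T \<subseteq> {..<n}" "S \<noteq> {}" "T \<noteq> {}" "r \<in> {1..8 * n + 4}" for S T r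
        unfolding dn using disc[rule_format, of \<omega> S T r] that \<omega> by simp
      show "edge_mass (\<lambda>i j. \<bar>obs \<omega> i j\<bar>) S {..<n} \<le> 6 * d * card S + 8 * entropy_bound n (card S)"
        if "S \<subseteq> {..<n}" "S \<noteq> {}" for S
        unfolding d_def using deg[rule_format, of \<omega> S] that \<omega> by simp
      show "light_sum n (sqrt d) (\<lambda>i j. obs \<omega> i j - \<mu> i j) \<xi> \<eta> \<le> 42 * sqrt d * n"
        if "\<xi> \<in> int_net n" "\<eta> \<in> int_net n" for \<xi> \<eta>
        using L[of \<omega> \<xi> \<eta>] that \<omega> by (simp add: d_def)
      show "\<bar>obs \<omega> i j\<bar> = \<bar>obs \<omega> j i\<bar>" for i j by (simp add: obs_sym[of \<omega> i j])
    qed (use n_pos \<alpha> B in \<open>auto simp: d_def\<close>)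
    show ?thesis by (rule form_bound_sparse)
  qed
  ultimately show ?thesis using I123(1) unfolding d_def by blast
qed

end

section \<open>Elementary bounds for the entry laws\<close>

lemma label_prod:
  assumes "label_vec n \<sigma>" "i < n" "j < n"
  shows "\<sigma> $ i * \<sigma> $ j = 1 \<or> \<sigma> $ i * \<sigma> $ j = -1"
proof -
  have "\<sigma> $ i = 1 \<or> \<sigma> $ i = -1" "\<sigma> $ j = 1 \<or> \<sigma> $ j = -1" using assms by (auto simp: label_vec_def)
  then show ?thesis by auto
qed

text \<open>For \<open>y = - w\<close> negative, combine the Taylor lower bound for
  \<open>exp w\<close> with \<open>(1 - w + w^2) * (1 + w + w^2 / 2) \<ge> 1\<close>.\<close>

lemma exp_le_quadratic:
  fixes y :: real
  assumes "\<bar>y\<bar> \<le> 1"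
  shows "exp y \<le> 1 + y + y\<^sup>2"
proof (cases "y \<ge> 0")
  case True
  then show ?thesis using exp_bound[of y] assms by simp
next
  case False
  define w where "w = - y"
  have w: "w \<ge> 0" using False by (simp add: w_def)
  have "1 + w + w\<^sup>2 / 2 \<le> exp w" using exp_lower_Taylor_quadratic[OF w] .
  moreover have "0 \<le> 1 - w + w\<^sup>2" using assms w by (simp add: w_def)
  ultimately have "(1 - w + w\<^sup>2) * (1 + w + w\<^sup>2 / 2) \<le> (1 - w + w\<^sup>2) * exp w" by (intro mult_left_mono)
  moreover have "(1 - w + w\<^sup>2) * (1 + w + w\<^sup>2 / 2) = 1 + (w\<^sup>2 / 2 + w ^ 3 / 2 + w ^ 4 / 2)"
    by (simp add: field_simps eval_nat_numeral)
  moreover have "0 \<le> w\<^sup>2 / 2 + w ^ 3 / 2 + w ^ 4 / 2" using w by simp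
  ultimately have "1 \<le> (1 - w + w\<^sup>2) * exp w" by linarith
  then have "exp (- w) \<le> 1 - w + w\<^sup>2" by (simp add: exp_minus divide_simps)
  then show ?thesis by (simp add: w_def)
qed

lemma prob_space_borel_of_pmf: "prob_space (borel_of_pmf P)"
  unfolding borel_of_pmf_def by (rule measure_pmf.prob_space_distr) simp

lemma sets_borel_of_pmf: "sets (borel_of_pmf P) = sets borel"
  by (simp add: borel_of_pmf_def)

lemma nn_integral_borel_of_pmf:
  assumes "f \<in> borel_measurable borel"
  shows "(\<integral>\<^sup>+x. ennreal (f x) \<partial>borel_of_pmf P) = (\<integral>\<^sup>+x. ennreal (f x) \<partial>measure_pmf P)"
  unfolding borel_of_pmf_def by (rule nn_integral_distr) (use assms in auto)

section \<open>Gaussian synchronization\<close>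

text \<open>Completing the square turns the tilted density into a multiple of a shifted normal
  density.\<close>

lemma sync_entry_mgf:
  assumes "\<tau> > 0"
  shows "(\<integral>\<^sup>+x. ennreal (exp (u * x)) \<partial>sync_entry \<tau> s) = ennreal (exp (u * s + u\<^sup>2 * \<tau>\<^sup>2 / 2))"
proof -
  have pt: "normal_density s \<tau> x * exp (u * x) = exp (u * s + u\<^sup>2 * \<tau>\<^sup>2 / 2) * normal_density (s + u * \<tau>\<^sup>2) \<tau> x" for x
  proof -
    have "- (x - s)\<^sup>2 / (2 * \<tau>\<^sup>2) + u * x = (u * s + u\<^sup>2 * \<tau>\<^sup>2 / 2) + - (x - (s + u * \<tau>\<^sup>2))\<^sup>2 / (2 * \<tau>\<^sup>2)"
      using assms by (simp add: field_simps power2_eq_square)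
    then show ?thesis unfolding normal_density_def by (simp add: exp_add[symmetric])
  qed
  have one: "(\<integral>\<^sup>+x. ennreal (normal_density m \<tau> x) \<partial>lborel) = 1" for m
  proof -
    interpret prob_space "density lborel (normal_density m \<tau>)" by (rule prob_space_normal_density[OF assms])
    show ?thesis using emeasure_space_1 by (simp add: emeasure_density)
  qed
  have "(\<integral>\<^sup>+x. ennreal (exp (u * x)) \<partial>sync_entry \<tau> s) = (\<integral>\<^sup>+x. ennreal (normal_density s \<tau> x) * ennreal (exp (u * x)) \<partial>lborel)"
    unfolding sync_entry_def by (rule nn_integral_density) auto
  also have "\<dots> = (\<integral>\<^sup>+x. ennreal (exp (u * s + u\<^sup>2 * \<tau>\<^sup>2 / 2)) * ennreal (normal_density (s + u * \<tau>\<^sup>2) \<tau> x) \<partial>lborel)"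
    by (intro nn_integral_cong) (simp add: ennreal_mult[symmetric] pt)
  also have "\<dots> = ennreal (exp (u * s + u\<^sup>2 * \<tau>\<^sup>2 / 2))" by (simp add: nn_integral_cmult one)
  finally show ?thesis .
qed

lemma sync_bounds:
  assumes n: "1 \<le> n" and \<sigma>: "label_vec n \<sigma>" and \<tau>: "\<tau> > 0" and nI: "6 \<le> n * sync_info \<tau>" and a: "84 \<le> a"
  shows "sdp_error_bounds n (sync_entry \<tau>) (sdp_feasible n) \<sigma> (sync_info \<tau>) n (3 * a + 16) (3 * a + 20)"
proof -
  interpret entry_model n "sync_entry \<tau>" \<sigma>
  proof (intro entry_model.intro)
    show "prob_space (sync_entry \<tau> s)" for s
      unfolding sync_entry_def by (rule prob_space_normal_density[OF \<tau>])
    show "sets (sync_entry \<tau> s) = sets borel" for s by (simp add: sync_entry_def)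
  qed (use n \<sigma> in auto)
  show ?thesis
  proof (cases "ln n < 1")
    case True
    then show ?thesis by (rule sdp_error_bounds_of_small_n)
  next
    case False
    \<comment> \<open>The optimal tilt: the exponent \<open>- t + t^2 * \<tau>^2 / 2\<close> has its
      minimum \<open>- sync_info \<tau>\<close> here and returns to zero at twice this
      value.\<close>
    define t where "t = 1 / \<tau>\<^sup>2"
    have t: "t > 0" "t * \<tau>\<^sup>2 = 1" using \<tau> by (auto simp: t_def)
    have I: "sync_info \<tau> = t / 2" by (simp add: sync_info_def t_def)
    have I0: "0 < sync_info \<tau>" unfolding I using t by simp
    have s2: "(\<sigma> $ i * \<sigma> $ j) * (\<sigma> $ i * \<sigma> $ j) = 1" if "i \<le> j" "j < n" for i j
      using label_prod[OF \<sigma>, of i j] that by auto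
    define \<theta> where "\<theta> = 42 * sqrt (n * \<tau>\<^sup>2)"
    have sq: "sqrt (n * \<tau>\<^sup>2) * sqrt (n * (t / 2)) \<le> n"
    proof -
      have "sqrt (n * \<tau>\<^sup>2) * sqrt (n * (t / 2)) = sqrt (n * n * (t * \<tau>\<^sup>2) / 2)"
        unfolding real_sqrt_mult[symmetric] by (simp add: mult_ac)
      also have "\<dots> \<le> sqrt (real n * real n)" unfolding t(2) by (rule real_sqrt_le_mono) simp
      finally show ?thesis by simp
    qed
    show ?thesis
    proof (rule sdp_error_bounds_of_form_event[where t = t and \<kappa> = 0 and J = "sync_info \<tau>" and c\<^sub>1 = 1 and c\<^sub>2 = 0 and \<theta> = \<theta>])
      fix i j assume ij: "i \<le> j" "j < n"
      define s where "s = \<sigma> $ i * \<sigma> $ j"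
      have "(- t * s) * s + (- t * s)\<^sup>2 * \<tau>\<^sup>2 / 2 = - t * (s * s) + (s * s) * t * (t * \<tau>\<^sup>2) / 2"
        by (simp add: power2_eq_square)
      also have "\<dots> = s * 0 - sync_info \<tau>" using s2[OF ij] unfolding t(2) I by (simp add: s_def)
      finally have e: "(- t * s) * s + (- t * s)\<^sup>2 * \<tau>\<^sup>2 / 2 = s * 0 - sync_info \<tau>" .
      show "(\<integral>\<^sup>+x. ennreal (exp (- t * (\<sigma> $ i * \<sigma> $ j) * x)) \<partial>sync_entry \<tau> (\<sigma> $ i * \<sigma> $ j)) \<le> ennreal (exp (\<sigma> $ i * \<sigma> $ j * 0 - sync_info \<tau>))"
        unfolding s_def[symmetric] sync_entry_mgf[OF \<tau>] e by simp
    next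
      fix i j assume ij: "i < j" "j < n"
      define s where "s = \<sigma> $ i * \<sigma> $ j"
      have "(- (2 * t) * s) * s + (- (2 * t) * s)\<^sup>2 * \<tau>\<^sup>2 / 2 = - (2 * t) * (s * s) + (s * s) * (2 * t) * (t * \<tau>\<^sup>2)"
        by (simp add: power2_eq_square)
      also have "\<dots> = 2 * (s * 0)" unfolding t(2) by simp
      finally have e: "(- (2 * t) * s) * s + (- (2 * t) * s)\<^sup>2 * \<tau>\<^sup>2 / 2 = 2 * (s * 0)" .
      show "(\<integral>\<^sup>+x. ennreal (exp (- (2 * t) * (\<sigma> $ i * \<sigma> $ j) * x)) \<partial>sync_entry \<tau> (\<sigma> $ i * \<sigma> $ j)) \<le> ennreal (exp (2 * (\<sigma> $ i * \<sigma> $ j * 0)))"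
        unfolding s_def[symmetric] sync_entry_mgf[OF \<tau>] e by simp
    next
      show "\<theta> * sqrt (n * sync_info \<tau>) \<le> a * n * 1"
      proof -
        have "42 * (sqrt (n * \<tau>\<^sup>2) * sqrt (n * (t / 2))) \<le> a * n"
          using sq a t by (intro mult_mono mult_nonneg_nonneg) auto
        then show ?thesis by (simp add: \<theta>_def I mult.assoc)
      qed
      show "t * \<theta> \<le> a * sqrt (n * sync_info \<tau>)"
      proof -
        have "t * \<theta> = 42 * sqrt (n * t)"
        proof -
          have "(t * sqrt (n * \<tau>\<^sup>2))\<^sup>2 = n * t * (t * \<tau>\<^sup>2)" by (simp add: power_mult_distrib power2_eq_square)
          then have "t * sqrt (n * \<tau>\<^sup>2) = sqrt (n * t)" unfolding t(2) using t by (intro real_sqrt_unique[symmetric]) auto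
          then show ?thesis by (simp add: \<theta>_def)
        qed
        \<comment> \<open>The factor \<open>sqrt 2\<close> between \<open>sqrt (n * t)\<close> and
          \<open>sqrt (n * I)\<close> is rounded up to 2, hence \<open>84 = 2 * 42\<close>.\<close>
        also have "sqrt (n * t) \<le> 2 * sqrt (n * (t / 2))"
        proof -
          have "sqrt (n * t) \<le> sqrt (4 * (n * (t / 2)))" using t by simp
          then show ?thesis unfolding real_sqrt_mult[of 4] by simp
        qed
        then have "42 * sqrt (n * t) \<le> 84 * sqrt (n * (t / 2))" by simp
        also have "\<dots> \<le> a * sqrt (n * (t / 2))" using a t by (intro mult_right_mono) auto
        finally show ?thesis by (simp add: I)
      qed
      have "\<exists>E\<in>events. 1 - 9 * exp (- sqrt (ln n)) \<le> prob E \<and>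
        (\<forall>\<omega>\<in>E. form_bound n (\<lambda>i j. obs \<omega> i j - (\<sigma> $ i * \<sigma> $ j)) (n * sync_info \<tau>) (42 * sqrt (n * \<tau>\<^sup>2)))"
      proof (rule subgaussian_form_event)
        fix u :: real and i j :: nat
        define s where "s = \<sigma> $ i * \<sigma> $ j"
        have "(\<integral>\<^sup>+x. ennreal (exp (u * (x - s))) \<partial>sync_entry \<tau> s) = (\<integral>\<^sup>+x. ennreal (exp (- (u * s))) * ennreal (exp (u * x)) \<partial>sync_entry \<tau> s)"
          by (intro nn_integral_cong) (simp add: ennreal_mult[symmetric] exp_add[symmetric] algebra_simps)
        also have "\<dots> = ennreal (exp (- (u * s))) * (\<integral>\<^sup>+x. ennreal (exp (u * x)) \<partial>sync_entry \<tau> s)"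
          by (rule nn_integral_cmult) (simp add: sync_entry_def)
        also have "\<dots> = ennreal (exp (u\<^sup>2 * \<tau>\<^sup>2 / 2))"
          unfolding sync_entry_mgf[OF \<tau>] by (simp add: ennreal_mult[symmetric] exp_add[symmetric])
        also have "\<dots> \<le> ennreal (exp (\<tau>\<^sup>2 * u\<^sup>2))" by (intro ennreal_leI) (simp add: mult.commute)
        finally show "(\<integral>\<^sup>+x. ennreal (exp (u * (x - \<sigma> $ i * \<sigma> $ j))) \<partial>sync_entry \<tau> (\<sigma> $ i * \<sigma> $ j)) \<le> ennreal (exp (\<tau>\<^sup>2 * u\<^sup>2))"
          by (simp add: s_def)
      qed (use \<tau> False in \<open>auto simp: mult.commute\<close>)
      then show "\<exists>E\<in>events. 1 - 9 * exp (- sqrt (ln n)) \<le> prob E \<and>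
        (\<forall>\<omega>\<in>E. form_bound n (\<lambda>i j. obs \<omega> i j - (1 * (\<sigma> $ i * \<sigma> $ j) + 0)) (n * sync_info \<tau>) \<theta>)"
        by (simp add: \<theta>_def)
    qed (use t nI a I0 in auto)
  qed
qed

section \<open>The censored block model\<close>

lemma censored_entry_nn_integral:
  assumes "0 < \<alpha>" "\<alpha> \<le> 1" "0 < \<epsilon>" "\<epsilon> < 1 / 2" and s: "s = 1 \<or> s = -1"
    and f: "f \<in> borel_measurable borel" "\<And>x. 0 \<le> f x"
  shows "(\<integral>\<^sup>+x. ennreal (f x) \<partial>censored_entry \<alpha> \<epsilon> s) = ennreal (\<alpha> * (1 - \<epsilon>) * f s + \<alpha> * \<epsilon> * f (- s) + (1 - \<alpha>) * f 0)"
proof -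
  define xs where "xs = [(s, \<alpha> * (1 - \<epsilon>)), (- s, \<alpha> * \<epsilon>), (0, 1 - \<alpha>)]"
  have wf: "pmf_of_list_wf xs" unfolding xs_def by (rule censored_entry_wf[OF assms(1-4)])
  have "set_pmf (pmf_of_list xs) \<subseteq> {s, - s, 0}" using set_pmf_of_list[OF wf] by (auto simp: xs_def)
  then have "(\<integral>\<^sup>+x. ennreal (f x) \<partial>measure_pmf (pmf_of_list xs)) = (\<Sum>x\<in>{s, - s, 0}. ennreal (f x) * pmf (pmf_of_list xs) x)"
    by (intro nn_integral_measure_pmf_support) auto
  also have "\<dots> = ennreal (\<alpha> * (1 - \<epsilon>) * f s + \<alpha> * \<epsilon> * f (- s) + (1 - \<alpha>) * f 0)"
  proof -
    have ne: "s \<noteq> - s" "s \<noteq> 0" using s by auto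
    have p: "pmf (pmf_of_list xs) s = \<alpha> * (1 - \<epsilon>)" "pmf (pmf_of_list xs) (- s) = \<alpha> * \<epsilon>" "pmf (pmf_of_list xs) 0 = 1 - \<alpha>"
      unfolding pmf_pmf_of_list[OF wf] using s by (auto simp: xs_def)
    show ?thesis using ne assms f(2)
      by (simp add: p ennreal_mult[symmetric] ennreal_plus[symmetric] mult_ac add_ac del: ennreal_plus)
  qed
  finally show ?thesis unfolding censored_entry_def nn_integral_borel_of_pmf[OF f(1)] xs_def .
qed

lemma censored_bounds:
  assumes \<epsilon>: "0 < \<epsilon>" "\<epsilon> < 1 / 2"
  shows "\<exists>a\<ge>0. \<forall>n \<sigma> \<alpha>. 1 \<le> n \<and> label_vec n \<sigma> \<and> 0 < \<alpha> \<and> \<alpha> \<le> 1 \<and> 6 \<le> real n * censored_info \<alpha> \<epsilon> \<longrightarrow>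
    sdp_error_bounds n (censored_entry \<alpha> \<epsilon>) (sdp_feasible n) \<sigma> (censored_info \<alpha> \<epsilon>) n (3 * a + 16) (3 * a + 20)"
proof -
  define \<eta> where "\<eta> = (sqrt (1 - \<epsilon>) - sqrt \<epsilon>)\<^sup>2"
  have lt: "sqrt \<epsilon> < sqrt (1 - \<epsilon>)" using \<epsilon> by simp
  have \<eta>0: "\<eta> > 0" using lt by (simp add: \<eta>_def)
  define h where "h = sqrt (\<epsilon> * (1 - \<epsilon>))"
  have \<eta>h: "\<eta> = 1 - 2 * h" using \<epsilon> by (simp add: \<eta>_def h_def power2_diff real_sqrt_mult)
  have h0: "h \<ge> 0" using \<epsilon> by (simp add: h_def)
  \<comment> \<open>At \<open>t = ln \<rho>\<close> both terms of
    \<open>(1 - \<epsilon>) * exp (- t) + \<epsilon> * exp t\<close> equal \<open>h\<close>; this is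
    the minimum, with value \<open>2 * h = 1 - \<eta>\<close>. At \<open>2 * t\<close> the two
    probabilities change places and the moment is one.\<close>
  define \<rho> where "\<rho> = sqrt ((1 - \<epsilon>) / \<epsilon>)"
  have r1: "(1 - \<epsilon>) / \<epsilon> > 1" using \<epsilon> by (simp add: less_divide_eq)
  have \<rho>: "\<rho> > 1" "\<rho>\<^sup>2 = (1 - \<epsilon>) / \<epsilon>" using r1 by (auto simp: \<rho>_def)
  have hr: "\<epsilon> * \<rho> = h" "(1 - \<epsilon>) / \<rho> = h"
  proof -
    have "(\<epsilon> * \<rho>)\<^sup>2 = \<epsilon> * (1 - \<epsilon>)"
      unfolding power_mult_distrib \<rho>(2) using \<epsilon> by (simp add: power2_eq_square)
    then show 1: "\<epsilon> * \<rho> = h" unfolding h_def using \<epsilon> \<rho> by (intro real_sqrt_unique[symmetric]) auto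
    have "\<epsilon> * \<rho> * \<rho> = \<epsilon> * \<rho>\<^sup>2" by (simp add: power2_eq_square)
    then have "1 - \<epsilon> = \<epsilon> * \<rho> * \<rho>" unfolding \<rho>(2) using \<epsilon> by simp
    then show "(1 - \<epsilon>) / \<rho> = h" using 1 \<rho>(1) by simp
  qed
  define t where "t = ln \<rho>"
  have t: "t > 0" "exp t = \<rho>" using \<rho>(1) by (auto simp: t_def)
  \<comment> \<open>The last factor is \<open>B = 1\<close>: the information is at most \<alpha>, so
    \<open>\<nu> = n * I\<close> is at most \<open>n * \<alpha>\<close>.\<close>
  define Cs where "Cs = 394 + heavy_const + 72 * 1"
  have Cs: "Cs \<ge> 0" by (simp add: Cs_def heavy_const_def)
  \<comment> \<open>The summands bound \<open>t * \<theta>\<close> against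
    \<open>sqrt (n * I)\<close> and \<theta> against the signal
    \<open>\<alpha> * (1 - 2 * \<epsilon>)\<close>. As \<open>I = \<alpha> * \<eta>\<close>, neither
    depends on \<open>n\<close> or \<alpha>.\<close>
  define a where "a = t * Cs / sqrt \<eta> + Cs * sqrt \<eta> / (1 - 2 * \<epsilon>)"
  have a0: "a \<ge> 0" using t Cs \<eta>0 \<epsilon> by (simp add: a_def)
  have "sdp_error_bounds n (censored_entry \<alpha> \<epsilon>) (sdp_feasible n) \<sigma> (censored_info \<alpha> \<epsilon>) n (3 * a + 16) (3 * a + 20)"
    if n: "1 \<le> n" and \<sigma>: "label_vec n \<sigma>" and \<alpha>: "0 < \<alpha>" "\<alpha> \<le> 1" and nI: "6 \<le> real n * censored_info \<alpha> \<epsilon>" for n \<sigma> \<alpha>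
  proof -
    interpret entry_model n "censored_entry \<alpha> \<epsilon>" \<sigma>
    proof (intro entry_model.intro)
      show "prob_space (censored_entry \<alpha> \<epsilon> s)" for s unfolding censored_entry_def by (rule prob_space_borel_of_pmf)
      show "sets (censored_entry \<alpha> \<epsilon> s) = sets borel" for s unfolding censored_entry_def by (rule sets_borel_of_pmf)
    qed (use n \<sigma> in auto)
    note nn = censored_entry_nn_integral[OF \<alpha> \<epsilon>]
    define I where "I = censored_info \<alpha> \<epsilon>"
    have I: "I = \<alpha> * \<eta>"
    proof -
      have "sqrt (\<alpha> * (1 - \<epsilon>)) - sqrt (\<alpha> * \<epsilon>) = sqrt \<alpha> * (sqrt (1 - \<epsilon>) - sqrt \<epsilon>)"
        unfolding real_sqrt_mult by (simp only: right_diff_distrib)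
      then show ?thesis using \<alpha> by (simp add: I_def censored_info_def \<eta>_def power_mult_distrib)
    qed
    have "I \<le> \<alpha> * 1" unfolding I using \<alpha> \<eta>h h0 by (intro mult_left_mono) auto
    then have nI\<alpha>: "n * I \<le> n * \<alpha>" by (intro mult_left_mono) auto
    have I0: "I \<ge> 0" using I \<alpha> \<eta>0 by simp
    define c where "c = \<alpha> * (1 - 2 * \<epsilon>)"
    have c: "0 < c" "c \<le> \<alpha>" using \<alpha> \<epsilon> by (auto simp: c_def mult_le_cancel_left1)
    show ?thesis
    proof (cases "ln n < 1")
      case True
      then show ?thesis by (rule sdp_error_bounds_of_small_n)
    next
      case False
      show ?thesis
      proof (rule sdp_error_bounds_of_form_event[where t = t and \<kappa> = 0 and J = "censored_info \<alpha> \<epsilon>" and c\<^sub>1 = c and c\<^sub>2 = 0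
          and \<theta> = "Cs * sqrt (n * \<alpha>)"], unfold I_def[symmetric])
        fix i j assume ij: "i \<le> j" "j < n"
        define s where "s = \<sigma> $ i * \<sigma> $ j"
        have s: "s = 1 \<or> s = -1" using label_prod[OF \<sigma>, of i j] ij by (simp add: s_def)
        then have ss: "s * s = 1" by auto
        have "(\<integral>\<^sup>+x. ennreal (exp (- t * s * x)) \<partial>censored_entry \<alpha> \<epsilon> s)
          = ennreal (\<alpha> * (1 - \<epsilon>) * exp (- t * s * s) + \<alpha> * \<epsilon> * exp (- t * s * (- s)) + (1 - \<alpha>) * exp (- t * s * 0))"
          by (rule nn[OF s]) auto
        also have "\<alpha> * (1 - \<epsilon>) * exp (- t * s * s) + \<alpha> * \<epsilon> * exp (- t * s * (- s)) + (1 - \<alpha>) * exp (- t * s * 0) = 1 - I"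
        proof -
          have "exp (- t * s * s) = 1 / \<rho>" using ss t(2) by (simp add: mult.assoc exp_minus inverse_eq_divide)
          moreover have "exp (- t * s * (- s)) = \<rho>" using ss t(2) by (simp add: mult.assoc)
          ultimately have "\<alpha> * (1 - \<epsilon>) * exp (- t * s * s) + \<alpha> * \<epsilon> * exp (- t * s * (- s)) + (1 - \<alpha>) * exp (- t * s * 0)
            = \<alpha> * ((1 - \<epsilon>) / \<rho>) + \<alpha> * (\<epsilon> * \<rho>) + (1 - \<alpha>)" by simp
          also have "\<dots> = 1 - I" unfolding hr I \<eta>h by (simp add: algebra_simps)
          finally show ?thesis .
        qed
        also have "ennreal (1 - I) \<le> ennreal (exp (s * 0 - I))"
          using exp_ge_add_one_self[of "- I"] by (intro ennreal_leI) simp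
        finally show "(\<integral>\<^sup>+x. ennreal (exp (- t * (\<sigma> $ i * \<sigma> $ j) * x)) \<partial>censored_entry \<alpha> \<epsilon> (\<sigma> $ i * \<sigma> $ j)) \<le> ennreal (exp (\<sigma> $ i * \<sigma> $ j * 0 - I))"
          by (simp add: s_def)
      next
        fix i j assume ij: "i < j" "j < n"
        define s where "s = \<sigma> $ i * \<sigma> $ j"
        have s: "s = 1 \<or> s = -1" using label_prod[OF \<sigma>, of i j] ij by (simp add: s_def)
        then have ss: "s * s = 1" by auto
        have "(\<integral>\<^sup>+x. ennreal (exp (- (2 * t) * s * x)) \<partial>censored_entry \<alpha> \<epsilon> s)
          = ennreal (\<alpha> * (1 - \<epsilon>) * exp (- (2 * t) * s * s) + \<alpha> * \<epsilon> * exp (- (2 * t) * s * (- s)) + (1 - \<alpha>) * exp (- (2 * t) * s * 0))"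
          by (rule nn[OF s]) auto
        also have "\<alpha> * (1 - \<epsilon>) * exp (- (2 * t) * s * s) + \<alpha> * \<epsilon> * exp (- (2 * t) * s * (- s)) + (1 - \<alpha>) * exp (- (2 * t) * s * 0) = 1"
        proof -
          have e2: "exp (2 * t) = (1 - \<epsilon>) / \<epsilon>" using t(2) \<rho>(2) by (simp add: exp_double)
          have "exp (- (2 * t) * s * s) = \<epsilon> / (1 - \<epsilon>)" using ss e2 by (simp add: mult.assoc exp_minus)
          moreover have "exp (- (2 * t) * s * (- s)) = (1 - \<epsilon>) / \<epsilon>" using ss e2 by (simp add: mult.assoc)
          moreover have "\<alpha> * (1 - \<epsilon>) * (\<epsilon> / (1 - \<epsilon>)) = \<alpha> * \<epsilon>" "\<alpha> * \<epsilon> * ((1 - \<epsilon>) / \<epsilon>) = \<alpha> * (1 - \<epsilon>)"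
            using \<epsilon> by auto
          moreover have "exp (- (2 * t) * s * 0) = 1" by simp
          ultimately show ?thesis by (simp only: right_diff_distrib) simp
        qed
        finally show "(\<integral>\<^sup>+x. ennreal (exp (- (2 * t) * (\<sigma> $ i * \<sigma> $ j) * x)) \<partial>censored_entry \<alpha> \<epsilon> (\<sigma> $ i * \<sigma> $ j)) \<le> ennreal (exp (2 * (\<sigma> $ i * \<sigma> $ j * 0)))"
          by (simp add: s_def)
      next
        have sn: "sqrt (n * I) = sqrt \<eta> * sqrt (n * \<alpha>)" by (simp add: I real_sqrt_mult mult_ac)
        have "t * Cs / sqrt \<eta> \<le> a" using Cs \<eta>0 \<epsilon> by (simp add: a_def)
        then have "t * Cs / sqrt \<eta> * (sqrt \<eta> * sqrt (n * \<alpha>)) \<le> a * (sqrt \<eta> * sqrt (n * \<alpha>))"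
          using \<eta>0 \<alpha> by (intro mult_right_mono) auto
        then show "t * (Cs * sqrt (n * \<alpha>)) \<le> a * sqrt (n * I)" using \<eta>0 by (simp add: sn mult.assoc)
        have "Cs * sqrt \<eta> / (1 - 2 * \<epsilon>) \<le> a" using Cs \<eta>0 \<epsilon> t by (simp add: a_def)
        then have "Cs * sqrt \<eta> \<le> a * (1 - 2 * \<epsilon>)" using \<epsilon> by (simp add: pos_divide_le_eq)
        then have le: "(Cs * sqrt \<eta>) * (n * \<alpha>) \<le> (a * (1 - 2 * \<epsilon>)) * (n * \<alpha>)" using \<alpha> by (intro mult_right_mono) auto
        have "sqrt (n * \<alpha>) * sqrt (n * \<alpha>) = n * \<alpha>" using \<alpha> by simp
        then have eq1: "Cs * sqrt (n * \<alpha>) * sqrt (n * I) = (Cs * sqrt \<eta>) * (n * \<alpha>)"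
          unfolding sn by (metis mult.assoc mult.left_commute)
        have eq2: "a * n * c = (a * (1 - 2 * \<epsilon>)) * (n * \<alpha>)" by (simp add: c_def)
        show "Cs * sqrt (n * \<alpha>) * sqrt (n * I) \<le> a * n * c" unfolding eq1 eq2 by (rule le)
        have "\<exists>E\<in>events. 1 - 9 * exp (- sqrt (ln n)) \<le> prob E \<and>
          (\<forall>\<omega>\<in>E. form_bound n (\<lambda>i j. obs \<omega> i j - c * (\<sigma> $ i * \<sigma> $ j)) (n * I) ((394 + heavy_const + 72 * 1) * sqrt (n * \<alpha>)))"
        proof (rule sparse_form_event)
          fix u :: real and i j :: nat assume ij: "i \<le> j" "j < n" and u: "\<bar>u\<bar> \<le> 1"
          define s where "s = \<sigma> $ i * \<sigma> $ j"
          have s: "s = 1 \<or> s = -1" using label_prod[OF \<sigma>, of i j] ij by (simp add: s_def)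
          have us: "\<bar>u * s\<bar> \<le> 1" "\<bar>u * (- s)\<bar> \<le> 1" "(u * s)\<^sup>2 = u\<^sup>2" "(u * (- s))\<^sup>2 = u\<^sup>2" using u s by auto
          have "(\<integral>\<^sup>+x. ennreal (exp (u * (x - c * s))) \<partial>censored_entry \<alpha> \<epsilon> s)
            = ennreal (\<alpha> * (1 - \<epsilon>) * exp (u * (s - c * s)) + \<alpha> * \<epsilon> * exp (u * (- s - c * s)) + (1 - \<alpha>) * exp (u * (0 - c * s)))"
            by (rule nn[OF s]) auto
          also have "\<dots> \<le> ennreal (exp (\<alpha> * u\<^sup>2))"
          proof (rule ennreal_leI)
            have "\<alpha> * (1 - \<epsilon>) * exp (u * (s - c * s)) + \<alpha> * \<epsilon> * exp (u * (- s - c * s)) + (1 - \<alpha>) * exp (u * (0 - c * s))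
              = exp (- (u * c * s)) * (\<alpha> * (1 - \<epsilon>) * exp (u * s) + \<alpha> * \<epsilon> * exp (u * (- s)) + (1 - \<alpha>))"
              by (simp add: right_diff_distrib exp_diff exp_minus field_simps)
            also have "\<dots> \<le> exp (- (u * c * s)) * (\<alpha> * (1 - \<epsilon>) * (1 + u * s + u\<^sup>2) + \<alpha> * \<epsilon> * (1 + u * (- s) + u\<^sup>2) + (1 - \<alpha>))"
              using exp_le_quadratic[OF us(1)] exp_le_quadratic[OF us(2)] us(3,4) \<alpha> \<epsilon>
              by (intro mult_left_mono add_mono) auto
            also have "\<alpha> * (1 - \<epsilon>) * (1 + u * s + u\<^sup>2) + \<alpha> * \<epsilon> * (1 + u * (- s) + u\<^sup>2) + (1 - \<alpha>) = 1 + (u * c * s + \<alpha> * u\<^sup>2)"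
              by (simp add: c_def algebra_simps)
            also have "exp (- (u * c * s)) * (1 + (u * c * s + \<alpha> * u\<^sup>2)) \<le> exp (- (u * c * s)) * exp (u * c * s + \<alpha> * u\<^sup>2)"
              by (intro mult_left_mono exp_ge_add_one_self) auto
            also have "\<dots> = exp (\<alpha> * u\<^sup>2)" by (simp add: exp_add[symmetric])
            finally show "\<alpha> * (1 - \<epsilon>) * exp (u * (s - c * s)) + \<alpha> * \<epsilon> * exp (u * (- s - c * s)) + (1 - \<alpha>) * exp (u * (0 - c * s)) \<le> exp (\<alpha> * u\<^sup>2)" .
          qed
          finally show "(\<integral>\<^sup>+x. ennreal (exp (u * (x - c * (\<sigma> $ i * \<sigma> $ j)))) \<partial>censored_entry \<alpha> \<epsilon> (\<sigma> $ i * \<sigma> $ j)) \<le> ennreal (exp (\<alpha> * u\<^sup>2))"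
            by (simp add: s_def)
        next
          show "abs_mgf_le \<alpha>" unfolding abs_mgf_le_def
          proof (intro allI impI)
            fix u :: real and i j :: nat assume ij: "i \<le> j" "j < n" and u: "0 \<le> u"
            define s where "s = \<sigma> $ i * \<sigma> $ j"
            have s: "s = 1 \<or> s = -1" using label_prod[OF \<sigma>, of i j] ij by (simp add: s_def)
            have "(\<integral>\<^sup>+x. ennreal (exp (u * \<bar>x\<bar>)) \<partial>censored_entry \<alpha> \<epsilon> s)
              = ennreal (\<alpha> * (1 - \<epsilon>) * exp (u * \<bar>s\<bar>) + \<alpha> * \<epsilon> * exp (u * \<bar>- s\<bar>) + (1 - \<alpha>) * exp (u * \<bar>0\<bar>))"
              by (rule nn[OF s]) auto
            also have "\<alpha> * (1 - \<epsilon>) * exp (u * \<bar>s\<bar>) + \<alpha> * \<epsilon> * exp (u * \<bar>- s\<bar>) + (1 - \<alpha>) * exp (u * \<bar>0\<bar>) = 1 + \<alpha> * (exp u - 1)"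
              using s by (auto simp: algebra_simps)
            also have "ennreal \<dots> \<le> ennreal (exp (\<alpha> * (exp u - 1)))" by (intro ennreal_leI exp_ge_add_one_self)
            finally show "(\<integral>\<^sup>+x. ennreal (exp (u * \<bar>x\<bar>)) \<partial>censored_entry \<alpha> \<epsilon> (\<sigma> $ i * \<sigma> $ j)) \<le> ennreal (exp (\<alpha> * (exp u - 1)))"
              by (simp add: s_def)
          qed
        next
          fix i j assume "i < n" "j < n"
          then have "\<bar>\<sigma> $ i * \<sigma> $ j\<bar> = 1" using label_prod[OF \<sigma>, of i j] by auto
          then show "\<bar>c * (\<sigma> $ i * \<sigma> $ j)\<bar> \<le> \<alpha>" unfolding abs_mult[of c] using c by simp
        next
          show "1 \<le> n * \<alpha>" using nI nI\<alpha> by (simp add: I_def)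
        qed (use nI\<alpha> I0 False in \<open>auto simp: mult.commute\<close>)
        then show "\<exists>E\<in>events. 1 - 9 * exp (- sqrt (ln n)) \<le> prob E \<and>
          (\<forall>\<omega>\<in>E. form_bound n (\<lambda>i j. obs \<omega> i j - (c * (\<sigma> $ i * \<sigma> $ j) + 0)) (n * I) (Cs * sqrt (n * \<alpha>)))"
          by (simp add: Cs_def)
      qed (use t nI a0 I0 c in \<open>auto simp: I_def\<close>)
    qed
  qed
  then show ?thesis using a0 by blast
qed

section \<open>The stochastic block model\<close>

lemma sbm_entry_nn_integral:
  assumes "0 \<le> q" "q \<le> 1" "0 \<le> p" "p \<le> 1" and f: "f \<in> borel_measurable borel" "\<And>x. 0 \<le> f x"
  shows "(\<integral>\<^sup>+x. ennreal (f x) \<partial>sbm_entry p q s) =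
    ennreal ((if s = 1 then p else q) * f 1 + (1 - (if s = 1 then p else q)) * f 0)"
proof -
  define r where "r = (if s = 1 then p else q)"
  have r: "0 \<le> r" "r \<le> 1" using assms by (auto simp: r_def)
  have "(\<integral>\<^sup>+x. ennreal (f x) \<partial>sbm_entry p q s) = (\<integral>\<^sup>+b. ennreal (f (of_bool b)) \<partial>measure_pmf (bernoulli_pmf r))"
    unfolding sbm_entry_def nn_integral_borel_of_pmf[OF f(1)] r_def[symmetric] by (rule nn_integral_map_pmf)
  also have "\<dots> = ennreal (f 1) * r + ennreal (f 0) * (1 - r)"
    using nn_integral_bernoulli_pmf[OF r, of "\<lambda>b. ennreal (f (of_bool b))"] by simp
  also have "\<dots> = ennreal (r * f 1 + (1 - r) * f 0)"
    using r f(2) by (simp add: ennreal_mult[symmetric] ennreal_plus[symmetric] mult.commute del: ennreal_plus)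
  finally show ?thesis by (simp add: r_def)
qed

text \<open>Everything is compared with \<open>(p - q)^2 / p\<close>, squared signal over variance.
  \<open>2 * (1 - g)\<close> is a squared Hellinger distance of two Bernoulli laws, written as a sum
  of two squares; \<open>- ln g\<close> is comparable to \<open>1 - g\<close> because
  \<open>g \<ge> 1 - p \<ge> c\<^sub>1\<close>. The ratio bound \<open>q \<ge> c\<^sub>0 * p\<close>
  controls the optimal tilt in the last claim.\<close>

lemma sbm_info_bounds:
  fixes p q c\<^sub>0 c\<^sub>1 :: real
  assumes c: "0 < c\<^sub>0" "0 < c\<^sub>1" and pq: "0 < c\<^sub>0 * p" "c\<^sub>0 * p \<le> q" "q < p" "p \<le> 1 - c\<^sub>1"
  defines "g \<equiv> sqrt (p * q) + sqrt ((1 - p) * (1 - q))"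
  shows "0 < g" "sbm_info p q = - 2 * ln g"
    and "(p - q)\<^sup>2 / (4 * p) \<le> sbm_info p q" "sbm_info p q \<le> 2 / c\<^sub>1\<^sup>2 * ((p - q)\<^sup>2 / p)"
    and "(ln (p / q) + ln ((1 - q) / (1 - p))) / 2 \<le> (1 / c\<^sub>0 + 1 / c\<^sub>1) / 2 * ((p - q) / p)"
proof -
  have p: "0 < p" "p < 1" "0 < q" "q < 1"
  proof -
    show "0 < p" using pq(1) c by (simp add: zero_less_mult_iff)
    show "p < 1" "0 < q" "q < 1" using pq c by linarith+
  qed
  have c1: "c\<^sub>1 \<le> 1 - p" "c\<^sub>1 < 1" using pq p by auto
  have sp: "sqrt p > 0" "sqrt q > 0" "sqrt (1 - p) > 0" "sqrt (1 - q) > 0" using p by auto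
  have hel: "(sqrt p - sqrt q)\<^sup>2 + (sqrt (1 - p) - sqrt (1 - q))\<^sup>2 = 2 * (1 - g)"
    unfolding g_def real_sqrt_mult power2_diff using p by (simp add: algebra_simps)
  have gp: "1 - p \<le> g"
  proof -
    have "(1 - p) * (1 - p) \<le> (1 - p) * (1 - q)" using p pq by (intro mult_left_mono) auto
    then have "sqrt ((1 - p) * (1 - p)) \<le> sqrt ((1 - p) * (1 - q))" by (rule real_sqrt_le_mono)
    moreover have "0 \<le> sqrt (p * q)" "sqrt ((1 - p) * (1 - p)) = 1 - p" using p by simp_all
    ultimately show ?thesis unfolding g_def by linarith
  qed
  then show g0: "0 < g" using p by simp
  show I: "sbm_info p q = - 2 * ln g" by (simp add: sbm_info_def g_def)
  have d1: "(sqrt p - sqrt q) * (sqrt p + sqrt q) = p - q" using p by (simp add: algebra_simps)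
  have "ln g \<le> g - 1" using g0 by (rule ln_le_minus_one)
  then have "2 * (1 - g) \<le> sbm_info p q" unfolding I by simp
  moreover have "(sqrt p - sqrt q)\<^sup>2 \<le> 2 * (1 - g)" unfolding hel[symmetric] by simp
  moreover have "(p - q)\<^sup>2 / (4 * p) \<le> (sqrt p - sqrt q)\<^sup>2"
  proof -
    have "sqrt p + sqrt q \<le> 2 * sqrt p" using pq by simp
    then have "(sqrt p + sqrt q)\<^sup>2 \<le> (2 * sqrt p)\<^sup>2" using sp by (intro power_mono) auto
    then have "(sqrt p + sqrt q)\<^sup>2 \<le> 4 * p" using p by (simp add: power_mult_distrib)
    then have "(sqrt p - sqrt q)\<^sup>2 * (sqrt p + sqrt q)\<^sup>2 \<le> (sqrt p - sqrt q)\<^sup>2 * (4 * p)" by (intro mult_left_mono) auto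
    then have "(p - q)\<^sup>2 \<le> (sqrt p - sqrt q)\<^sup>2 * (4 * p)" unfolding power_mult_distrib[symmetric] d1 .
    then show ?thesis using p by (simp add: pos_divide_le_eq)
  qed
  ultimately show "(p - q)\<^sup>2 / (4 * p) \<le> sbm_info p q" by linarith
  have e1: "(sqrt p - sqrt q)\<^sup>2 \<le> (p - q)\<^sup>2 / p"
  proof -
    have "(sqrt p)\<^sup>2 \<le> (sqrt p + sqrt q)\<^sup>2" using sp by (intro power_mono) auto
    then have "(sqrt p - sqrt q)\<^sup>2 * p \<le> (sqrt p - sqrt q)\<^sup>2 * (sqrt p + sqrt q)\<^sup>2" using p by (intro mult_left_mono) auto
    then have "(sqrt p - sqrt q)\<^sup>2 * p \<le> (p - q)\<^sup>2" unfolding power_mult_distrib[symmetric] d1 .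
    then show ?thesis using p by (simp add: pos_le_divide_eq)
  qed
  have d2: "(sqrt (1 - p) - sqrt (1 - q)) * (sqrt (1 - p) + sqrt (1 - q)) = q - p" using p by (simp add: algebra_simps)
  have e2: "(sqrt (1 - p) - sqrt (1 - q))\<^sup>2 \<le> (p - q)\<^sup>2 / (c\<^sub>1 * p)"
  proof -
    have "c\<^sub>1 * p \<le> (1 - p) * 1" using c1 c p by (intro mult_mono) auto
    also have "\<dots> = (sqrt (1 - p))\<^sup>2" using p by simp
    also have "\<dots> \<le> (sqrt (1 - p) + sqrt (1 - q))\<^sup>2" using sp by (intro power_mono) auto
    finally have "(sqrt (1 - p) - sqrt (1 - q))\<^sup>2 * (c\<^sub>1 * p) \<le> (sqrt (1 - p) - sqrt (1 - q))\<^sup>2 * (sqrt (1 - p) + sqrt (1 - q))\<^sup>2"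
      by (intro mult_left_mono) auto
    then have "(sqrt (1 - p) - sqrt (1 - q))\<^sup>2 * (c\<^sub>1 * p) \<le> (q - p)\<^sup>2" unfolding power_mult_distrib[symmetric] d2 .
    then show ?thesis using p c by (simp add: pos_le_divide_eq power2_commute[of q p])
  qed
  have e1': "(p - q)\<^sup>2 / p \<le> (p - q)\<^sup>2 / (c\<^sub>1 * p)"
    using p c c1 by (intro divide_left_mono) (auto simp: mult_le_cancel_right1)
  have "2 * (1 - g) \<le> 2 * ((p - q)\<^sup>2 / (c\<^sub>1 * p))" unfolding hel[symmetric] using e1 e2 e1' by linarith
  then have h1: "1 - g \<le> (p - q)\<^sup>2 / (c\<^sub>1 * p)" by simp
  have "ln (1 / g) \<le> 1 / g - 1" using g0 by (intro ln_le_minus_one) auto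
  then have "- ln g \<le> 1 / g - 1" using g0 by (simp add: ln_div)
  also have "\<dots> = (1 - g) / g" using g0 by (simp add: field_simps)
  also have "\<dots> \<le> (p - q)\<^sup>2 / (c\<^sub>1 * p) / c\<^sub>1"
    using h1 g0 gp c1 c p by (intro frac_le) auto
  finally have "- ln g \<le> (p - q)\<^sup>2 / (c\<^sub>1 * p) / c\<^sub>1" .
  moreover have "2 / c\<^sub>1\<^sup>2 * ((p - q)\<^sup>2 / p) = 2 * ((p - q)\<^sup>2 / (c\<^sub>1 * p) / c\<^sub>1)"
    by (simp add: power2_eq_square[of c\<^sub>1])
  ultimately show "sbm_info p q \<le> 2 / c\<^sub>1\<^sup>2 * ((p - q)\<^sup>2 / p)" unfolding I by linarith
  have "ln (p / q) \<le> p / q - 1" "ln ((1 - q) / (1 - p)) \<le> (1 - q) / (1 - p) - 1"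
    using p by (auto intro!: ln_le_minus_one)
  moreover have "p / q - 1 = (p - q) / q" "(1 - q) / (1 - p) - 1 = (p - q) / (1 - p)" using p by (auto simp: field_simps)
  moreover have "(p - q) / q \<le> (p - q) / (c\<^sub>0 * p)" using pq p by (intro divide_left_mono) auto
  moreover have "(p - q) / (1 - p) \<le> (p - q) / (c\<^sub>1 * p)"
  proof (rule divide_left_mono)
    have "c\<^sub>1 * p \<le> (1 - p) * 1" using c1 c p by (intro mult_mono) auto
    then show "c\<^sub>1 * p \<le> 1 - p" by simp
  qed (use pq p c in auto)
  ultimately have lnsum: "ln (p / q) + ln ((1 - q) / (1 - p)) \<le> (p - q) / (c\<^sub>0 * p) + (p - q) / (c\<^sub>1 * p)" by linarith
  show "(ln (p / q) + ln ((1 - q) / (1 - p))) / 2 \<le> (1 / c\<^sub>0 + 1 / c\<^sub>1) / 2 * ((p - q) / p)"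
  proof -
    have "(p - q) / (c\<^sub>0 * p) + (p - q) / (c\<^sub>1 * p) = (1 / c\<^sub>0 + 1 / c\<^sub>1) * ((p - q) / p)"
      unfolding distrib_right times_divide_times_eq by simp
    then show ?thesis using lnsum by simp
  qed
qed

text \<open>\<open>B\<close> is chosen so that the information is at most \<open>B * p\<close>. Then
  \<open>n * I \<ge> B\<close> forces the expected degree \<open>n * p\<close> to be at least one,
  and \<nu> is bounded by \<open>B\<close> times the degree.\<close>

lemma sbm_bounds:
  fixes c\<^sub>0 c\<^sub>1 :: real
  assumes c: "0 < c\<^sub>0" "0 < c\<^sub>1"
  defines "B \<equiv> 2 / c\<^sub>1\<^sup>2"
  defines "Cs \<equiv> 394 + heavy_const + 72 * B"
  assumes a: "Cs * (1 / c\<^sub>0 + 1 / c\<^sub>1) + 4 * Cs / c\<^sub>1 \<le> a"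
    and n: "1 \<le> n" and \<sigma>: "label_vec n \<sigma>" and bal: "balanced n \<sigma>"
    and pq: "0 < c\<^sub>0 * p" "c\<^sub>0 * p \<le> q" "q < p" "p \<le> 1 - c\<^sub>1" and nI: "6 + B \<le> n * sbm_info p q"
  shows "sdp_error_bounds n (sbm_entry p q) (sdp_feasible_balanced n) \<sigma> (sbm_info p q) (n / 2) (3 * a + 16) (3 * a + 20)"
proof -
  interpret entry_model n "sbm_entry p q" \<sigma>
  proof (intro entry_model.intro)
    show "prob_space (sbm_entry p q s)" for s unfolding sbm_entry_def by (rule prob_space_borel_of_pmf)
    show "sets (sbm_entry p q s) = sets borel" for s unfolding sbm_entry_def by (rule sets_borel_of_pmf)
  qed (use n \<sigma> in auto)
  have p: "0 < p" "p < 1" "0 < q" "q < 1"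
  proof -
    show "0 < p" using pq(1) c by (simp add: zero_less_mult_iff)
    show "p < 1" "0 < q" "q < 1" using pq c by linarith+
  qed
  define g where "g = sqrt (p * q) + sqrt ((1 - p) * (1 - q))"
  note ib = sbm_info_bounds[OF c pq, folded g_def]
  define I where "I = sbm_info p q"
  have B0: "B > 0" using c by (simp add: B_def)
  have Cs0: "Cs > 0" using B0 by (simp add: Cs_def heavy_const_def add_pos_pos)
  have a1: "Cs * (1 / c\<^sub>0 + 1 / c\<^sub>1) \<le> a" and a2: "4 * Cs / c\<^sub>1 \<le> a"
  proof -
    have "0 \<le> Cs * (1 / c\<^sub>0 + 1 / c\<^sub>1)" "0 \<le> 4 * Cs / c\<^sub>1" using Cs0 c by auto
    then show "Cs * (1 / c\<^sub>0 + 1 / c\<^sub>1) \<le> a" "4 * Cs / c\<^sub>1 \<le> a" using a by linarith+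
  qed
  have a0: "a \<ge> 0" using a2 Cs0 c by (meson divide_nonneg_pos le_less_trans less_eq_real_def mult_nonneg_nonneg order_trans zero_le_numeral)
  define \<delta> where "\<delta> = p - q"
  have \<delta>: "\<delta> > 0" "\<delta> \<le> p" using pq p by (auto simp: \<delta>_def)
  have I1: "\<delta>\<^sup>2 / (4 * p) \<le> I" and I2: "I \<le> B * (\<delta>\<^sup>2 / p)" using ib(3,4) by (auto simp: I_def \<delta>_def B_def)
  have I0: "I > 0"
  proof -
    have "0 < \<delta>\<^sup>2 / (4 * p)" using \<delta> p by simp
    then show ?thesis using I1 by linarith
  qed
  have IBp: "I \<le> B * p"
  proof -
    have "\<delta>\<^sup>2 \<le> p * p" using \<delta> unfolding power2_eq_square by (intro mult_mono) auto
    then have "\<delta>\<^sup>2 / p \<le> p" using p by (simp add: pos_divide_le_eq)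
    then have "B * (\<delta>\<^sup>2 / p) \<le> B * p" using B0 by (intro mult_left_mono) auto
    then show ?thesis using I2 by linarith
  qed
  then have nIB: "n * I \<le> B * (n * p)" using mult_left_mono[OF IBp, of "real n"] by (simp add: mult_ac)
  have np: "1 \<le> n * p"
  proof -
    have "B * 1 \<le> B * (n * p)" using nI nIB by (simp add: I_def)
    then show ?thesis using B0 by (simp only: mult_le_cancel_left_pos)
  qed
  show ?thesis
  proof (cases "ln n < 1")
    case True
    then show ?thesis by (rule sdp_error_bounds_of_small_n)
  next
    case False
    \<comment> \<open>At \<open>t = ln \<rho>\<close> the moments for equal and for opposite labels
      are \<open>r * g\<close> and \<open>g / r\<close>. The offset \<open>\<kappa> = ln r\<close>
      cancels over a balanced row and leaves \<open>g = exp (- I / 2)\<close> for both; hence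
      \<open>J = I / 2\<close> and the effective size \<open>n / 2\<close>.\<close>
    define \<rho> where "\<rho> = sqrt (p * (1 - q) / (q * (1 - p)))"
    define r where "r = sqrt ((1 - p) / (1 - q))"
    have r0: "r > 0" "r\<^sup>2 = (1 - p) / (1 - q)" using p by (auto simp: r_def)
    have "q * (1 - p) < p * (1 - q)" using pq by (simp add: algebra_simps)
    then have gt1: "p * (1 - q) / (q * (1 - p)) > 1" using p by (simp add: less_divide_eq)
    then have \<rho>: "\<rho> > 1" "\<rho>\<^sup>2 = p * (1 - q) / (q * (1 - p))" by (auto simp: \<rho>_def)
    define t where "t = ln \<rho>"
    define \<kappa> where "\<kappa> = ln r"
    have t: "t > 0" "exp t = \<rho>" using \<rho>(1) by (auto simp: t_def)
    have \<kappa>: "exp \<kappa> = r" using r0 by (simp add: \<kappa>_def)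
    have teq: "t = (ln (p / q) + ln ((1 - q) / (1 - p))) / 2"
    proof -
      have "t = ln (p * (1 - q) / (q * (1 - p))) / 2" using gt1 by (simp add: t_def \<rho>_def ln_sqrt)
      also have "p * (1 - q) / (q * (1 - p)) = (p / q) * ((1 - q) / (1 - p))" by simp
      also have "ln \<dots> = ln (p / q) + ln ((1 - q) / (1 - p))" by (rule ln_mult_pos) (use p in auto)
      finally show ?thesis .
    qed
    have eJ: "exp (- (I / 2)) = g" using ib(1,2) by (simp add: I_def)
    have rg: "r * g = p / \<rho> + (1 - p)" "g / r = q * \<rho> + (1 - q)"
    proof -
      have A: "r * sqrt ((1 - p) * (1 - q)) = 1 - p" "sqrt ((1 - p) * (1 - q)) / r = 1 - q"
      proof -
        have "r * sqrt ((1 - p) * (1 - q)) = sqrt ((1 - p)\<^sup>2)"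
          unfolding r_def real_sqrt_mult[symmetric] using p by (simp add: power2_eq_square)
        then show "r * sqrt ((1 - p) * (1 - q)) = 1 - p" using p by simp
        have "sqrt ((1 - p) * (1 - q)) / r = sqrt ((1 - q)\<^sup>2)"
          unfolding r_def real_sqrt_divide[symmetric] using p by (simp add: power2_eq_square)
        then show "sqrt ((1 - p) * (1 - q)) / r = 1 - q" using p by simp
      qed
      have Bq: "q * \<rho> = sqrt (p * q) / r"
      proof -
        have "sqrt (p * q) / r = sqrt (q\<^sup>2 * (p * (1 - q) / (q * (1 - p))))"
          unfolding r_def real_sqrt_divide[symmetric] using p by (simp add: power2_eq_square field_simps)
        also have "\<dots> = q * \<rho>" unfolding real_sqrt_mult \<rho>_def using p by simp
        finally show ?thesis by simp
      qed
      have Bp: "p / \<rho> = r * sqrt (p * q)"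
      proof -
        have "r * sqrt (p * q) = sqrt (p\<^sup>2 / (p * (1 - q) / (q * (1 - p))))"
          unfolding r_def real_sqrt_mult[symmetric] using p by (simp add: power2_eq_square field_simps)
        also have "\<dots> = p / \<rho>" unfolding real_sqrt_divide[of "p\<^sup>2"] \<rho>_def using p by simp
        finally show ?thesis by simp
      qed
      show "r * g = p / \<rho> + (1 - p)" unfolding g_def distrib_left A Bp ..
      show "g / r = q * \<rho> + (1 - q)" unfolding g_def add_divide_distrib A Bq ..
    qed
    note nn = sbm_entry_nn_integral[OF less_imp_le[OF p(3)] less_imp_le[OF p(4)] less_imp_le[OF p(1)] less_imp_le[OF p(2)]]
    have lp: "\<sigma> $ i * \<sigma> $ j = 1 \<or> \<sigma> $ i * \<sigma> $ j = -1" if "i \<le> j" "j < n" for i j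
      using label_prod[OF \<sigma>, of i j] that by auto
    show ?thesis
    proof (rule sdp_error_bounds_of_form_event[where t = t and \<kappa> = \<kappa> and J = "I / 2" and c\<^sub>1 = "\<delta> / 2" and c\<^sub>2 = "(p + q) / 2"
        and \<theta> = "Cs * sqrt (n * p)"], unfold I_def[symmetric])
      fix i j assume ij: "i \<le> j" "j < n"
      define s where "s = \<sigma> $ i * \<sigma> $ j"
      have s: "s = 1 \<or> s = -1" using lp[OF ij] by (simp add: s_def)
      have "(\<integral>\<^sup>+x. ennreal (exp (- t * s * x)) \<partial>sbm_entry p q s)
        = ennreal ((if s = 1 then p else q) * exp (- t * s * 1) + (1 - (if s = 1 then p else q)) * exp (- t * s * 0))"
        by (rule nn) auto
      also have "(if s = 1 then p else q) * exp (- t * s * 1) + (1 - (if s = 1 then p else q)) * exp (- t * s * 0) = exp (s * \<kappa> - I / 2)"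
        using s
      proof
        assume "s = 1"
        have "exp (\<kappa> - I / 2) = r * g"
          using exp_add[of \<kappa> "- (I / 2)"] unfolding \<kappa> eJ by simp
        then show ?thesis using \<open>s = 1\<close> t(2) rg(1) exp_minus[of t] by (simp add: inverse_eq_divide)
      next
        assume s1: "s = -1"
        have "- \<kappa> - I / 2 = - (I / 2) - \<kappa>" by linarith
        then have "exp (- \<kappa> - I / 2) = g / r"
          using exp_diff[of "- (I / 2)" \<kappa>] unfolding \<kappa> eJ by (simp only:)
        then show ?thesis unfolding s1 using rg(2) t(2) by simp
      qed
      finally show "(\<integral>\<^sup>+x. ennreal (exp (- t * (\<sigma> $ i * \<sigma> $ j) * x)) \<partial>sbm_entry p q (\<sigma> $ i * \<sigma> $ j)) \<le> ennreal (exp (\<sigma> $ i * \<sigma> $ j * \<kappa> - I / 2))"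
        by (simp add: s_def)
    next
      fix i j assume ij: "i < j" "j < n"
      define s where "s = \<sigma> $ i * \<sigma> $ j"
      have s: "s = 1 \<or> s = -1" using lp[of i j] ij by (simp add: s_def)
      have e2: "exp (2 * t) = p * (1 - q) / (q * (1 - p))" "exp (2 * \<kappa>) = (1 - p) / (1 - q)"
        using t(2) \<rho>(2) \<kappa> r0(2) by (simp_all add: exp_double)
      have "(\<integral>\<^sup>+x. ennreal (exp (- (2 * t) * s * x)) \<partial>sbm_entry p q s)
        = ennreal ((if s = 1 then p else q) * exp (- (2 * t) * s * 1) + (1 - (if s = 1 then p else q)) * exp (- (2 * t) * s * 0))"
        by (rule nn) auto
      also have "(if s = 1 then p else q) * exp (- (2 * t) * s * 1) + (1 - (if s = 1 then p else q)) * exp (- (2 * t) * s * 0) = exp (2 * (s * \<kappa>))"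
        using s
      proof
        assume s1: "s = 1"
        have "p * exp (- (2 * t)) = q * (1 - p) / (1 - q)" unfolding exp_minus e2 using p by simp
        moreover have "q * (1 - p) / (1 - q) + (1 - p) = (1 - p) / (1 - q)" using p by (simp add: field_simps)
        ultimately show ?thesis unfolding s1 using e2(2) by simp
      next
        assume s1: "s = -1"
        have "q * exp (2 * t) = p * (1 - q) / (1 - p)" unfolding e2 using p by simp
        moreover have "p * (1 - q) / (1 - p) + (1 - q) = (1 - q) / (1 - p)" using p by (simp add: field_simps)
        moreover have "exp (2 * (- 1 * \<kappa>)) = (1 - q) / (1 - p)" using exp_minus[of "2 * \<kappa>"] unfolding e2 by simp
        ultimately show ?thesis unfolding s1 by simp
      qed
      finally show "(\<integral>\<^sup>+x. ennreal (exp (- (2 * t) * (\<sigma> $ i * \<sigma> $ j) * x)) \<partial>sbm_entry p q (\<sigma> $ i * \<sigma> $ j)) \<le> ennreal (exp (2 * (\<sigma> $ i * \<sigma> $ j * \<kappa>)))"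
        by (simp add: s_def)
    next
      show "\<kappa> * (\<Sum>i<n. \<sigma> $ i) = 0" using bal by (simp add: balanced_def)
      show "sdp_feasible_balanced n \<subseteq> sdp_feasible n" by (auto simp: sdp_feasible_balanced_def)
      show "(p + q) / 2 = 0 \<or> balanced n \<sigma> \<and> sdp_feasible_balanced n \<subseteq> sdp_feasible_balanced n" using bal by simp
      show "t * (Cs * sqrt (n * p)) \<le> a * sqrt (n * I)"
      proof -
        have t1: "t \<le> (1 / c\<^sub>0 + 1 / c\<^sub>1) / 2 * (\<delta> / p)" using ib(5) by (simp add: teq \<delta>_def)
        have "\<delta> / p * sqrt (n * p) = sqrt ((\<delta> / p)\<^sup>2 * (n * p))"
          unfolding real_sqrt_mult[of "(\<delta> / p)\<^sup>2"] using \<delta> p by simp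
        also have "(\<delta> / p)\<^sup>2 * (n * p) = 4 * (n * (\<delta>\<^sup>2 / (4 * p)))" using p by (simp add: power2_eq_square)
        also have "sqrt \<dots> \<le> sqrt (4 * (n * I))" using I1 by (intro real_sqrt_le_mono mult_left_mono) auto
        finally have dd: "\<delta> / p * sqrt (n * p) \<le> 2 * sqrt (n * I)" by (simp add: real_sqrt_mult)
        have "t * (Cs * sqrt (n * p)) \<le> (1 / c\<^sub>0 + 1 / c\<^sub>1) / 2 * (\<delta> / p) * (Cs * sqrt (n * p))"
          using t1 Cs0 p by (intro mult_right_mono) auto
        also have "\<dots> = Cs * (1 / c\<^sub>0 + 1 / c\<^sub>1) / 2 * (\<delta> / p * sqrt (n * p))" by simp
        also have "\<dots> \<le> Cs * (1 / c\<^sub>0 + 1 / c\<^sub>1) / 2 * (2 * sqrt (n * I))"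
          using dd Cs0 c by (intro mult_left_mono) auto
        also have "\<dots> = Cs * (1 / c\<^sub>0 + 1 / c\<^sub>1) * sqrt (n * I)" by simp
        also have "\<dots> \<le> a * sqrt (n * I)" using a1 I0 by (intro mult_right_mono) auto
        finally show ?thesis .
      qed
      show "Cs * sqrt (n * p) * sqrt (n * I) \<le> a * n * (\<delta> / 2)"
      proof -
        have "sqrt (n * p) * sqrt (n * I) = sqrt (n * n * (p * I))" unfolding real_sqrt_mult[symmetric] by (simp add: mult_ac)
        also have "\<dots> \<le> sqrt ((n * (2 / c\<^sub>1 * \<delta>))\<^sup>2)"
        proof (rule real_sqrt_le_mono)
          have "p * I \<le> p * (B * (\<delta>\<^sup>2 / p))" using I2 p by (intro mult_left_mono) auto
          also have "\<dots> = 2 / c\<^sub>1\<^sup>2 * \<delta>\<^sup>2" using p by (simp add: B_def)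
          also have "\<dots> \<le> 4 / c\<^sub>1\<^sup>2 * \<delta>\<^sup>2" by (intro mult_right_mono divide_right_mono) auto
          also have "\<dots> = (2 / c\<^sub>1 * \<delta>)\<^sup>2" by (simp add: power_mult_distrib power_divide)
          finally have "n * n * (p * I) \<le> n * n * (2 / c\<^sub>1 * \<delta>)\<^sup>2" by (intro mult_left_mono) auto
          then show "n * n * (p * I) \<le> (n * (2 / c\<^sub>1 * \<delta>))\<^sup>2" by (simp add: power_mult_distrib power2_eq_square mult_ac)
        qed
        also have "\<dots> = n * (2 / c\<^sub>1 * \<delta>)" using \<delta> c by simp
        finally have "Cs * (sqrt (n * p) * sqrt (n * I)) \<le> Cs * (n * (2 / c\<^sub>1 * \<delta>))" using Cs0 by (intro mult_left_mono) auto
        also have "\<dots> = 4 * Cs / c\<^sub>1 * (n * (\<delta> / 2))" by simp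
        also have "\<dots> \<le> a * (n * (\<delta> / 2))" using a2 \<delta> by (intro mult_right_mono) auto
        finally show ?thesis by (simp add: mult.assoc)
      qed
      define \<mu> where "\<mu> = (\<lambda>i j. \<delta> / 2 * (\<sigma> $ i * \<sigma> $ j) + (p + q) / 2)"
      have \<mu>pq: "\<mu> i j = (if \<sigma> $ i * \<sigma> $ j = 1 then p else q)" if "i < n" "j < n" for i j
        using label_prod[OF \<sigma> that] by (auto simp: \<mu>_def \<delta>_def diff_divide_distrib add_divide_distrib)
      have "\<exists>E\<in>events. 1 - 9 * exp (- sqrt (ln n)) \<le> prob E \<and>
        (\<forall>\<omega>\<in>E. form_bound n (\<lambda>i j. obs \<omega> i j - \<mu> i j) (n * (I / 2)) ((394 + heavy_const + 72 * B) * sqrt (n * p)))"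
      proof (rule sparse_form_event)
        fix u :: real and i j :: nat assume ij: "i \<le> j" "j < n" and u: "\<bar>u\<bar> \<le> 1"
        define s where "s = \<sigma> $ i * \<sigma> $ j"
        define m where "m = (if s = 1 then p else q)"
        have m: "\<mu> i j = m" "0 \<le> m" "m \<le> p" using \<mu>pq[of i j] ij p pq by (auto simp: m_def s_def)
        have "(\<integral>\<^sup>+x. ennreal (exp (u * (x - m))) \<partial>sbm_entry p q s)
          = ennreal (m * exp (u * (1 - m)) + (1 - m) * exp (u * (0 - m)))"
          unfolding m_def by (rule nn) auto
        also have "\<dots> \<le> ennreal (exp (p * u\<^sup>2))"
        proof (rule ennreal_leI)
          have "m * exp (u * (1 - m)) + (1 - m) * exp (u * (0 - m)) = exp (- (u * m)) * (m * exp u + (1 - m))"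
            by (simp add: right_diff_distrib exp_diff exp_minus field_simps)
          also have "\<dots> \<le> exp (- (u * m)) * (m * (1 + u + u\<^sup>2) + (1 - m))"
            using exp_le_quadratic[OF u] m by (intro mult_left_mono add_mono) auto
          also have "m * (1 + u + u\<^sup>2) + (1 - m) = 1 + (u * m + m * u\<^sup>2)" by (simp add: algebra_simps)
          also have "exp (- (u * m)) * (1 + (u * m + m * u\<^sup>2)) \<le> exp (- (u * m)) * exp (u * m + m * u\<^sup>2)"
            by (intro mult_left_mono exp_ge_add_one_self) auto
          also have "\<dots> = exp (m * u\<^sup>2)" by (simp add: exp_add[symmetric])
          also have "\<dots> \<le> exp (p * u\<^sup>2)" using m by (simp add: mult_right_mono)
          finally show "m * exp (u * (1 - m)) + (1 - m) * exp (u * (0 - m)) \<le> exp (p * u\<^sup>2)" .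
        qed
        finally show "(\<integral>\<^sup>+x. ennreal (exp (u * (x - \<mu> i j))) \<partial>sbm_entry p q (\<sigma> $ i * \<sigma> $ j)) \<le> ennreal (exp (p * u\<^sup>2))"
          by (simp add: m(1) s_def)
      next
        show "abs_mgf_le p" unfolding abs_mgf_le_def
        proof (intro allI impI)
          fix u :: real and i j :: nat assume u: "0 \<le> u"
          define s where "s = \<sigma> $ i * \<sigma> $ j"
          define m where "m = (if s = 1 then p else q)"
          have m: "m \<le> p" using pq by (auto simp: m_def)
          have "(\<integral>\<^sup>+x. ennreal (exp (u * \<bar>x\<bar>)) \<partial>sbm_entry p q s)
            = ennreal (m * exp (u * \<bar>1\<bar>) + (1 - m) * exp (u * \<bar>0\<bar>))"
            unfolding m_def by (rule nn) auto
          also have "m * exp (u * \<bar>1\<bar>) + (1 - m) * exp (u * \<bar>0\<bar>) = 1 + m * (exp u - 1)" by (simp add: algebra_simps)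
          also have "ennreal \<dots> \<le> ennreal (exp (p * (exp u - 1)))"
          proof (rule ennreal_leI)
            have "1 + m * (exp u - 1) \<le> 1 + p * (exp u - 1)" using m u by (simp add: mult_right_mono)
            also have "\<dots> \<le> exp (p * (exp u - 1))" by (rule exp_ge_add_one_self)
            finally show "1 + m * (exp u - 1) \<le> exp (p * (exp u - 1))" .
          qed
          finally show "(\<integral>\<^sup>+x. ennreal (exp (u * \<bar>x\<bar>)) \<partial>sbm_entry p q (\<sigma> $ i * \<sigma> $ j)) \<le> ennreal (exp (p * (exp u - 1)))"
            by (simp add: s_def)
        qed
      next
        fix i j assume "i < n" "j < n"
        then show "\<bar>\<mu> i j\<bar> \<le> p" using \<mu>pq[of i j] p pq by auto
      next
        show "n * (I / 2) \<le> B * (n * p)"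
        proof -
          have "n * (I / 2) \<le> n * I" using I0 by simp
          then show ?thesis using nIB by linarith
        qed
        show "\<mu> i j = \<mu> j i" for i j by (simp add: \<mu>_def mult.commute)
      qed (use np B0 I0 False in auto)
      then show "\<exists>E\<in>events. 1 - 9 * exp (- sqrt (ln n)) \<le> prob E \<and>
        (\<forall>\<omega>\<in>E. form_bound n (\<lambda>i j. obs \<omega> i j - (\<delta> / 2 * (\<sigma> $ i * \<sigma> $ j) + (p + q) / 2)) (n * (I / 2)) (Cs * sqrt (n * p)))"
        by (simp add: Cs_def \<mu>_def)
      show "6 \<le> n * I" using nI B0 by (simp add: I_def)
    qed (use t a0 I0 \<delta> in auto)
  qed
qed

theorem theorem3:
  fixes c\<^sub>0 c\<^sub>1 :: real
  assumes "0 < c\<^sub>0" "c\<^sub>0 < 1" "0 < c\<^sub>1" "c\<^sub>1 < 1"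
  shows
    "(\<exists>C\<^sub>I>0. \<exists>C\<^sub>e>0. \<exists>C\<^sub>e'>0.
        (\<forall>n \<sigma> \<tau>. 1 \<le> n \<and> label_vec n \<sigma> \<and> 0 < \<tau> \<and> C\<^sub>I \<le> real n * sync_info \<tau> \<longrightarrow>
           sdp_error_bounds n (sync_entry \<tau>) (sdp_feasible n) \<sigma>
             (sync_info \<tau>) (real n) C\<^sub>e C\<^sub>e') \<and>
        (\<forall>n \<sigma> p q. 1 \<le> n \<and> label_vec n \<sigma> \<and> balanced n \<sigma> \<and>
           0 < c\<^sub>0 * p \<and> c\<^sub>0 * p \<le> q \<and> q < p \<and> p \<le> 1 - c\<^sub>1 \<and> C\<^sub>I \<le> real n * sbm_info p q \<longrightarrow>
           sdp_error_bounds n (sbm_entry p q) (sdp_feasible_balanced n) \<sigma>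
             (sbm_info p q) (real n / 2) C\<^sub>e C\<^sub>e')) \<and>
     (\<forall>\<epsilon>. 0 < \<epsilon> \<and> \<epsilon> < 1 / 2 \<longrightarrow>
        (\<exists>C\<^sub>I>0. \<exists>C\<^sub>e>0. \<exists>C\<^sub>e'>0.
          \<forall>n \<sigma> \<alpha>. 1 \<le> n \<and> label_vec n \<sigma> \<and> 0 < \<alpha> \<and> \<alpha> \<le> 1 \<and>
             C\<^sub>I \<le> real n * censored_info \<alpha> \<epsilon> \<longrightarrow>
             sdp_error_bounds n (censored_entry \<alpha> \<epsilon>) (sdp_feasible n) \<sigma>
               (censored_info \<alpha> \<epsilon>) (real n) C\<^sub>e C\<^sub>e'))"
proof (intro conjI allI impI)
  define B where "B = 2 / c\<^sub>1\<^sup>2"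
  define Cs where "Cs = 394 + heavy_const + 72 * B"
  \<comment> \<open>One constant for the two models treated jointly: 84 for Gaussian entries, the
    other value for the block model. Likewise \<open>6 + B\<close> meets both lower bounds on
    \<open>n * I\<close>.\<close>
  define a where "a = max 84 (Cs * (1 / c\<^sub>0 + 1 / c\<^sub>1) + 4 * Cs / c\<^sub>1)"
  have B0: "B > 0" using assms by (simp add: B_def)
  have a: "84 \<le> a" "Cs * (1 / c\<^sub>0 + 1 / c\<^sub>1) + 4 * Cs / c\<^sub>1 \<le> a" by (simp_all add: a_def)
  note sbm = sbm_bounds[OF assms(1) assms(3), folded B_def, folded Cs_def, OF a(2)]
  show "\<exists>C\<^sub>I>0. \<exists>C\<^sub>e>0. \<exists>C\<^sub>e'>0.
        (\<forall>n \<sigma> \<tau>. 1 \<le> n \<and> label_vec n \<sigma> \<and> 0 < \<tau> \<and> C\<^sub>I \<le> real n * sync_info \<tau> \<longrightarrow>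
           sdp_error_bounds n (sync_entry \<tau>) (sdp_feasible n) \<sigma>
             (sync_info \<tau>) (real n) C\<^sub>e C\<^sub>e') \<and>
        (\<forall>n \<sigma> p q. 1 \<le> n \<and> label_vec n \<sigma> \<and> balanced n \<sigma> \<and>
           0 < c\<^sub>0 * p \<and> c\<^sub>0 * p \<le> q \<and> q < p \<and> p \<le> 1 - c\<^sub>1 \<and> C\<^sub>I \<le> real n * sbm_info p q \<longrightarrow>
           sdp_error_bounds n (sbm_entry p q) (sdp_feasible_balanced n) \<sigma>
             (sbm_info p q) (real n / 2) C\<^sub>e C\<^sub>e')"
  proof (rule exI[of _ "6 + B"], rule conjI, goal_cases)
    case 2
    show ?case
    proof (rule exI[of _ "3 * a + 16"], rule conjI, goal_cases)
      case 2
      show ?case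
      proof (rule exI[of _ "3 * a + 20"], intro conjI allI impI, goal_cases)
        case (2 n \<sigma> \<tau>)
        then have "6 \<le> n * sync_info \<tau>" using B0 by linarith
        then show ?case using sync_bounds[of n \<sigma> \<tau> a] 2 a by blast
      next
        case (3 n \<sigma> p q)
        then show ?case using sbm[of n \<sigma> p q] by blast
      qed (use a in simp)
    qed (use a in simp)
  qed (use B0 in simp)
  fix \<epsilon> :: real assume \<epsilon>: "0 < \<epsilon> \<and> \<epsilon> < 1 / 2"
  then obtain a where a: "a \<ge> 0" and bd: "\<forall>n \<sigma> \<alpha>. 1 \<le> n \<and> label_vec n \<sigma> \<and> 0 < \<alpha> \<and> \<alpha> \<le> 1 \<and> 6 \<le> real n * censored_info \<alpha> \<epsilon> \<longrightarrow>
    sdp_error_bounds n (censored_entry \<alpha> \<epsilon>) (sdp_feasible n) \<sigma> (censored_info \<alpha> \<epsilon>) n (3 * a + 16) (3 * a + 20)"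
    using censored_bounds by blast
  show "\<exists>C\<^sub>I>0. \<exists>C\<^sub>e>0. \<exists>C\<^sub>e'>0.
          \<forall>n \<sigma> \<alpha>. 1 \<le> n \<and> label_vec n \<sigma> \<and> 0 < \<alpha> \<and> \<alpha> \<le> 1 \<and>
             C\<^sub>I \<le> real n * censored_info \<alpha> \<epsilon> \<longrightarrow>
             sdp_error_bounds n (censored_entry \<alpha> \<epsilon>) (sdp_feasible n) \<sigma>
               (censored_info \<alpha> \<epsilon>) (real n) C\<^sub>e C\<^sub>e'"
    by (rule exI[of _ 6], rule conjI, simp, rule exI[of _ "3 * a + 16"], rule conjI, use a in simp,
        rule exI[of _ "3 * a + 20"], rule conjI, use a in simp, rule bd)
qed

end
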